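(* Consider the six modes of convergence $$\mathrm{o},\quad \mathrm{uo},\quad \widehat\tau_{\mathrm{Orth}(E)},\quad \mathrm{SO},\quad \mathrm{SUO},\quad \mathrm{S}\widehat\tau_E$$ for nets in $\mathrm{Orth}(E)$, where $E$ is a Dedekind complete vector lattice. For an ordered pair $(c_1,c_2)$ of these six modes, let $P(c_1,c_2)$ be the statement: "for every Dedekind complete vector lattice $E$ (admitting a Hausdorff uo-Lebesgue topology in case $c_1$ or $c_2$ is one of $\widehat\tau_{\mathrm{Orth}(E)}$, $\mathrm{S}\widehat\tau_E$), every net $(T_\alpha)$ in $\mathrm{Orth}(E)$ and every $T\in\mathrm{Orth}(E)$: if $T_\alpha\to T$ in the sense of $c_1$, then $T_\alpha\to T$ in the sense of $c_2$." Then $P(c_1,c_2)$ is true exactly for the following pairs: - $c_1=\mathrm{o}$ and $c_2$ any of the six modes; - $c_1=\mathrm{uo}$ and $c_2\in\{\mathrm{uo},\widehat\tau_{\mathrm{Orth}(E)},\mathrm{SUO},\mathrm{S}\widehat\tau_E\}$; - $c_1=\widehat\tau_{\mathrm{Orth}(E)}$ and $c_2\in\{\widehat\tau_{\mathrm{Orth}(E)},\mathrm{S}\widehat\tau_E\}$; - $c_1=\mathrm{SO}$ and $c_2\in\{\mathrm{uo},\widehat\tau_{\mathrm{Orth}(E)},\mathrm{SO},\mathrm{SUO},\mathrm{S}\widehat\tau_E\}$; - $c_1=\mathrm{SUO}$ and $c_2\in\{\mathrm{uo},\widehat\tau_{\mathrm{Orth}(E)},\mathrm{SUO},\mathrm{S}\widehat\tau_E\}$;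 - $c_1=\mathrm{S}\widehat\tau_E$ and $c_2\in\{\widehat\tau_{\mathrm{Orth}(E)},\mathrm{S}\widehat\tau_E\}$. For each of the remaining pairs $(c_1,c_2)$ the statement $P(c_1,c_2)$ is false, i.e. there exist such an $E$, a net and a limit for which the implication fails.
   Context: All vector lattices are real and Archimedean. $\mathrm{Orth}(E)$ is the vector lattice of orthomorphisms on $E$, i.e. of order bounded linear operators $T:E\to E$ with $T(B)\subseteq B$ for every band $B$ of $E$. In a vector lattice $G$, a net $(x_\alpha)_{\alpha\in A}$ is order convergent to $x$ (mode o; $x_\alpha\xrightarrow{\mathrm{o}}x$) if there is a net $(y_\beta)_{\beta\in B}$ in $G$ with $y_\beta\downarrow 0$ such that for every $\beta_0\in B$ there is $\alpha_0\in A$ with $|x-x_\alpha|\le y_{\beta_0}$ for all $\alpha\ge\alpha_0$. It is unbounded order convergent to $x$ (mode uo; $x_\alpha\xrightarrow{\mathrm{uo}}x$) if $|x_\alpha-x|\wedge y\xrightarrow{\mathrm{o}}0$ for all $y\in G^+$. A uo-Lebesgue topology on $G$ is a locally solid linear topology $\tau$ on $G$ such that $x_\alpha\xrightarrow{\mathrm{uo}}0$ implies $x_\alpha\xrightarrow{\tau}0$ for every net. A vector lattice $G$ admits at most one Hausdorff uo-Lebesgue topology, denoted $\widehat\tau_G$ if it exists. For Dedekind complete $E$, $\mathrm{Orth}(E)$ admits one if and only if $E$ does. For nets in $\mathrm{Orth}(E)$, the modes o, uo and $\widehat\tau_{\mathrm{Orth}(E)}$ are taken in the vector lattice $\mathrm{Orth}(E)$.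 The strong modes are pointwise: $T_\alpha\to T$ in the sense of SO (resp. SUO, resp. $\mathrm{S}\widehat\tau_E$) means that $T_\alpha x\to Tx$ in order (resp. in unbounded order, resp. in $\widehat\tau_E$) in $E$ for every $x\in E$. *)

theory Defs
  imports "HOL-Analysis.Analysis" "HOL-Algebra.Module"
begin

section \<open>Vector lattices\<close>

text \<open>
  Vector lattices are carrier-based, so that one can quantify over them inside a formula and so
  that \<open>Orth(E)\<close> is again such a structure. The fields for multiplication and one, inherited from
  the record of modules, play no role in the notion of a vector lattice.
\<close>

definition real_ring :: "real ring" where
  "real_ring = \<lparr>carrier = UNIV, mult = (*), one = 1, zero = 0, add = (+)\<rparr>"

record 'a vlat = "(real, 'a) module" +
  vle :: "'a \<Rightarrow> 'a \<Rightarrow> bool"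

definition ord_of :: "'a vlat \<Rightarrow> 'a gorder" where
  "ord_of E = \<lparr>carrier = carrier E, eq = (=), le = vle E\<rparr>"

definition archimedean :: "'a vlat \<Rightarrow> bool" where
  "archimedean E \<longleftrightarrow>
     (\<forall>x\<in>carrier E. \<forall>y\<in>carrier E. (\<forall>n::nat. vle E (real n \<odot>\<^bsub>E\<^esub> x) y) \<longrightarrow> vle E x \<zero>\<^bsub>E\<^esub>)"

definition vector_lattice :: "'a vlat \<Rightarrow> bool" where
  "vector_lattice E \<longleftrightarrow>
     Module.module real_ring E \<and> Lattice.lattice (ord_of E) \<and>
     (\<forall>x\<in>carrier E. \<forall>y\<in>carrier E. \<forall>z\<in>carrier E.
        vle E x y \<longrightarrow> vle E (x \<oplus>\<^bsub>E\<^esub> z) (y \<oplus>\<^bsub>E\<^esub> z)) \<and>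
     (\<forall>x\<in>carrier E. \<forall>y\<in>carrier E. \<forall>r::real.
        0 \<le> r \<and> vle E x y \<longrightarrow> vle E (r \<odot>\<^bsub>E\<^esub> x) (r \<odot>\<^bsub>E\<^esub> y)) \<and>
     archimedean E"

definition dedekind_complete :: "'a vlat \<Rightarrow> bool" where
  "dedekind_complete E \<longleftrightarrow>
     (\<forall>A. A \<subseteq> carrier E \<and> A \<noteq> {} \<and> Upper (ord_of E) A \<noteq> {} \<longrightarrow>
        (\<exists>s. least (ord_of E) s (Upper (ord_of E) A)))"

definition vabs :: "'a vlat \<Rightarrow> 'a \<Rightarrow> 'a" where
  "vabs E x = x \<squnion>\<^bsub>ord_of E\<^esub> (\<ominus>\<^bsub>E\<^esub> x)"

definition solid :: "'a vlat \<Rightarrow> 'a set \<Rightarrow> bool" where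
  "solid E S \<longleftrightarrow>
     S \<subseteq> carrier E \<and> (\<forall>x\<in>S. \<forall>y\<in>carrier E. vle E (vabs E y) (vabs E x) \<longrightarrow> y \<in> S)"

definition order_ideal :: "'a vlat \<Rightarrow> 'a set \<Rightarrow> bool" where
  "order_ideal E I \<longleftrightarrow> submodule I real_ring E \<and> solid E I"

definition band :: "'a vlat \<Rightarrow> 'a set \<Rightarrow> bool" where
  "band E B \<longleftrightarrow>
     order_ideal E B \<and>
     (\<forall>D s. D \<subseteq> B \<and> D \<noteq> {} \<and> least (ord_of E) s (Upper (ord_of E) D) \<longrightarrow> s \<in> B)"


section \<open>Orthomorphisms\<close>

definition linear_operator :: "'a vlat \<Rightarrow> ('a \<Rightarrow> 'a) \<Rightarrow> bool" where
  "linear_operator E T \<longleftrightarrow>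
     (\<forall>x\<in>carrier E. T x \<in> carrier E) \<and>
     (\<forall>x\<in>carrier E. \<forall>y\<in>carrier E. T (x \<oplus>\<^bsub>E\<^esub> y) = T x \<oplus>\<^bsub>E\<^esub> T y) \<and>
     (\<forall>x\<in>carrier E. \<forall>r. T (r \<odot>\<^bsub>E\<^esub> x) = r \<odot>\<^bsub>E\<^esub> T x)"

definition order_bounded_operator :: "'a vlat \<Rightarrow> ('a \<Rightarrow> 'a) \<Rightarrow> bool" where
  "order_bounded_operator E T \<longleftrightarrow>
     (\<forall>a\<in>carrier E. \<forall>b\<in>carrier E. \<exists>c\<in>carrier E. \<exists>d\<in>carrier E.
        T ` \<lbrace>a..b\<rbrace>\<^bsub>ord_of E\<^esub> \<subseteq> \<lbrace>c..d\<rbrace>\<^bsub>ord_of E\<^esub>)"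

definition orthomorphism :: "'a vlat \<Rightarrow> ('a \<Rightarrow> 'a) \<Rightarrow> bool" where
  "orthomorphism E T \<longleftrightarrow>
     linear_operator E T \<and> order_bounded_operator E T \<and> (\<forall>B. band E B \<longrightarrow> T ` B \<subseteq> B)"

text \<open>
  Operators are taken extensional on the carrier, so that equality of operators is equality of
  HOL functions. The order is the usual operator order.
\<close>

definition Orth :: "'a vlat \<Rightarrow> ('a \<Rightarrow> 'a) vlat" where
  "Orth E =
     \<lparr>carrier = {T \<in> extensional (carrier E). orthomorphism E T},
      mult = (\<lambda>S T. compose (carrier E) S T),
      one = (\<lambda>x\<in>carrier E. x),
      zero = (\<lambda>x\<in>carrier E. \<zero>\<^bsub>E\<^esub>),
      add = (\<lambda>S T. \<lambda>x\<in>carrier E. S x \<oplus>\<^bsub>E\<^esub> T x),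
      smult = (\<lambda>r T. \<lambda>x\<in>carrier E. r \<odot>\<^bsub>E\<^esub> T x),
      vle = (\<lambda>S T. \<forall>x\<in>carrier E. vle E \<zero>\<^bsub>E\<^esub> x \<longrightarrow> vle E (S x) (T x))\<rparr>"


section \<open>Nets and their modes of convergence\<close>

text \<open>A net consists of a directed (preordered) index set \<open>A\<close> and a family indexed by it.\<close>

definition directed :: "'i set \<Rightarrow> ('i \<Rightarrow> 'i \<Rightarrow> bool) \<Rightarrow> bool" where
  "directed A lq \<longleftrightarrow>
     A \<noteq> {} \<and> reflp_on A lq \<and> transp_on A lq \<and> (\<forall>a\<in>A. \<forall>b\<in>A. \<exists>c\<in>A. lq a c \<and> lq b c)"

definition net_filter :: "'i set \<Rightarrow> ('i \<Rightarrow> 'i \<Rightarrow> bool) \<Rightarrow> 'i filter" where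
  "net_filter A lq = (INF a\<in>A. principal {b \<in> A. lq a b})"

lemma eventually_net_filter:
  assumes "directed A lq"
  shows "eventually P (net_filter A lq) \<longleftrightarrow> (\<exists>a\<in>A. \<forall>b\<in>A. lq a b \<longrightarrow> P b)"
proof -
  have "\<exists>c\<in>A. principal {d \<in> A. lq c d} \<le> inf (principal {d \<in> A. lq a d}) (principal {d \<in> A. lq b d})"
    if ab: "a \<in> A" "b \<in> A" for a b
  proof -
    obtain c where c: "c \<in> A" "lq a c" "lq b c"
      using assms ab unfolding directed_def by blast
    have "lq a d \<and> lq b d" if "d \<in> A" "lq c d" for d
      using assms ab c that unfolding directed_def by (meson transp_onD)
    with c(1) show ?thesis by auto
  qed
  then show ?thesis
    using assms unfolding net_filter_def directed_def
    by (subst eventually_INF_base) (auto simp: eventually_principal)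
qed

text \<open>
  In the definition of order convergence the index set of the dominating net \<open>y\<close> may be taken inside
  the type of the elements of \<open>G\<close>: a net decreasing to zero can be reindexed by its own range,
  ordered by the converse of the order of \<open>G\<close>.
\<close>

definition decreases_to_zero :: "'a vlat \<Rightarrow> 'b set \<Rightarrow> ('b \<Rightarrow> 'b \<Rightarrow> bool) \<Rightarrow> ('b \<Rightarrow> 'a) \<Rightarrow> bool" where
  "decreases_to_zero G B lq y \<longleftrightarrow>
     (\<forall>b\<in>B. y b \<in> carrier G) \<and>
     (\<forall>b\<in>B. \<forall>b'\<in>B. lq b b' \<longrightarrow> vle G (y b') (y b)) \<and>
     greatest (ord_of G) \<zero>\<^bsub>G\<^esub> (Lower (ord_of G) (y ` B))"

definition o_conv :: "'a vlat \<Rightarrow> 'i set \<Rightarrow> ('i \<Rightarrow> 'i \<Rightarrow> bool) \<Rightarrow> ('i \<Rightarrow> 'a) \<Rightarrow> 'a \<Rightarrow> bool" where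
  "o_conv G A lq x l \<longleftrightarrow>
     (\<exists>(B::'a set) lq' y. directed B lq' \<and> decreases_to_zero G B lq' y \<and>
        (\<forall>b0\<in>B. \<exists>a0\<in>A. \<forall>a\<in>A. lq a0 a \<longrightarrow> vle G (vabs G (l \<ominus>\<^bsub>G\<^esub> x a)) (y b0)))"

definition uo_conv :: "'a vlat \<Rightarrow> 'i set \<Rightarrow> ('i \<Rightarrow> 'i \<Rightarrow> bool) \<Rightarrow> ('i \<Rightarrow> 'a) \<Rightarrow> 'a \<Rightarrow> bool" where
  "uo_conv G A lq x l \<longleftrightarrow>
     (\<forall>y\<in>carrier G. vle G \<zero>\<^bsub>G\<^esub> y \<longrightarrow>
        o_conv G A lq (\<lambda>a. vabs G (x a \<ominus>\<^bsub>G\<^esub> l) \<sqinter>\<^bsub>ord_of G\<^esub> y) \<zero>\<^bsub>G\<^esub>)"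

definition linear_topology :: "'a vlat \<Rightarrow> 'a topology \<Rightarrow> bool" where
  "linear_topology G \<tau> \<longleftrightarrow>
     topspace \<tau> = carrier G \<and>
     continuous_map (prod_topology \<tau> \<tau>) \<tau> (\<lambda>(x, y). x \<oplus>\<^bsub>G\<^esub> y) \<and>
     continuous_map (prod_topology euclideanreal \<tau>) \<tau> (\<lambda>(r, x). r \<odot>\<^bsub>G\<^esub> x)"

definition locally_solid :: "'a vlat \<Rightarrow> 'a topology \<Rightarrow> bool" where
  "locally_solid G \<tau> \<longleftrightarrow>
     (\<forall>U. openin \<tau> U \<and> \<zero>\<^bsub>G\<^esub> \<in> U \<longrightarrow>
        (\<exists>V W. solid G V \<and> openin \<tau> W \<and> \<zero>\<^bsub>G\<^esub> \<in> W \<and> W \<subseteq> V \<and> V \<subseteq> U))"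

text \<open>
  HOL cannot quantify over all index types inside a definition. Nets with index set in
  \<open>'a \<times> 'a set\<close> are enough: whether a net in \<open>G\<close> is uo-convergent, or convergent in a topology,
  depends only on the filter \<open>F\<close> of sets that contain a tail of it, and \<open>F\<close> is also the filter of
  the net \<open>(p, S) \<mapsto> p\<close> on \<open>{(p, S). p \<in> S \<and> S \<in> F}\<close>, directed by reverse inclusion of \<open>S\<close>.
\<close>

definition uo_lebesgue :: "'a vlat \<Rightarrow> 'a topology \<Rightarrow> bool" where
  "uo_lebesgue G \<tau> \<longleftrightarrow>
     linear_topology G \<tau> \<and> locally_solid G \<tau> \<and>
     (\<forall>(A::('a \<times> 'a set) set) lq x.
        directed A lq \<and> (\<forall>a\<in>A. x a \<in> carrier G) \<and> uo_conv G A lq x \<zero>\<^bsub>G\<^esub> \<longrightarrow>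
        limitin \<tau> x \<zero>\<^bsub>G\<^esub> (net_filter A lq))"

definition admits_uoL :: "'a vlat \<Rightarrow> bool" where
  "admits_uoL G \<longleftrightarrow> (\<exists>\<tau>. uo_lebesgue G \<tau> \<and> Hausdorff_space \<tau>)"

definition uoL :: "'a vlat \<Rightarrow> 'a topology" where
  "uoL G = (THE \<tau>. uo_lebesgue G \<tau> \<and> Hausdorff_space \<tau>)"

definition tau_conv :: "'a vlat \<Rightarrow> 'i set \<Rightarrow> ('i \<Rightarrow> 'i \<Rightarrow> bool) \<Rightarrow> ('i \<Rightarrow> 'a) \<Rightarrow> 'a \<Rightarrow> bool" where
  "tau_conv G A lq x l \<longleftrightarrow> limitin (uoL G) x l (net_filter A lq)"


section \<open>The six modes for nets of orthomorphisms\<close>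

datatype conv_mode = Mode_o | Mode_uo | Mode_tau | Mode_SO | Mode_SUO | Mode_Stau

fun converges ::
  "conv_mode \<Rightarrow> 'a vlat \<Rightarrow> 'i set \<Rightarrow> ('i \<Rightarrow> 'i \<Rightarrow> bool) \<Rightarrow> ('i \<Rightarrow> 'a \<Rightarrow> 'a) \<Rightarrow> ('a \<Rightarrow> 'a) \<Rightarrow> bool"
where
  "converges Mode_o E A lq T S = o_conv (Orth E) A lq T S"
| "converges Mode_uo E A lq T S = uo_conv (Orth E) A lq T S"
| "converges Mode_tau E A lq T S = tau_conv (Orth E) A lq T S"
| "converges Mode_SO E A lq T S = (\<forall>x\<in>carrier E. o_conv E A lq (\<lambda>a. T a x) (S x))"
| "converges Mode_SUO E A lq T S = (\<forall>x\<in>carrier E. uo_conv E A lq (\<lambda>a. T a x) (S x))"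
| "converges Mode_Stau E A lq T S = (\<forall>x\<in>carrier E. tau_conv E A lq (\<lambda>a. T a x) (S x))"

text \<open>
  \<open>mode_implies TYPE('a) TYPE('i) c1 c2\<close>: for all \<open>E\<close> with carrier a subset of \<open>'a\<close> and all nets with
  index set a subset of \<open>'i\<close>, convergence in the sense of \<open>c1\<close> implies convergence in the sense of \<open>c2\<close>.
\<close>

definition mode_implies ::
  "'a itself \<Rightarrow> 'i itself \<Rightarrow> conv_mode \<Rightarrow> conv_mode \<Rightarrow> bool"
where
  "mode_implies _ _ c1 c2 \<longleftrightarrow>
     (\<forall>(E::'a vlat) (A::'i set) lq T S.
        vector_lattice E \<and> dedekind_complete E \<and>
        (c1 \<in> {Mode_tau, Mode_Stau} \<or> c2 \<in> {Mode_tau, Mode_Stau} \<longrightarrow> admits_uoL E) \<and>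
        directed A lq \<and> (\<forall>a\<in>A. T a \<in> carrier (Orth E)) \<and> S \<in> carrier (Orth E) \<and>
        converges c1 E A lq T S \<longrightarrow> converges c2 E A lq T S)"

definition valid_implications :: "(conv_mode \<times> conv_mode) set" where
  "valid_implications =
     {Mode_o} \<times> UNIV \<union>
     {Mode_uo} \<times> {Mode_uo, Mode_tau, Mode_SUO, Mode_Stau} \<union>
     {Mode_tau} \<times> {Mode_tau, Mode_Stau} \<union>
     {Mode_SO} \<times> {Mode_uo, Mode_tau, Mode_SO, Mode_SUO, Mode_Stau} \<union>
     {Mode_SUO} \<times> {Mode_uo, Mode_tau, Mode_SUO, Mode_Stau} \<union>
     {Mode_Stau} \<times> {Mode_tau, Mode_Stau}"

end

theory Submission
  imports Defs
begin

text \<open>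
  Everything rests on one property of orthomorphisms on a Dedekind complete \<open>E\<close>: if
  \<open>0 \<le> x \<le> z\<close>, then \<open>T x \<le> pos (T z)\<close> (\<open>orth_le_pos\<close>). It is clear for multiplication by a
  function, and in general it follows from the fact that \<open>T\<close> commutes with band projections and is
  order bounded. It makes the pointwise supremum of a family of orthomorphisms additive
  (\<open>ex_pointwise_lub\<close>). Hence \<open>Orth E\<close> is a Dedekind complete vector lattice in which suprema,
  infima and absolute values are formed pointwise on the positive cone.

  For the true implications it remains to compare convergence in \<open>Orth E\<close> with pointwise convergence.
  An order null net in \<open>Orth E\<close> is pointwise order null, because infima are pointwise. For unbounded
  order convergence both notions agree: a pointwise null net has tails whose suprema are pointwise
  small (\<open>uo_null_Orth_of_pointwise\<close>), and conversely \<open>T x\<close> stays in the band generated by \<open>x\<close>,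
  where the multiples of \<open>\<bbar>x\<bbar>\<close>, that is, the values at \<open>\<bbar>x\<bbar>\<close> of the multiples of the identity,
  exhaust every element (\<open>uo_null_Orth_pointwise\<close>). For the uo-Lebesgue topology \<open>\<tau>\<close> of \<open>E\<close> the
  topology of pointwise \<open>\<tau>\<close>-convergence on \<open>Orth E\<close> is again a Hausdorff uo-Lebesgue topology,
  because \<open>uo\<close>-convergence is pointwise. As there is only one such topology
  (\<open>uo_lebesgue_unique\<close>), the two \<open>\<tau>\<close>-modes agree as well. Finally, order convergence implies
  unbounded order convergence, and this implies convergence in \<open>\<tau>\<close>.

  The proof of uniqueness compares the neighbourhoods of zero of two Hausdorff uo-Lebesgue
  topologies \<open>\<sigma>\<close> and \<open>\<tau>\<close>. A sequence of solid \<open>\<sigma>\<close>-neighbourhoods \<open>Vs n\<close> with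
  \<open>Vs (n + 1) + Vs (n + 1) \<subseteq> Vs n\<close> intersects in a band \<open>N\<close>. For a suitable sequence \<open>N\<close> lies in a
  given \<open>\<tau>\<close>-neighbourhood \<open>U\<close>, and elements of \<open>Vs n\<close> disjoint from \<open>N\<close> form a sequence that is
  uo-null. So some \<open>Vs n\<close> is contained in \<open>U + U\<close>.

  Three nets refute the remaining implications. Unbounded multiples \<open>n\<close> of the projection to the point
  \<open>m\<close>, as \<open>m\<close> tends to infinity, converge strongly in order on the functions of finite support, but no
  tail of them is order bounded in \<open>Orth E\<close>. On the lattice of all functions they are \<open>uo\<close>-null, but
  no tail is order bounded at the constant function 1. On \<open>L\<^sup>\<infinity>[0, 1]\<close> the projections to the
  intervals \<open>[j / (k + 1), (j + 1) / (k + 1)]\<close> tend to zero in measure, but every tail of them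
  has supremum 1.
\<close>

section \<open>Arithmetic in a vector lattice\<close>

definition is_lub :: "'a vlat \<Rightarrow> 'a \<Rightarrow> 'a set \<Rightarrow> bool" where
  "is_lub E s A \<longleftrightarrow> s \<in> carrier E \<and> (\<forall>a\<in>A. vle E a s) \<and>
     (\<forall>u\<in>carrier E. (\<forall>a\<in>A. vle E a u) \<longrightarrow> vle E s u)"

definition is_glb :: "'a vlat \<Rightarrow> 'a \<Rightarrow> 'a set \<Rightarrow> bool" where
  "is_glb E s A \<longleftrightarrow> s \<in> carrier E \<and> (\<forall>a\<in>A. vle E s a) \<and>
     (\<forall>u\<in>carrier E. (\<forall>a\<in>A. vle E u a) \<longrightarrow> vle E u s)"

lemma ord_of_simps [simp]:
  "carrier (ord_of E) = carrier E" "le (ord_of E) = vle E" "eq (ord_of E) = (=)"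
  by (simp_all add: ord_of_def)

lemma real_ring_simps [simp]:
  "carrier real_ring = UNIV" "mult real_ring = (*)" "one real_ring = 1"
  "zero real_ring = 0" "add real_ring = (+)"
  by (simp_all add: real_ring_def)

lemma cring_real_ring: "cring real_ring"
proof (rule cringI)
  show "abelian_group real_ring"
  proof (rule abelian_groupI)
    show "\<exists>y\<in>carrier real_ring. y \<oplus>\<^bsub>real_ring\<^esub> x = \<zero>\<^bsub>real_ring\<^esub>" for x
      by (rule bexI[of _ "-x"]) auto
  qed auto
  show "Group.comm_monoid real_ring"
    by (rule comm_monoidI) auto
qed (auto simp: algebra_simps)

lemma least_Upper_iff:
  "A \<subseteq> carrier E \<Longrightarrow> least (ord_of E) s (Upper (ord_of E) A) \<longleftrightarrow> is_lub E s A"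
  unfolding least_def Upper_def is_lub_def by (auto; blast)

lemma greatest_Lower_iff:
  "A \<subseteq> carrier E \<Longrightarrow> greatest (ord_of E) s (Lower (ord_of E) A) \<longleftrightarrow> is_glb E s A"
  unfolding greatest_def Lower_def is_glb_def by (auto; blast)

locale vlattice =
  fixes E :: "'a vlat" (structure)
  assumes vector_lattice: "vector_lattice E"
begin

sublocale abelian_group E
  using vector_lattice unfolding vector_lattice_def module_def by blast

(* The method algebra decides identities between linear combinations of elements of the carrier.
   For other terms it has to know that they lie in the carrier. *)
lemmas [algebra abelian_group "zero E" "add E" "a_inv E" "a_minus E"] =
  zero_closed a_closed a_inv_closed minus_closed l_zero r_zero l_neg r_neg
  a_assoc a_comm a_lcomm minus_add minus_minus minus_zero r_neg1 r_neg2 a_minus_def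

abbreviation le (infix "\<preceq>" 50) where "x \<preceq> y \<equiv> vle E x y"
abbreviation vsup (infixl "\<squnion>" 65) where "x \<squnion> y \<equiv> x \<squnion>\<^bsub>ord_of E\<^esub> y"
abbreviation vinf (infixl "\<sqinter>" 70) where "x \<sqinter> y \<equiv> x \<sqinter>\<^bsub>ord_of E\<^esub> y"
abbreviation absv ("\<bbar>_\<bbar>") where "\<bbar>x\<bbar> \<equiv> vabs E x"
abbreviation V where "V \<equiv> carrier E"

lemma module: "Module.module real_ring E"
  and lattice_ord: "Lattice.lattice (ord_of E)"
  and archimedean: "archimedean E"
  using vector_lattice unfolding vector_lattice_def by auto

lemma smult_closed [simp, intro]: "x \<in> V \<Longrightarrow> r \<odot> x \<in> V"
  using module.smult_closed[OF module] by simp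

lemma smult_add_left: "x \<in> V \<Longrightarrow> (r + s) \<odot> x = r \<odot> x \<oplus> s \<odot> x"
  using module.smult_l_distr[OF module] by simp

lemma smult_add_right: "x \<in> V \<Longrightarrow> y \<in> V \<Longrightarrow> r \<odot> (x \<oplus> y) = r \<odot> x \<oplus> r \<odot> y"
  using module.smult_r_distr[OF module] by simp

lemma smult_smult: "x \<in> V \<Longrightarrow> r \<odot> (s \<odot> x) = (r * s) \<odot> x"
  using module.smult_assoc1[OF module] by simp

lemma smult_1 [simp]: "x \<in> V \<Longrightarrow> 1 \<odot> x = x"
  using module.smult_one[OF module] by simp

lemma smult_0 [simp]: "x \<in> V \<Longrightarrow> 0 \<odot> x = \<zero>"
  using module.smult_l_null[OF module] by simp

lemma smult_zero [simp]: "r \<odot> \<zero> = \<zero>"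
  using module.smult_r_null[OF module] by simp

lemma smult_minus_right: "x \<in> V \<Longrightarrow> r \<odot> (\<ominus> x) = \<ominus> (r \<odot> x)"
  using module.smult_r_minus[OF module] by simp

lemma smult_minus_left: "x \<in> V \<Longrightarrow> (- r) \<odot> x = \<ominus> (r \<odot> x)"
  using smult_add_left[of x r "-r"] by (metis add.inv_equality a_comm add.right_inverse smult_0 smult_closed)

lemma smult_diff_right: "x \<in> V \<Longrightarrow> y \<in> V \<Longrightarrow> r \<odot> (x \<ominus> y) = r \<odot> x \<ominus> r \<odot> y"
  by (simp add: a_minus_def smult_add_right smult_minus_right)

lemma smult_2: "x \<in> V \<Longrightarrow> 2 \<odot> x = x \<oplus> x"
  using smult_add_left[of x 1 1] by simp

lemma le_refl [simp, intro]: "x \<in> V \<Longrightarrow> x \<preceq> x"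
proof -
  interpret L: Lattice.lattice "ord_of E" by (rule lattice_ord)
  show "x \<in> V \<Longrightarrow> x \<preceq> x" using L.le_refl by simp
qed

lemma le_trans: "x \<preceq> y \<Longrightarrow> y \<preceq> z \<Longrightarrow> x \<in> V \<Longrightarrow> y \<in> V \<Longrightarrow> z \<in> V \<Longrightarrow> x \<preceq> z"
proof -
  interpret L: Lattice.lattice "ord_of E" by (rule lattice_ord)
  show "x \<preceq> y \<Longrightarrow> y \<preceq> z \<Longrightarrow> x \<in> V \<Longrightarrow> y \<in> V \<Longrightarrow> z \<in> V \<Longrightarrow> x \<preceq> z"
    using L.le_trans by simp
qed

lemma le_antisym: "x \<preceq> y \<Longrightarrow> y \<preceq> x \<Longrightarrow> x \<in> V \<Longrightarrow> y \<in> V \<Longrightarrow> x = y"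
proof -
  interpret L: Lattice.lattice "ord_of E" by (rule lattice_ord)
  show "x \<preceq> y \<Longrightarrow> y \<preceq> x \<Longrightarrow> x \<in> V \<Longrightarrow> y \<in> V \<Longrightarrow> x = y"
    using L.le_antisym by simp
qed

lemma sup_facts:
  assumes "x \<in> V" "y \<in> V"
  shows sup_closed [simp, intro]: "x \<squnion> y \<in> V"
    and sup_ge1 [simp, intro]: "x \<preceq> x \<squnion> y" and sup_ge2 [simp, intro]: "y \<preceq> x \<squnion> y"
    and sup_least: "z \<in> V \<Longrightarrow> x \<preceq> z \<Longrightarrow> y \<preceq> z \<Longrightarrow> x \<squnion> y \<preceq> z"
proof -
  interpret L: Lattice.lattice "ord_of E" by (rule lattice_ord)
  show "x \<squnion> y \<in> V" "x \<preceq> x \<squnion> y" "y \<preceq> x \<squnion> y"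
    using L.join_closed L.join_left L.join_right assms by simp_all
  show "z \<in> V \<Longrightarrow> x \<preceq> z \<Longrightarrow> y \<preceq> z \<Longrightarrow> x \<squnion> y \<preceq> z"
    using L.join_le assms by simp
qed

lemma inf_facts:
  assumes "x \<in> V" "y \<in> V"
  shows inf_closed [simp, intro]: "x \<sqinter> y \<in> V"
    and inf_le1 [simp, intro]: "x \<sqinter> y \<preceq> x" and inf_le2 [simp, intro]: "x \<sqinter> y \<preceq> y"
    and inf_greatest: "z \<in> V \<Longrightarrow> z \<preceq> x \<Longrightarrow> z \<preceq> y \<Longrightarrow> z \<preceq> x \<sqinter> y"
proof -
  interpret L: Lattice.lattice "ord_of E" by (rule lattice_ord)
  show "x \<sqinter> y \<in> V" "x \<sqinter> y \<preceq> x" "x \<sqinter> y \<preceq> y"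
    using L.meet_closed L.meet_left L.meet_right assms by simp_all
  show "z \<in> V \<Longrightarrow> z \<preceq> x \<Longrightarrow> z \<preceq> y \<Longrightarrow> z \<preceq> x \<sqinter> y"
    using L.meet_le assms by simp
qed

lemma sup_comm: "x \<squnion> y = y \<squnion> x" by (rule join_comm)
lemma inf_comm: "x \<sqinter> y = y \<sqinter> x" by (rule meet_comm)

lemma add_mono_right: "x \<preceq> y \<Longrightarrow> x \<in> V \<Longrightarrow> y \<in> V \<Longrightarrow> z \<in> V \<Longrightarrow> x \<oplus> z \<preceq> y \<oplus> z"
  using vector_lattice unfolding vector_lattice_def by blast

lemma smult_mono: "x \<preceq> y \<Longrightarrow> 0 \<le> r \<Longrightarrow> x \<in> V \<Longrightarrow> y \<in> V \<Longrightarrow> r \<odot> x \<preceq> r \<odot> y"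
  using vector_lattice unfolding vector_lattice_def by blast

lemmas [algebra abelian_group "zero E" "add E" "a_inv E" "a_minus E"] =
  smult_closed sup_closed inf_closed smult_add_right smult_minus_right smult_zero

lemma add_mono:
  assumes "x \<preceq> y" "z \<preceq> w" and [simp]: "x \<in> V" "y \<in> V" "z \<in> V" "w \<in> V"
  shows "x \<oplus> z \<preceq> y \<oplus> w"
proof -
  have "x \<oplus> z \<preceq> y \<oplus> z" using assms by (simp add: add_mono_right)
  moreover have "y \<oplus> z \<preceq> y \<oplus> w" using add_mono_right[of z w y] assms by (simp add: a_comm)
  ultimately show ?thesis by (rule le_trans) auto
qed

lemma le_iff_diff: "x \<in> V \<Longrightarrow> y \<in> V \<Longrightarrow> x \<preceq> y \<longleftrightarrow> \<zero> \<preceq> y \<ominus> x"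
proof
  assume V: "x \<in> V" "y \<in> V"
  { assume "x \<preceq> y"
    from add_mono_right[OF this, of "\<ominus> x"] V show "\<zero> \<preceq> y \<ominus> x" by (simp add: a_minus_def r_neg) }
  assume "\<zero> \<preceq> y \<ominus> x"
  from add_mono_right[OF this, of x] V have "\<zero> \<oplus> x \<preceq> (y \<ominus> x) \<oplus> x" by simp
  moreover have "(y \<ominus> x) \<oplus> x = y" using V by algebra
  ultimately show "x \<preceq> y" using V by simp
qed

lemma diff_le_iff:
  assumes "x \<in> V" "y \<in> V" "z \<in> V" shows "x \<ominus> y \<preceq> z \<longleftrightarrow> x \<preceq> z \<oplus> y"
proof -
  have "z \<ominus> (x \<ominus> y) = (z \<oplus> y) \<ominus> x" using assms by algebra
  then show ?thesis using assms by (subst (1 2) le_iff_diff) auto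
qed

lemma le_diff_iff:
  assumes "x \<in> V" "y \<in> V" "z \<in> V" shows "x \<preceq> z \<ominus> y \<longleftrightarrow> x \<oplus> y \<preceq> z"
proof -
  have "(z \<ominus> y) \<ominus> x = z \<ominus> (x \<oplus> y)" using assms by algebra
  then show ?thesis using assms by (subst (1 2) le_iff_diff) auto
qed

lemma add_le_cancel_right [simp]:
  assumes "x \<in> V" "y \<in> V" "z \<in> V" shows "x \<oplus> z \<preceq> y \<oplus> z \<longleftrightarrow> x \<preceq> y"
proof -
  have "(y \<oplus> z) \<ominus> (x \<oplus> z) = y \<ominus> x" using assms by algebra
  then show ?thesis using assms by (subst (1 2) le_iff_diff) auto
qed

lemma add_le_cancel_left [simp]:
  "x \<in> V \<Longrightarrow> y \<in> V \<Longrightarrow> z \<in> V \<Longrightarrow> z \<oplus> x \<preceq> z \<oplus> y \<longleftrightarrow> x \<preceq> y"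
  using add_le_cancel_right[of x y z] by (simp add: a_comm)

lemma neg_le_neg_iff [simp]:
  assumes "x \<in> V" "y \<in> V" shows "\<ominus> x \<preceq> \<ominus> y \<longleftrightarrow> y \<preceq> x"
proof -
  have "\<ominus> y \<ominus> \<ominus> x = x \<ominus> y" using assms by algebra
  then show ?thesis using assms by (subst (1 2) le_iff_diff) auto
qed

lemma neg_le_iff: "x \<in> V \<Longrightarrow> y \<in> V \<Longrightarrow> \<ominus> x \<preceq> y \<longleftrightarrow> \<ominus> y \<preceq> x"
  using neg_le_neg_iff[of x "\<ominus> y"] by simp

lemma le_neg_iff: "x \<in> V \<Longrightarrow> y \<in> V \<Longrightarrow> x \<preceq> \<ominus> y \<longleftrightarrow> y \<preceq> \<ominus> x"
  using neg_le_neg_iff[of "\<ominus> x" y] by simp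

lemma neg_zero [simp]: "\<ominus> \<zero> = \<zero>"
  using r_neg[of \<zero>] l_zero[of "\<ominus> \<zero>"] by simp

lemma neg_le_zero_iff [simp]: "x \<in> V \<Longrightarrow> \<ominus> x \<preceq> \<zero> \<longleftrightarrow> \<zero> \<preceq> x"
  using neg_le_neg_iff[of x \<zero>] by simp

lemma zero_le_neg_iff [simp]: "x \<in> V \<Longrightarrow> \<zero> \<preceq> \<ominus> x \<longleftrightarrow> x \<preceq> \<zero>"
  using neg_le_neg_iff[of \<zero> x] by simp

lemma diff_le_self_iff [simp]: "x \<in> V \<Longrightarrow> y \<in> V \<Longrightarrow> x \<ominus> y \<preceq> x \<longleftrightarrow> \<zero> \<preceq> y"
  using add_le_cancel_left[of \<zero> y x] by (simp add: diff_le_iff)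

lemma le_add_right: "x \<in> V \<Longrightarrow> y \<in> V \<Longrightarrow> \<zero> \<preceq> y \<Longrightarrow> x \<preceq> x \<oplus> y"
  using add_le_cancel_left[of \<zero> y x] by simp

lemma le_add_left: "x \<in> V \<Longrightarrow> y \<in> V \<Longrightarrow> \<zero> \<preceq> y \<Longrightarrow> x \<preceq> y \<oplus> x"
  using le_add_right[of x y] by (simp add: a_comm)

lemma add_nonneg: "x \<in> V \<Longrightarrow> y \<in> V \<Longrightarrow> \<zero> \<preceq> x \<Longrightarrow> \<zero> \<preceq> y \<Longrightarrow> \<zero> \<preceq> x \<oplus> y"
  using add_mono[of \<zero> x \<zero> y] by simp

lemma diff_mono_left: "x \<preceq> y \<Longrightarrow> x \<in> V \<Longrightarrow> y \<in> V \<Longrightarrow> z \<in> V \<Longrightarrow> z \<ominus> y \<preceq> z \<ominus> x"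
  by (simp add: a_minus_def)

lemma smult_nonneg: "x \<in> V \<Longrightarrow> \<zero> \<preceq> x \<Longrightarrow> 0 \<le> r \<Longrightarrow> \<zero> \<preceq> r \<odot> x"
  using smult_mono[of \<zero> x r] by simp

lemma smult_mono_left:
  assumes "r \<le> s" "\<zero> \<preceq> x" "x \<in> V" shows "r \<odot> x \<preceq> s \<odot> x"
proof -
  have "s \<odot> x = r \<odot> x \<oplus> (s - r) \<odot> x" using assms smult_add_left[of x r "s - r"] by simp
  with smult_nonneg[of x "s - r"] assms show ?thesis by (simp add: le_add_right)
qed

lemma smult_le_cancel: "0 < r \<Longrightarrow> x \<in> V \<Longrightarrow> y \<in> V \<Longrightarrow> r \<odot> x \<preceq> r \<odot> y \<longleftrightarrow> x \<preceq> y"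
  using smult_mono[of x y r] smult_mono[of "r \<odot> x" "r \<odot> y" "1/r"] by (auto simp: smult_smult)

lemma le_of_smult_le:
  assumes "x \<in> V" "y \<in> V" "\<And>n::nat. real n \<odot> x \<preceq> y" shows "x \<preceq> \<zero>"
  using archimedean assms unfolding archimedean_def by blast

lemma sup_eqI:
  assumes "x \<in> V" "y \<in> V" "z \<in> V" "x \<preceq> z" "y \<preceq> z"
    "\<And>u. u \<in> V \<Longrightarrow> x \<preceq> u \<Longrightarrow> y \<preceq> u \<Longrightarrow> z \<preceq> u"
  shows "x \<squnion> y = z"
  using assms by (intro le_antisym) (auto intro: sup_least)

lemma inf_eqI:
  assumes "x \<in> V" "y \<in> V" "z \<in> V" "z \<preceq> x" "z \<preceq> y"
    "\<And>u. u \<in> V \<Longrightarrow> u \<preceq> x \<Longrightarrow> u \<preceq> y \<Longrightarrow> u \<preceq> z"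
  shows "x \<sqinter> y = z"
  using assms by (intro le_antisym) (auto intro: inf_greatest)

lemma sup_le_iff: "x \<in> V \<Longrightarrow> y \<in> V \<Longrightarrow> z \<in> V \<Longrightarrow> x \<squnion> y \<preceq> z \<longleftrightarrow> x \<preceq> z \<and> y \<preceq> z"
  by (meson le_trans sup_ge1 sup_ge2 sup_least sup_closed)

lemma le_inf_iff: "x \<in> V \<Longrightarrow> y \<in> V \<Longrightarrow> z \<in> V \<Longrightarrow> z \<preceq> x \<sqinter> y \<longleftrightarrow> z \<preceq> x \<and> z \<preceq> y"
  by (meson le_trans inf_le1 inf_le2 inf_greatest inf_closed)

lemma inf_mono:
  assumes "x \<preceq> y" "z \<preceq> w" and [simp]: "x \<in> V" "y \<in> V" "z \<in> V" "w \<in> V"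
  shows "x \<sqinter> z \<preceq> y \<sqinter> w"
proof -
  have "x \<sqinter> z \<preceq> y" by (rule le_trans[OF inf_le1]) (use assms in auto)
  moreover have "x \<sqinter> z \<preceq> w" by (rule le_trans[OF inf_le2]) (use assms in auto)
  ultimately show ?thesis by (simp add: le_inf_iff)
qed

lemma inf_absorb1: "x \<in> V \<Longrightarrow> y \<in> V \<Longrightarrow> x \<preceq> y \<Longrightarrow> x \<sqinter> y = x"
  by (rule inf_eqI) auto

lemma sup_absorb1: "x \<in> V \<Longrightarrow> y \<in> V \<Longrightarrow> y \<preceq> x \<Longrightarrow> x \<squnion> y = x"
  by (rule sup_eqI) auto

lemma inf_nonneg: "x \<in> V \<Longrightarrow> y \<in> V \<Longrightarrow> \<zero> \<preceq> x \<Longrightarrow> \<zero> \<preceq> y \<Longrightarrow> \<zero> \<preceq> x \<sqinter> y"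
  by (simp add: le_inf_iff)

lemma inf_zero_iff:
  assumes "x \<in> V" "y \<in> V" "\<zero> \<preceq> x" "\<zero> \<preceq> y" shows "x \<sqinter> y = \<zero> \<longleftrightarrow> x \<sqinter> y \<preceq> \<zero>"
  using assms inf_nonneg[of x y] le_antisym[of "x \<sqinter> y" \<zero>] by auto

lemma neg_sup:
  assumes [simp]: "x \<in> V" "y \<in> V" shows "\<ominus> (x \<squnion> y) = \<ominus> x \<sqinter> \<ominus> y"
  by (rule inf_eqI[symmetric]) (auto simp: le_neg_iff[of _ "x \<squnion> y"] le_neg_iff[of _ x] le_neg_iff[of _ y] sup_le_iff)

lemma neg_inf:
  assumes [simp]: "x \<in> V" "y \<in> V" shows "\<ominus> (x \<sqinter> y) = \<ominus> x \<squnion> \<ominus> y"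
  using neg_sup[of "\<ominus> x" "\<ominus> y"] by (metis assms add.inv_closed minus_minus sup_closed)

lemma sup_add:
  assumes [simp]: "x \<in> V" "y \<in> V" "z \<in> V" shows "(x \<squnion> y) \<oplus> z = (x \<oplus> z) \<squnion> (y \<oplus> z)"
proof (rule sup_eqI[symmetric])
  fix u assume u: "u \<in> V" "x \<oplus> z \<preceq> u" "y \<oplus> z \<preceq> u"
  then have "x \<squnion> y \<preceq> u \<ominus> z" by (intro sup_least) (auto simp: le_diff_iff)
  then show "x \<squnion> y \<oplus> z \<preceq> u"
    by (rule le_diff_iff[THEN iffD1, rotated -1]) (use u in auto)
qed auto

lemma inf_add_sup:
  assumes [simp]: "x \<in> V" "y \<in> V" shows "x \<oplus> y = (x \<squnion> y) \<oplus> (x \<sqinter> y)"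
proof -
  have "(x \<squnion> y) \<ominus> (x \<oplus> y) = (x \<squnion> y) \<oplus> \<ominus> (x \<oplus> y)" by (simp add: a_minus_def)
  also have "\<dots> = (x \<oplus> \<ominus> (x \<oplus> y)) \<squnion> (y \<oplus> \<ominus> (x \<oplus> y))" by (simp add: sup_add)
  also have "x \<oplus> \<ominus> (x \<oplus> y) = \<ominus> y" using assms by algebra
  also have "y \<oplus> \<ominus> (x \<oplus> y) = \<ominus> x" using assms by algebra
  also have "\<ominus> y \<squnion> \<ominus> x = \<ominus> (x \<sqinter> y)" by (simp add: neg_inf sup_comm)
  finally have *: "(x \<squnion> y) \<ominus> (x \<oplus> y) = \<ominus> (x \<sqinter> y)" .
  have "(x \<squnion> y) \<oplus> (x \<sqinter> y) = (x \<squnion> y) \<ominus> \<ominus> (x \<sqinter> y)" by (simp add: a_minus_def)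
  also have "\<dots> = (x \<squnion> y) \<ominus> ((x \<squnion> y) \<ominus> (x \<oplus> y))" by (simp only: *)
  also have "\<dots> = x \<oplus> y" using assms by algebra
  finally show ?thesis by simp
qed

lemma inf_add_le:
  assumes [simp]: "x \<in> V" "y \<in> V" "z \<in> V" and pos: "\<zero> \<preceq> x" "\<zero> \<preceq> y" "\<zero> \<preceq> z"
  shows "(x \<oplus> y) \<sqinter> z \<preceq> x \<sqinter> z \<oplus> y \<sqinter> z"
proof -
  define w where "w = (x \<oplus> y) \<sqinter> z"
  have [simp]: "w \<in> V" and wle: "w \<preceq> x \<oplus> y" "w \<preceq> z" by (auto simp: w_def)
  have "w \<preceq> z \<oplus> y" by (rule le_trans[OF wle(2)]) (use pos in \<open>auto intro: le_add_right\<close>)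
  then have "w \<ominus> y \<preceq> x \<sqinter> z" by (simp add: le_inf_iff diff_le_iff wle)
  then have 1: "w \<ominus> (x \<sqinter> z) \<preceq> y" by (simp add: diff_le_iff a_comm)
  have "w \<preceq> z \<oplus> x \<sqinter> z" by (rule le_trans[OF wle(2)]) (use pos in \<open>auto intro!: le_add_right inf_nonneg\<close>)
  then have 2: "w \<ominus> (x \<sqinter> z) \<preceq> z" by (simp add: diff_le_iff)
  from 1 2 have "w \<ominus> (x \<sqinter> z) \<preceq> y \<sqinter> z" by (simp add: le_inf_iff)
  then show ?thesis by (simp add: diff_le_iff a_comm w_def)
qed

abbreviation pos where "pos x \<equiv> x \<squnion> \<zero>"
abbreviation neg where "neg x \<equiv> \<ominus> x \<squnion> \<zero>"

lemma pos_nonneg [simp, intro]: "x \<in> V \<Longrightarrow> \<zero> \<preceq> pos x" by simp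

lemma pos_diff:
  assumes [simp]: "x \<in> V" shows "pos x \<ominus> x = neg x"
  using sup_add[of x \<zero> "\<ominus> x"] by (simp add: a_minus_def sup_comm r_neg)

lemma pos_neg: assumes [simp]: "x \<in> V" shows "x = pos x \<ominus> neg x"
proof -
  have "pos x \<ominus> (pos x \<ominus> x) = x" using assms by algebra
  then show ?thesis by (simp add: pos_diff)
qed

text \<open>If \<open>c\<close> lies below both parts, then \<open>pos x - c\<close> is still an upper bound of \<open>x\<close> and of zero.\<close>

lemma pos_inf_neg: assumes [simp]: "x \<in> V" shows "pos x \<sqinter> neg x = \<zero>"
proof -
  have "pos x \<sqinter> neg x \<preceq> \<zero>"
  proof -
    let ?c = "pos x \<sqinter> neg x"
    have "x \<preceq> pos x \<ominus> ?c"
    proof -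
      have "pos x \<ominus> neg x \<preceq> pos x \<ominus> ?c" by (rule diff_mono_left) auto
      then show ?thesis by (simp add: pos_neg[symmetric])
    qed
    moreover have "\<zero> \<preceq> pos x \<ominus> ?c" by (simp add: le_diff_iff)
    ultimately have "pos x \<preceq> pos x \<ominus> ?c" by (simp add: sup_le_iff)
    then have "pos x \<oplus> ?c \<preceq> pos x \<oplus> \<zero>" by (simp add: le_diff_iff)
    then show ?thesis by (subst (asm) add_le_cancel_left) auto
  qed
  then show ?thesis by (subst inf_zero_iff) auto
qed

lemma abs_closed [simp, intro]: "x \<in> V \<Longrightarrow> \<bbar>x\<bbar> \<in> V"
  and abs_ge_self [simp]: "x \<in> V \<Longrightarrow> x \<preceq> \<bbar>x\<bbar>"
  and abs_ge_neg [simp]: "x \<in> V \<Longrightarrow> \<ominus> x \<preceq> \<bbar>x\<bbar>"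
  by (simp_all add: vabs_def)

lemmas [algebra abelian_group "zero E" "add E" "a_inv E" "a_minus E"] = abs_closed

lemma abs_le_iff: "x \<in> V \<Longrightarrow> y \<in> V \<Longrightarrow> \<bbar>x\<bbar> \<preceq> y \<longleftrightarrow> x \<preceq> y \<and> \<ominus> x \<preceq> y"
  by (simp add: vabs_def sup_le_iff)

lemma abs_nonneg [simp, intro]: assumes [simp]: "x \<in> V" shows "\<zero> \<preceq> \<bbar>x\<bbar>"
proof -
  have "x \<oplus> \<ominus> x \<preceq> \<bbar>x\<bbar> \<oplus> \<bbar>x\<bbar>" by (rule add_mono) auto
  then have "2 \<odot> \<zero> \<preceq> 2 \<odot> \<bbar>x\<bbar>" by (simp add: r_neg smult_2)
  then show ?thesis by (subst (asm) smult_le_cancel) auto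
qed

lemma abs_of_nonneg [simp]: "x \<in> V \<Longrightarrow> \<zero> \<preceq> x \<Longrightarrow> \<bbar>x\<bbar> = x"
  unfolding vabs_def by (rule sup_absorb1) (auto intro: le_trans[of _ \<zero>])

lemma abs_zero_iff: "x \<in> V \<Longrightarrow> \<bbar>x\<bbar> = \<zero> \<longleftrightarrow> x = \<zero>"
  using abs_ge_self[of x] abs_ge_neg[of x] le_antisym[of x \<zero>]
  by (metis abs_of_nonneg le_refl neg_le_zero_iff zero_closed)

lemma abs_zero [simp]: "\<bbar>\<zero>\<bbar> = \<zero>" by (simp add: abs_zero_iff)

lemma abs_neg [simp]: "x \<in> V \<Longrightarrow> \<bbar>\<ominus> x\<bbar> = \<bbar>x\<bbar>"
  by (simp add: vabs_def sup_comm)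

lemma abs_diff_comm: assumes "x \<in> V" "y \<in> V" shows "\<bbar>x \<ominus> y\<bbar> = \<bbar>y \<ominus> x\<bbar>"
proof -
  have "y \<ominus> x = \<ominus> (x \<ominus> y)" using assms by algebra
  then show ?thesis using assms by simp
qed

lemma abs_triangle: assumes [simp]: "x \<in> V" "y \<in> V" shows "\<bbar>x \<oplus> y\<bbar> \<preceq> \<bbar>x\<bbar> \<oplus> \<bbar>y\<bbar>"
  by (simp add: abs_le_iff minus_add add_mono)

lemma pos_add_neg: assumes [simp]: "x \<in> V" shows "\<bbar>x\<bbar> = pos x \<oplus> neg x"
proof (rule le_antisym)
  have "x \<preceq> pos x \<oplus> neg x" by (rule le_trans[of _ "pos x"]) (auto intro: le_add_right)
  moreover have "\<ominus> x \<preceq> pos x \<oplus> neg x" by (rule le_trans[of _ "neg x"]) (auto intro: le_add_left)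
  ultimately show "\<bbar>x\<bbar> \<preceq> pos x \<oplus> neg x" by (simp add: abs_le_iff)
  have "pos x \<oplus> neg x = pos x \<squnion> neg x" using inf_add_sup[of "pos x" "neg x"] by (simp add: pos_inf_neg)
  then show "pos x \<oplus> neg x \<preceq> \<bbar>x\<bbar>" by (simp add: sup_le_iff)
qed auto

lemma pos_le_abs: "x \<in> V \<Longrightarrow> pos x \<preceq> \<bbar>x\<bbar>" and neg_le_abs: "x \<in> V \<Longrightarrow> neg x \<preceq> \<bbar>x\<bbar>"
  by (auto simp: sup_le_iff)

lemma abs_smult: assumes [simp]: "x \<in> V" shows "\<bbar>r \<odot> x\<bbar> = \<bar>r\<bar> \<odot> \<bbar>x\<bbar>"
proof -
  have *: "\<bbar>s \<odot> y\<bbar> \<preceq> \<bar>s\<bar> \<odot> \<bbar>y\<bbar>" if [simp]: "y \<in> V" for s y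
  proof (cases "0 \<le> s")
    case True
    then show ?thesis
      using smult_mono[of y "\<bbar>y\<bbar>" s] smult_mono[of "\<ominus> y" "\<bbar>y\<bbar>" s] by (simp add: abs_le_iff smult_minus_right)
  next
    case False
    then show ?thesis
      using smult_mono[of y "\<bbar>y\<bbar>" "-s"] smult_mono[of "\<ominus> y" "\<bbar>y\<bbar>" "-s"]
      by (simp add: abs_le_iff smult_minus_right smult_minus_left)
  qed
  show ?thesis
  proof (cases "r = 0")
    case False
    have "\<bbar>x\<bbar> \<preceq> \<bar>1/r\<bar> \<odot> \<bbar>r \<odot> x\<bbar>" using *[of "r \<odot> x" "1/r"] False by (simp add: smult_smult)
    then have "\<bar>r\<bar> \<odot> \<bbar>x\<bbar> \<preceq> \<bar>r\<bar> \<odot> (\<bar>1/r\<bar> \<odot> \<bbar>r \<odot> x\<bbar>)" by (rule smult_mono) auto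
    also have "\<bar>r\<bar> \<odot> (\<bar>1/r\<bar> \<odot> \<bbar>r \<odot> x\<bbar>) = \<bbar>r \<odot> x\<bbar>" using False by (simp add: smult_smult abs_mult[symmetric])
    finally show ?thesis using * by (intro le_antisym) auto
  qed auto
qed

lemma abs_le_mono_nonneg: "x \<in> V \<Longrightarrow> y \<in> V \<Longrightarrow> \<zero> \<preceq> x \<Longrightarrow> x \<preceq> y \<Longrightarrow> \<bbar>x\<bbar> \<preceq> \<bbar>y\<bbar>"
  by (metis abs_of_nonneg le_trans zero_closed)

end

section \<open>Bands and band projections\<close>

lemma is_lub_unique:
  "vlattice E \<Longrightarrow> is_lub E s A \<Longrightarrow> is_lub E t A \<Longrightarrow> s = t"
  unfolding is_lub_def by (meson vlattice.le_antisym)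

lemma is_glb_unique:
  "vlattice E \<Longrightarrow> is_glb E s A \<Longrightarrow> is_glb E t A \<Longrightarrow> s = t"
  unfolding is_glb_def by (meson vlattice.le_antisym)

context vlattice
begin

lemma is_lubD:
  assumes "is_lub E s A"
  shows "s \<in> V" "\<And>a. a \<in> A \<Longrightarrow> a \<preceq> s" "\<And>u. u \<in> V \<Longrightarrow> (\<And>a. a \<in> A \<Longrightarrow> a \<preceq> u) \<Longrightarrow> s \<preceq> u"
  using assms unfolding is_lub_def by auto

lemma is_glbD:
  assumes "is_glb E s A"
  shows "s \<in> V" "\<And>a. a \<in> A \<Longrightarrow> s \<preceq> a" "\<And>u. u \<in> V \<Longrightarrow> (\<And>a. a \<in> A \<Longrightarrow> u \<preceq> a) \<Longrightarrow> u \<preceq> s"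
  using assms unfolding is_glb_def by auto

lemma is_lub_sup: "x \<in> V \<Longrightarrow> y \<in> V \<Longrightarrow> is_lub E (x \<squnion> y) {x, y}"
  unfolding is_lub_def by (auto intro: sup_least)

lemma is_glb_inf: "x \<in> V \<Longrightarrow> y \<in> V \<Longrightarrow> is_glb E (x \<sqinter> y) {x, y}"
  unfolding is_glb_def by (auto intro: inf_greatest)

lemma is_glb_neg: "A \<subseteq> V \<Longrightarrow> is_lub E s (a_inv E ` A) \<Longrightarrow> is_glb E (\<ominus> s) A"
  unfolding is_lub_def is_glb_def
  by (auto simp: subset_iff) (metis add.inv_closed minus_minus neg_le_neg_iff)+

lemma is_glb_zeroI:
  assumes "\<And>a. a \<in> A \<Longrightarrow> a \<in> V \<and> \<zero> \<preceq> a" "\<And>u. u \<in> V \<Longrightarrow> \<zero> \<preceq> u \<Longrightarrow> (\<And>a. a \<in> A \<Longrightarrow> u \<preceq> a) \<Longrightarrow> u = \<zero>"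
  shows "is_glb E \<zero> A"
  unfolding is_glb_def
proof (intro conjI ballI impI)
  fix u assume u: "u \<in> V" "\<forall>a\<in>A. u \<preceq> a"
  have "pos u \<preceq> a" if "a \<in> A" for a using that u assms(1)[OF that] by (simp add: sup_le_iff)
  then have "pos u = \<zero>" using assms(2)[of "pos u"] u by auto
  then show "u \<preceq> \<zero>" using u by (metis sup_ge1 zero_closed)
qed (use assms(1) in auto)

definition dcompl :: "'a set \<Rightarrow> 'a set" where
  "dcompl S = {x \<in> V. \<forall>s\<in>S. \<bbar>x\<bbar> \<sqinter> \<bbar>s\<bbar> = \<zero>}"

lemma bandI:
  assumes "B \<subseteq> V" "\<zero> \<in> B" "\<And>x y. x \<in> B \<Longrightarrow> y \<in> B \<Longrightarrow> x \<oplus> y \<in> B" "\<And>r x. x \<in> B \<Longrightarrow> r \<odot> x \<in> B"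
    "\<And>x y. x \<in> B \<Longrightarrow> y \<in> V \<Longrightarrow> \<bbar>y\<bbar> \<preceq> \<bbar>x\<bbar> \<Longrightarrow> y \<in> B"
    "\<And>D s. D \<subseteq> B \<Longrightarrow> D \<noteq> {} \<Longrightarrow> is_lub E s D \<Longrightarrow> s \<in> B"
  shows "band E B"
proof -
  have "\<ominus> x \<in> B" if "x \<in> B" for x
    using assms(4)[OF that, of "-1"] that assms(1) smult_minus_left[of x 1] by (simp add: subset_iff)
  then have "submodule B real_ring E"
    using assms(1-4) by (intro module.submoduleI[OF module])
  moreover have "solid E B" unfolding solid_def using assms(1,5) by blast
  moreover have "s \<in> B" if "D \<subseteq> B" "D \<noteq> {}" "least (ord_of E) s (Upper (ord_of E) D)" for D s
    using that assms(6)[of D s] least_Upper_iff[of D E s] subset_trans[OF that(1) assms(1)] by blast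
  ultimately show ?thesis unfolding band_def order_ideal_def by blast
qed

lemma bandD:
  assumes "band E B"
  shows band_subset: "B \<subseteq> V" and band_zero: "\<zero> \<in> B"
    and band_add: "\<And>x y. x \<in> B \<Longrightarrow> y \<in> B \<Longrightarrow> x \<oplus> y \<in> B" and band_smult: "\<And>r x. x \<in> B \<Longrightarrow> r \<odot> x \<in> B"
    and band_neg: "\<And>x. x \<in> B \<Longrightarrow> \<ominus> x \<in> B"
    and band_diff: "\<And>x y. x \<in> B \<Longrightarrow> y \<in> B \<Longrightarrow> x \<ominus> y \<in> B"
    and band_solid: "\<And>x y. x \<in> B \<Longrightarrow> y \<in> V \<Longrightarrow> \<bbar>y\<bbar> \<preceq> \<bbar>x\<bbar> \<Longrightarrow> y \<in> B"
    and band_solid_pos: "\<And>x y. x \<in> B \<Longrightarrow> y \<in> V \<Longrightarrow> \<zero> \<preceq> y \<Longrightarrow> y \<preceq> x \<Longrightarrow> y \<in> B"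
    and band_lub: "\<And>D s. D \<subseteq> B \<Longrightarrow> D \<noteq> {} \<Longrightarrow> is_lub E s D \<Longrightarrow> s \<in> B"
    and band_abs: "\<And>x. x \<in> B \<Longrightarrow> \<bbar>x\<bbar> \<in> B"
    and band_pos: "\<And>x. x \<in> B \<Longrightarrow> pos x \<in> B"
    and band_negpart: "\<And>x. x \<in> B \<Longrightarrow> neg x \<in> B"
proof -
  have sm: "submodule B real_ring E" and so: "solid E B"
    and lub: "\<And>D s. D \<subseteq> B \<Longrightarrow> D \<noteq> {} \<Longrightarrow> least (ord_of E) s (Upper (ord_of E) D) \<Longrightarrow> s \<in> B"
    using assms unfolding band_def order_ideal_def by auto
  interpret M: Module.module real_ring E by (rule module)
  note e = M.submoduleE[OF sm]
  show sub: "B \<subseteq> V" by fact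
  show add: "\<And>x y. x \<in> B \<Longrightarrow> y \<in> B \<Longrightarrow> x \<oplus> y \<in> B" and smult: "\<And>r x. x \<in> B \<Longrightarrow> r \<odot> x \<in> B"
    and neg: "\<And>x. x \<in> B \<Longrightarrow> \<ominus> x \<in> B" using e by auto
  then show "\<And>x y. x \<in> B \<Longrightarrow> y \<in> B \<Longrightarrow> x \<ominus> y \<in> B" by (simp add: a_minus_def)
  show "\<zero> \<in> B" using e(2) smult[of _ 0] sub by (metis ex_in_conv smult_0 subsetD)
  show solid: "\<And>x y. x \<in> B \<Longrightarrow> y \<in> V \<Longrightarrow> \<bbar>y\<bbar> \<preceq> \<bbar>x\<bbar> \<Longrightarrow> y \<in> B"
    using so unfolding solid_def by blast
  show "\<And>x y. x \<in> B \<Longrightarrow> y \<in> V \<Longrightarrow> \<zero> \<preceq> y \<Longrightarrow> y \<preceq> x \<Longrightarrow> y \<in> B"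
    using solid abs_le_mono_nonneg[OF _ subsetD[OF sub]] by blast
  show "\<And>D s. D \<subseteq> B \<Longrightarrow> D \<noteq> {} \<Longrightarrow> is_lub E s D \<Longrightarrow> s \<in> B"
    using lub least_Upper_iff[OF subset_trans[OF _ sub]] by blast
  show "\<bbar>x\<bbar> \<in> B" "pos x \<in> B" "neg x \<in> B" if "x \<in> B" for x
    using subsetD[OF sub that] pos_le_abs[of x] neg_le_abs[of x] by (auto intro!: solid[OF that])
qed

lemma inf_abs_mono_zero:
  assumes "\<bbar>x\<bbar> \<sqinter> \<bbar>t\<bbar> = \<zero>" "\<bbar>y\<bbar> \<preceq> \<bbar>x\<bbar>" and [simp]: "x \<in> V" "y \<in> V" "t \<in> V"
  shows "\<bbar>y\<bbar> \<sqinter> \<bbar>t\<bbar> = \<zero>"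
  using inf_mono[of "\<bbar>y\<bbar>" "\<bbar>x\<bbar>" "\<bbar>t\<bbar>" "\<bbar>t\<bbar>"] assms by (subst inf_zero_iff) auto

lemma disjoint_nonneg_add:
  assumes "x \<sqinter> z = \<zero>" "y \<sqinter> z = \<zero>" "\<zero> \<preceq> x" "\<zero> \<preceq> y" "\<zero> \<preceq> z" and [simp]: "x \<in> V" "y \<in> V" "z \<in> V"
  shows "(x \<oplus> y) \<sqinter> z = \<zero>"
  using inf_add_le[of x y z] assms by (subst inf_zero_iff) (auto intro: add_nonneg)

lemma disjoint_smult:
  assumes d: "x \<sqinter> z = \<zero>" and p: "\<zero> \<preceq> x" "\<zero> \<preceq> z" and r: "0 \<le> r" and [simp]: "x \<in> V" "z \<in> V"
  shows "(r \<odot> x) \<sqinter> z = \<zero>"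
proof -
  have n: "(real n \<odot> x) \<sqinter> z = \<zero>" for n
  proof (induction n)
    case 0 then show ?case using p by (simp add: inf_absorb1)
  next
    case (Suc n)
    have "real (Suc n) \<odot> x = real n \<odot> x \<oplus> x" using smult_add_left[of x "real n" 1] by (simp add: add.commute)
    then show ?case using disjoint_nonneg_add[OF Suc d] p by (simp add: smult_nonneg)
  qed
  obtain n where "r \<le> real n" using real_arch_simple by blast
  then have "(r \<odot> x) \<sqinter> z \<preceq> (real n \<odot> x) \<sqinter> z" using p by (intro inf_mono) (auto intro: smult_mono_left)
  then show ?thesis using n p r by (subst inf_zero_iff) (auto intro: smult_nonneg)
qed

text \<open>Suprema stay disjoint from \<open>t\<close>: the part \<open>c\<close> of the positive part of \<open>s\<close> below \<open>\<bbar>t\<bbar>\<close> can be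
  taken away from the upper bound \<open>pos s\<close>, and what is left still dominates \<open>s\<close>.\<close>

lemma band_dcompl:
  assumes "S \<subseteq> V"
  shows "band E (dcompl S)"
proof (rule bandI)
  show "dcompl S \<subseteq> V" by (auto simp: dcompl_def)
  show "\<zero> \<in> dcompl S" using assms by (auto simp: dcompl_def inf_absorb1)
  show "x \<oplus> y \<in> dcompl S" if "x \<in> dcompl S" "y \<in> dcompl S" for x y
  proof -
    have V: "x \<in> V" "y \<in> V" using that by (auto simp: dcompl_def)
    have "\<bbar>x \<oplus> y\<bbar> \<sqinter> \<bbar>t\<bbar> = \<zero>" if t: "t \<in> S" for t
    proof -
      have [simp]: "t \<in> V" "x \<in> V" "y \<in> V" using t assms V by auto
      have "(\<bbar>x\<bbar> \<oplus> \<bbar>y\<bbar>) \<sqinter> \<bbar>t\<bbar> = \<zero>"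
        using \<open>x \<in> dcompl S\<close> \<open>y \<in> dcompl S\<close> t by (intro disjoint_nonneg_add) (auto simp: dcompl_def)
      then show ?thesis using inf_mono[OF abs_triangle[of x y] le_refl[of "\<bbar>t\<bbar>"]]
        by (subst inf_zero_iff) auto
    qed
    then show ?thesis using V by (auto simp: dcompl_def)
  qed
  show "r \<odot> x \<in> dcompl S" if "x \<in> dcompl S" for r x
    using that assms by (auto simp: dcompl_def abs_smult subset_iff intro!: disjoint_smult)
  show "y \<in> dcompl S" if "x \<in> dcompl S" "y \<in> V" "\<bbar>y\<bbar> \<preceq> \<bbar>x\<bbar>" for x y
    using that assms by (auto simp: dcompl_def intro: inf_abs_mono_zero)
  show "s \<in> dcompl S" if D: "D \<subseteq> dcompl S" "D \<noteq> {}" and s: "is_lub E s D" for D s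
  proof -
    have [simp]: "s \<in> V" using s by (rule is_lubD)
    have "\<bbar>s\<bbar> \<sqinter> \<bbar>t\<bbar> = \<zero>" if t: "t \<in> S" for t
    proof -
      have [simp]: "t \<in> V" using t assms by auto
      have disj: "\<bbar>d\<bbar> \<sqinter> \<bbar>t\<bbar> = \<zero>" and V: "d \<in> V" if "d \<in> D" for d
        using D that t by (auto simp: dcompl_def)
      obtain d0 where d0: "d0 \<in> D" using D by auto
      have [simp]: "d0 \<in> V" using V d0 by auto
      have "neg s \<preceq> \<bbar>d0\<bbar>"
        using is_lubD(2)[OF s d0] le_trans[of "\<ominus> s" "\<ominus> d0" "\<bbar>d0\<bbar>"] by (simp add: sup_le_iff)
      then have 1: "neg s \<sqinter> \<bbar>t\<bbar> = \<zero>"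
        using inf_abs_mono_zero[OF disj[OF d0], of "neg s"] by simp
      define c where "c = pos s \<sqinter> \<bbar>t\<bbar>"
      have c [simp]: "c \<in> V" "\<zero> \<preceq> c" "c \<preceq> pos s" "c \<preceq> \<bbar>t\<bbar>" by (auto simp: c_def le_inf_iff)
      have "s \<preceq> pos s \<ominus> c"
      proof (rule is_lubD(3)[OF s])
        fix d assume d: "d \<in> D"
        have [simp]: "d \<in> V" using V d by auto
        have "pos d \<sqinter> c \<preceq> \<bbar>d\<bbar> \<sqinter> \<bbar>t\<bbar>" by (rule inf_mono) (auto intro: pos_le_abs)
        then have "pos d \<sqinter> c = \<zero>" using disj[OF d] by (subst inf_zero_iff) auto
        then have "pos d \<oplus> c = pos d \<squnion> c" using inf_add_sup[of "pos d" c] by simp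
        moreover have "d \<preceq> pos s" using is_lubD(2)[OF s d] by (rule le_trans) auto
        ultimately have "pos d \<oplus> c \<preceq> pos s" by (simp add: sup_le_iff)
        then have "pos d \<preceq> pos s \<ominus> c" by (subst le_diff_iff) auto
        then show "d \<preceq> pos s \<ominus> c" by (rule le_trans[rotated]) auto
      qed auto
      then have "c \<preceq> pos s \<ominus> s" by (simp add: le_diff_iff a_comm)
      then have "c \<preceq> pos s \<sqinter> neg s" by (simp add: pos_diff le_inf_iff)
      then have "pos s \<sqinter> \<bbar>t\<bbar> = \<zero>" using pos_inf_neg[of s] c_def c(1,2) le_antisym by auto
      from disjoint_nonneg_add[OF this 1] show ?thesis by (simp add: pos_add_neg[of s])
    qed
    then show ?thesis by (auto simp: dcompl_def)
  qed
qed

lemma dcompl_disjoint: "x \<in> B \<Longrightarrow> y \<in> dcompl B \<Longrightarrow> B \<subseteq> V \<Longrightarrow> \<bbar>x\<bbar> \<sqinter> \<bbar>y\<bbar> = \<zero>"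
  by (auto simp: dcompl_def inf_comm)

lemma dcompl_Int: "x \<in> B \<Longrightarrow> x \<in> dcompl B \<Longrightarrow> B \<subseteq> V \<Longrightarrow> x = \<zero>"
  using dcompl_disjoint[of x B x] abs_zero_iff[of x] by (auto simp: inf_absorb1)

end

locale dvlattice = vlattice +
  assumes dedekind_complete: "dedekind_complete E"
begin

lemma ex_lub: "A \<subseteq> V \<Longrightarrow> A \<noteq> {} \<Longrightarrow> u \<in> V \<Longrightarrow> (\<And>a. a \<in> A \<Longrightarrow> a \<preceq> u) \<Longrightarrow> \<exists>s. is_lub E s A"
proof -
  assume A: "A \<subseteq> V" "A \<noteq> {}" and u: "u \<in> V" "\<And>a. a \<in> A \<Longrightarrow> a \<preceq> u"
  then have "u \<in> Upper (ord_of E) A" by (simp add: Upper_def)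
  then show ?thesis using dedekind_complete A least_Upper_iff[OF A(1)] unfolding dedekind_complete_def by blast
qed

text \<open>Riesz decomposition: \<open>p\<close> is the largest element of \<open>B\<close> below \<open>x\<close>, so an element of \<open>B\<close> below
  \<open>x - p\<close> could be added to \<open>p\<close>.\<close>

lemma riesz_nonneg:
  assumes B: "band E B" and x [simp]: "x \<in> V" "\<zero> \<preceq> x"
  obtains p where "p \<in> B" "\<zero> \<preceq> p" "p \<preceq> x" "x \<ominus> p \<in> dcompl B" "\<And>b. b \<in> B \<Longrightarrow> b \<preceq> x \<Longrightarrow> b \<preceq> p"
proof -
  let ?D = "{b \<in> B. b \<preceq> x}"
  have BV: "B \<subseteq> V" using B by (rule band_subset)
  have 0: "\<zero> \<in> ?D" using band_zero[OF B] by auto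
  have "?D \<subseteq> V" "?D \<noteq> {}" using BV 0 by blast+
  then obtain p where p: "is_lub E p ?D" using ex_lub[of ?D x] x by blast
  have pV [simp]: "p \<in> V" using p by (rule is_lubD)
  have pB: "p \<in> B" using band_lub[OF B _ _ p] 0 by blast
  have p0: "\<zero> \<preceq> p" using is_lubD(2)[OF p 0] .
  have px: "p \<preceq> x" using is_lubD(3)[OF p x(1)] by auto
  have max: "\<And>b. b \<in> B \<Longrightarrow> b \<preceq> x \<Longrightarrow> b \<preceq> p" using is_lubD(2)[OF p] by auto
  have d0: "\<zero> \<preceq> x \<ominus> p" using px by (simp add: le_iff_diff[symmetric])
  have "\<bbar>x \<ominus> p\<bbar> \<sqinter> \<bbar>b\<bbar> = \<zero>" if b: "b \<in> B" for b
  proof -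
    have [simp]: "b \<in> V" using b BV by auto
    define c where "c = (x \<ominus> p) \<sqinter> \<bbar>b\<bbar>"
    have c [simp]: "c \<in> V" "\<zero> \<preceq> c" "c \<preceq> x \<ominus> p" "c \<preceq> \<bbar>b\<bbar>" using d0 by (auto simp: c_def le_inf_iff)
    have "c \<in> B" using band_solid_pos[OF B band_abs[OF B b]] by simp
    then have "c \<oplus> p \<preceq> p" using c(3) pB band_add[OF B] by (intro max) (auto simp: le_diff_iff[symmetric])
    then have "c \<preceq> \<zero>" using add_le_cancel_right[of c \<zero> p] by simp
    then show ?thesis using d0 c le_antisym[of c \<zero>] unfolding c_def[symmetric] by (simp add: c_def)
  qed
  then have "x \<ominus> p \<in> dcompl B" by (auto simp: dcompl_def)
  with that pB p0 px max show ?thesis by blast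
qed

definition proj :: "'a set \<Rightarrow> 'a \<Rightarrow> 'a" where
  "proj B x = (THE p. p \<in> B \<and> x \<ominus> p \<in> dcompl B)"

lemma proj_eqI:
  assumes B: "band E B" and "x \<in> V" "p \<in> B" "x \<ominus> p \<in> dcompl B"
  shows "proj B x = p"
  unfolding proj_def
proof (rule the_equality)
  fix q assume q: "q \<in> B \<and> x \<ominus> q \<in> dcompl B"
  have BV: "B \<subseteq> V" and dB: "band E (dcompl B)" using B band_subset band_dcompl by auto
  have V: "p \<in> V" "q \<in> V" using assms(3) q BV by auto
  have "q \<ominus> p = (x \<ominus> p) \<ominus> (x \<ominus> q)" using V assms(2) by algebra
  then have "q \<ominus> p \<in> dcompl B" using band_diff[OF dB] q assms by auto
  moreover have "q \<ominus> p \<in> B" using band_diff[OF B] q assms by auto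
  ultimately have "q \<ominus> p = \<zero>" using dcompl_Int BV by auto
  moreover have "q = (q \<ominus> p) \<oplus> p" using V by algebra
  ultimately show "q = p" using V by simp
qed (use assms in auto)

lemma proj_ex:
  assumes B: "band E B" and "x \<in> V"
  shows "proj B x \<in> B \<and> x \<ominus> proj B x \<in> dcompl B"
proof -
  have [simp]: "x \<in> V" by fact
  have BV: "B \<subseteq> V" and dB: "band E (dcompl B)" using B band_subset band_dcompl by auto
  obtain p where p: "p \<in> B" "pos x \<ominus> p \<in> dcompl B" using riesz_nonneg[OF B, of "pos x"] by auto
  obtain q where q: "q \<in> B" "neg x \<ominus> q \<in> dcompl B" using riesz_nonneg[OF B, of "neg x"] by auto
  have V: "p \<in> V" "q \<in> V" "pos x \<in> V" "neg x \<in> V" using p q BV by auto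
  have "(pos x \<ominus> neg x) \<ominus> (p \<ominus> q) = (pos x \<ominus> p) \<ominus> (neg x \<ominus> q)" using V by algebra
  then have "x \<ominus> (p \<ominus> q) \<in> dcompl B" using band_diff[OF dB p(2) q(2)] by (simp add: pos_neg[symmetric])
  moreover have "p \<ominus> q \<in> B" using band_diff[OF B] p q by auto
  ultimately show ?thesis using proj_eqI[OF B, of x "p \<ominus> q"] by auto
qed

lemma proj_in: "band E B \<Longrightarrow> x \<in> V \<Longrightarrow> proj B x \<in> B"
  and proj_compl: "band E B \<Longrightarrow> x \<in> V \<Longrightarrow> x \<ominus> proj B x \<in> dcompl B"
  using proj_ex by auto

lemma proj_closed [simp]: "band E B \<Longrightarrow> x \<in> V \<Longrightarrow> proj B x \<in> V"
  using proj_in band_subset by blast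

lemma proj_diff:
  assumes B: "band E B" and [simp]: "x \<in> V" "y \<in> V"
  shows "proj B (x \<ominus> y) = proj B x \<ominus> proj B y"
proof (rule proj_eqI[OF B])
  have dB: "band E (dcompl B)" using B band_subset band_dcompl by auto
  have "x \<ominus> y \<ominus> (proj B x \<ominus> proj B y) = (x \<ominus> proj B x) \<ominus> (y \<ominus> proj B y)"
    using assms(2,3) proj_closed[OF B] by algebra
  then show "x \<ominus> y \<ominus> (proj B x \<ominus> proj B y) \<in> dcompl B"
    by (simp add: band_diff[OF dB] proj_compl B)
qed (use B in \<open>auto intro!: band_diff[OF B] proj_in[OF B]\<close>)

lemma proj_nonneg:
  assumes B: "band E B" and [simp]: "x \<in> V" "\<zero> \<preceq> x"
  shows "\<zero> \<preceq> proj B x" "proj B x \<preceq> x" "\<And>b. b \<in> B \<Longrightarrow> b \<preceq> x \<Longrightarrow> b \<preceq> proj B x"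
proof -
  obtain p where "p \<in> B" "\<zero> \<preceq> p" "p \<preceq> x" "x \<ominus> p \<in> dcompl B" "\<And>b. b \<in> B \<Longrightarrow> b \<preceq> x \<Longrightarrow> b \<preceq> p"
    using riesz_nonneg[OF B, of x] by auto
  moreover from this have "proj B x = p" using B by (intro proj_eqI) auto
  ultimately show "\<zero> \<preceq> proj B x" "proj B x \<preceq> x" "\<And>b. b \<in> B \<Longrightarrow> b \<preceq> x \<Longrightarrow> b \<preceq> proj B x" by auto
qed

lemma proj_mono:
  assumes B: "band E B" and [simp]: "x \<in> V" "y \<in> V" "x \<preceq> y"
  shows "proj B x \<preceq> proj B y"
  using proj_nonneg(1)[OF B, of "y \<ominus> x"] B le_iff_diff[of x y]
  by (simp add: proj_diff le_iff_diff)

text \<open>This band stands for the region where \<open>v \<ge> 0\<close>. It turns comparisons that hold in such a region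
  into comparisons of projections.\<close>

lemma proj_disjoint_neg:
  assumes [simp]: "v \<in> V"
  shows "proj (dcompl {neg v}) v = pos v"
proof (rule proj_eqI)
  show "band E (dcompl {neg v})" by (rule band_dcompl) auto
  show "pos v \<in> dcompl {neg v}" by (auto simp: dcompl_def pos_inf_neg)
  have "v \<ominus> pos v = \<ominus> (pos v \<ominus> v)" using assms sup_closed[OF assms zero_closed] by algebra
  then have "v \<ominus> pos v = \<ominus> neg v" by (simp add: pos_diff)
  then show "v \<ominus> pos v \<in> dcompl (dcompl {neg v})" by (auto simp: dcompl_def inf_comm)
qed auto

end

section \<open>The vector lattice of orthomorphisms\<close>

text \<open>Infima are negatives of suprema, so only the suprema of pairs have to be provided.\<close>

lemma vector_latticeI:
  fixes E :: "'a vlat" (structure)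
  assumes mod: "Module.module real_ring E"
    and refl: "\<And>x. x \<in> carrier E \<Longrightarrow> vle E x x"
    and antisym: "\<And>x y. x \<in> carrier E \<Longrightarrow> y \<in> carrier E \<Longrightarrow> vle E x y \<Longrightarrow> vle E y x \<Longrightarrow> x = y"
    and trans: "\<And>x y z. x \<in> carrier E \<Longrightarrow> y \<in> carrier E \<Longrightarrow> z \<in> carrier E \<Longrightarrow> vle E x y \<Longrightarrow> vle E y z \<Longrightarrow> vle E x z"
    and add: "\<And>x y z. x \<in> carrier E \<Longrightarrow> y \<in> carrier E \<Longrightarrow> z \<in> carrier E \<Longrightarrow> vle E x y \<Longrightarrow> vle E (x \<oplus> z) (y \<oplus> z)"
    and smult: "\<And>x y r. x \<in> carrier E \<Longrightarrow> y \<in> carrier E \<Longrightarrow> 0 \<le> r \<Longrightarrow> vle E x y \<Longrightarrow> vle E (r \<odot> x) (r \<odot> y)"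
    and lub: "\<And>x y. x \<in> carrier E \<Longrightarrow> y \<in> carrier E \<Longrightarrow> \<exists>s. is_lub E s {x, y}"
    and arch: "archimedean E"
  shows "vector_lattice E"
proof -
  interpret M: abelian_group E using mod by (simp add: module_def)
  have neg: "vle E (\<ominus> y) (\<ominus> x)" if "x \<in> carrier E" "y \<in> carrier E" "vle E x y" for x y
  proof -
    have "x \<oplus> (\<ominus> x \<oplus> \<ominus> y) = \<ominus> y" "y \<oplus> (\<ominus> x \<oplus> \<ominus> y) = \<ominus> x"
      using that by (simp_all add: M.r_neg2 M.a_comm[of "\<ominus> x" "\<ominus> y"] del: M.minus_add) (simp add: M.r_neg2 M.a_comm[of "\<ominus> y" "\<ominus> x"])
    then show ?thesis using add[OF that(1,2) _ that(3), of "\<ominus> x \<oplus> \<ominus> y"] that by simp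
  qed
  have glb: "\<exists>s. is_glb E s {x, y}" if xy: "x \<in> carrier E" "y \<in> carrier E" for x y
  proof -
    obtain s where s: "is_lub E s {\<ominus> x, \<ominus> y}" using lub[of "\<ominus> x" "\<ominus> y"] xy by auto
    have sV: "s \<in> carrier E" using s by (simp add: is_lub_def)
    have "vle E (\<ominus> s) x" "vle E (\<ominus> s) y"
      using s neg[of "\<ominus> x" s] neg[of "\<ominus> y" s] xy sV by (auto simp: is_lub_def)
    moreover have "vle E u (\<ominus> s)" if u: "u \<in> carrier E" "vle E u x" "vle E u y" for u
    proof -
      have "vle E s (\<ominus> u)" using s u neg[of u x] neg[of u y] xy by (auto simp: is_lub_def)
      then show ?thesis using neg[of s "\<ominus> u"] sV u by auto
    qed
    ultimately show ?thesis using sV by (intro exI[of _ "\<ominus> s"]) (auto simp: is_glb_def)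
  qed
  have "Lattice.lattice (ord_of E)"
  proof unfold_locales
    show "x \<sqsubseteq>\<^bsub>ord_of E\<^esub> x" if "x \<in> carrier (ord_of E)" for x using that refl by simp
  next
    fix x y assume "x \<in> carrier (ord_of E)" "y \<in> carrier (ord_of E)"
    then show "\<exists>s. least (ord_of E) s (Upper (ord_of E) {x, y})"
      using lub[of x y] least_Upper_iff[of "{x,y}" E] by simp
  next
    fix x y assume "x \<in> carrier (ord_of E)" "y \<in> carrier (ord_of E)"
    then show "\<exists>s. greatest (ord_of E) s (Lower (ord_of E) {x, y})"
      using glb[of x y] greatest_Lower_iff[of "{x,y}" E] by simp
  qed (simp_all, (blast intro: antisym trans)+)
  with mod arch show ?thesis unfolding vector_lattice_def by (simp add: add smult)
qed

context vlattice
begin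

lemma linear_operatorD:
  assumes "linear_operator E T"
  shows lin_closed: "\<And>x. x \<in> V \<Longrightarrow> T x \<in> V"
    and lin_add: "\<And>x y. x \<in> V \<Longrightarrow> y \<in> V \<Longrightarrow> T (x \<oplus> y) = T x \<oplus> T y"
    and lin_smult: "\<And>r x. x \<in> V \<Longrightarrow> T (r \<odot> x) = r \<odot> T x"
    and lin_zero: "T \<zero> = \<zero>" and lin_neg: "\<And>x. x \<in> V \<Longrightarrow> T (\<ominus> x) = \<ominus> T x"
    and lin_diff: "\<And>x y. x \<in> V \<Longrightarrow> y \<in> V \<Longrightarrow> T (x \<ominus> y) = T x \<ominus> T y"
proof -
  show c: "\<And>x. x \<in> V \<Longrightarrow> T x \<in> V" and a: "\<And>x y. x \<in> V \<Longrightarrow> y \<in> V \<Longrightarrow> T (x \<oplus> y) = T x \<oplus> T y"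
    and s: "\<And>r x. x \<in> V \<Longrightarrow> T (r \<odot> x) = r \<odot> T x"
    using assms unfolding linear_operator_def by auto
  show "T \<zero> = \<zero>" using s[of \<zero> 0] c[of \<zero>] by simp
  show n: "\<And>x. x \<in> V \<Longrightarrow> T (\<ominus> x) = \<ominus> T x"
    using s[of _ "-1"] smult_minus_left[of _ 1] c by (metis smult_1)
  show "\<And>x y. x \<in> V \<Longrightarrow> y \<in> V \<Longrightarrow> T (x \<ominus> y) = T x \<ominus> T y"
    by (simp add: a_minus_def a n)
qed

lemma orthomorphismI:
  assumes "linear_operator E T"
    and ob: "\<And>z. z \<in> V \<Longrightarrow> \<zero> \<preceq> z \<Longrightarrow> \<exists>c\<in>V. \<forall>x\<in>V. \<bbar>x\<bbar> \<preceq> z \<longrightarrow> \<bbar>T x\<bbar> \<preceq> c"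
    and band: "\<And>B x. band E B \<Longrightarrow> x \<in> B \<Longrightarrow> T x \<in> B"
  shows "orthomorphism E T"
proof -
  note lin = linear_operatorD[OF assms(1)]
  have "order_bounded_operator E T" unfolding order_bounded_operator_def
  proof (intro ballI)
    fix a b assume [simp]: "a \<in> V" "b \<in> V"
    obtain c where c: "c \<in> V" "\<And>x. x \<in> V \<Longrightarrow> \<bbar>x\<bbar> \<preceq> \<bbar>a\<bbar> \<oplus> \<bbar>b\<bbar> \<Longrightarrow> \<bbar>T x\<bbar> \<preceq> c"
      using ob[of "\<bbar>a\<bbar> \<oplus> \<bbar>b\<bbar>"] add_nonneg[of "\<bbar>a\<bbar>" "\<bbar>b\<bbar>"] by auto
    have "T x \<in> \<lbrace>\<ominus> c..c\<rbrace>\<^bsub>ord_of E\<^esub>" if "x \<in> \<lbrace>a..b\<rbrace>\<^bsub>ord_of E\<^esub>" for x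
    proof -
      have x [simp]: "x \<in> V" "a \<preceq> x" "x \<preceq> b" using that by (auto simp: at_least_at_most_def)
      have "x \<preceq> \<bbar>b\<bbar>" by (rule le_trans[of _ b]) auto
      then have 1: "x \<preceq> \<bbar>a\<bbar> \<oplus> \<bbar>b\<bbar>" by (rule le_trans) (auto intro: le_add_left)
      have "\<ominus> x \<preceq> \<bbar>a\<bbar>" by (rule le_trans[of _ "\<ominus> a"]) auto
      then have 2: "\<ominus> x \<preceq> \<bbar>a\<bbar> \<oplus> \<bbar>b\<bbar>" by (rule le_trans) (auto intro: le_add_right)
      have "\<bbar>T x\<bbar> \<preceq> c" using c(2)[of x] 1 2 by (simp add: abs_le_iff)
      then show ?thesis using c(1) lin(1) neg_le_iff[of "T x" c] by (simp add: at_least_at_most_def abs_le_iff)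
    qed
    then show "\<exists>c\<in>V. \<exists>d\<in>V. T ` \<lbrace>a..b\<rbrace>\<^bsub>ord_of E\<^esub> \<subseteq> \<lbrace>c..d\<rbrace>\<^bsub>ord_of E\<^esub>"
      using c(1) by (intro bexI[of _ "\<ominus> c"] bexI[of _ c]) auto
  qed
  then show ?thesis unfolding orthomorphism_def using assms by blast
qed

lemma orthomorphismD:
  assumes "orthomorphism E T"
  shows orth_linear: "linear_operator E T"
    and orth_bounded: "\<And>z. z \<in> V \<Longrightarrow> \<exists>c\<in>V. \<zero> \<preceq> c \<and> (\<forall>x\<in>V. \<bbar>x\<bbar> \<preceq> z \<longrightarrow> \<bbar>T x\<bbar> \<preceq> c)"
    and orth_band: "\<And>B x. band E B \<Longrightarrow> x \<in> B \<Longrightarrow> T x \<in> B"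
proof -
  show lin: "linear_operator E T" and "\<And>B x. band E B \<Longrightarrow> x \<in> B \<Longrightarrow> T x \<in> B"
    using assms unfolding orthomorphism_def by auto
  note lin = linear_operatorD[OF lin]
  fix z assume z [simp]: "z \<in> V"
  obtain c d where c: "c \<in> V" "d \<in> V" "T ` \<lbrace>\<ominus> z..z\<rbrace>\<^bsub>ord_of E\<^esub> \<subseteq> \<lbrace>c..d\<rbrace>\<^bsub>ord_of E\<^esub>"
    using assms z unfolding orthomorphism_def order_bounded_operator_def by (meson add.inv_closed)
  have "\<bbar>T x\<bbar> \<preceq> \<bbar>c\<bbar> \<oplus> \<bbar>d\<bbar>" if [simp]: "x \<in> V" and x: "\<bbar>x\<bbar> \<preceq> z" for x
  proof -
    have "x \<in> \<lbrace>\<ominus> z..z\<rbrace>\<^bsub>ord_of E\<^esub>" using x by (simp add: at_least_at_most_def abs_le_iff neg_le_iff[of x])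
    then have "T x \<in> \<lbrace>c..d\<rbrace>\<^bsub>ord_of E\<^esub>" using c(3) by blast
    then have *: "c \<preceq> T x" "T x \<preceq> d" by (auto simp: at_least_at_most_def)
    note [simp] = c(1,2) lin(1)
    have "T x \<preceq> \<bbar>d\<bbar>" by (rule le_trans[OF *(2)]) auto
    then have 1: "T x \<preceq> \<bbar>c\<bbar> \<oplus> \<bbar>d\<bbar>" by (rule le_trans) (auto intro: le_add_left)
    have "\<ominus> T x \<preceq> \<ominus> c" using *(1) by simp
    then have "\<ominus> T x \<preceq> \<bbar>c\<bbar>" by (rule le_trans) auto
    then have 2: "\<ominus> T x \<preceq> \<bbar>c\<bbar> \<oplus> \<bbar>d\<bbar>" by (rule le_trans) (auto intro: le_add_right)
    show "\<bbar>T x\<bbar> \<preceq> \<bbar>c\<bbar> \<oplus> \<bbar>d\<bbar>" using 1 2 by (simp add: abs_le_iff)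
  qed
  then show "\<exists>c\<in>V. \<zero> \<preceq> c \<and> (\<forall>x\<in>V. \<bbar>x\<bbar> \<preceq> z \<longrightarrow> \<bbar>T x\<bbar> \<preceq> c)"
    using c by (intro bexI[of _ "\<bbar>c\<bbar> \<oplus> \<bbar>d\<bbar>"]) (auto intro: add_nonneg)
qed

lemma linear_operator_add:
  assumes "linear_operator E S" "linear_operator E T"
  shows "linear_operator E (\<lambda>x\<in>V. S x \<oplus> T x)"
proof -
  note l = linear_operatorD[OF assms(1)] linear_operatorD[OF assms(2)]
  have "S x \<oplus> S y \<oplus> (T x \<oplus> T y) = S x \<oplus> T x \<oplus> (S y \<oplus> T y)" if "x \<in> V" "y \<in> V" for x y
    using that l by algebra
  then show ?thesis unfolding linear_operator_def using l by (simp add: smult_add_right)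
qed

lemma linear_operator_smult:
  assumes "linear_operator E T"
  shows "linear_operator E (\<lambda>x\<in>V. r \<odot> T x)"
  using linear_operatorD[OF assms] unfolding linear_operator_def
  by (simp add: smult_add_right smult_smult mult.commute)

lemma orthomorphism_add:
  assumes "orthomorphism E S" "orthomorphism E T"
  shows "orthomorphism E (\<lambda>x\<in>V. S x \<oplus> T x)"
proof (rule orthomorphismI)
  show "linear_operator E (\<lambda>x\<in>V. S x \<oplus> T x)"
    using assms by (intro linear_operator_add orth_linear)
  show "(\<lambda>x\<in>V. S x \<oplus> T x) x \<in> B" if B: "band E B" and "x \<in> B" for x B
  proof -
    have "x \<in> V" using that band_subset by blast
    then show ?thesis using band_add[OF B] orth_band[OF assms(1) that] orth_band[OF assms(2) that] by simp
  qed
  show "\<exists>c\<in>V. \<forall>x\<in>V. \<bbar>x\<bbar> \<preceq> z \<longrightarrow> \<bbar>(\<lambda>x\<in>V. S x \<oplus> T x) x\<bbar> \<preceq> c" if z: "z \<in> V" for z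
  proof -
    obtain c d where cd: "c \<in> V" "d \<in> V" "\<And>x. x \<in> V \<Longrightarrow> \<bbar>x\<bbar> \<preceq> z \<Longrightarrow> \<bbar>S x\<bbar> \<preceq> c" "\<And>x. x \<in> V \<Longrightarrow> \<bbar>x\<bbar> \<preceq> z \<Longrightarrow> \<bbar>T x\<bbar> \<preceq> d"
      using orth_bounded[OF assms(1) z] orth_bounded[OF assms(2) z] by blast
    have "\<bbar>S x \<oplus> T x\<bbar> \<preceq> c \<oplus> d" if "x \<in> V" "\<bbar>x\<bbar> \<preceq> z" for x
    proof -
      have [simp]: "S x \<in> V" "T x \<in> V" using that(1) lin_closed[OF orth_linear] assms by simp_all
      show ?thesis using cd that by (intro le_trans[OF abs_triangle add_mono]) auto
    qed
    then show ?thesis using cd(1,2) by (intro bexI[of _ "c \<oplus> d"]) auto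
  qed
qed

lemma orthomorphism_smult:
  assumes "orthomorphism E T"
  shows "orthomorphism E (\<lambda>x\<in>V. r \<odot> T x)"
proof (rule orthomorphismI)
  show "linear_operator E (\<lambda>x\<in>V. r \<odot> T x)"
    using assms by (intro linear_operator_smult orth_linear)
  show "(\<lambda>x\<in>V. r \<odot> T x) x \<in> B" if B: "band E B" and "x \<in> B" for x B
  proof -
    have "x \<in> V" using that band_subset by blast
    then show ?thesis using band_smult[OF B] orth_band[OF assms(1) that] by simp
  qed
  show "\<exists>c\<in>V. \<forall>x\<in>V. \<bbar>x\<bbar> \<preceq> z \<longrightarrow> \<bbar>(\<lambda>x\<in>V. r \<odot> T x) x\<bbar> \<preceq> c" if z: "z \<in> V" for z
  proof -
    obtain c where c: "c \<in> V" "\<And>x. x \<in> V \<Longrightarrow> \<bbar>x\<bbar> \<preceq> z \<Longrightarrow> \<bbar>T x\<bbar> \<preceq> c"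
      using orth_bounded[OF assms(1) z] by blast
    have "\<bbar>r \<odot> T x\<bbar> \<preceq> \<bar>r\<bar> \<odot> c" if "x \<in> V" "\<bbar>x\<bbar> \<preceq> z" for x
      using c(2)[OF that] c(1) lin_closed[OF orth_linear[OF assms] that(1)] by (simp add: abs_smult smult_mono)
    then show ?thesis using c(1) by (intro bexI[of _ "\<bar>r\<bar> \<odot> c"]) auto
  qed
qed

text \<open>A linear operator that is squeezed between \<open>0\<close> and a multiple of the identity preserves every
  solid subspace.\<close>

lemma orthomorphism_of_le_smult:
  assumes lin: "linear_operator E T" and r: "0 \<le> r"
    and le: "\<And>x. x \<in> V \<Longrightarrow> \<zero> \<preceq> x \<Longrightarrow> \<zero> \<preceq> T x \<and> T x \<preceq> r \<odot> x"
  shows "orthomorphism E T"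
proof -
  note l = linear_operatorD[OF lin]
  have abs: "\<bbar>T x\<bbar> \<preceq> r \<odot> \<bbar>x\<bbar>" if [simp]: "x \<in> V" for x
  proof -
    have [simp]: "T (pos x) \<in> V" "T (neg x) \<in> V" "T x \<in> V" "T (\<bbar>x\<bbar>) \<in> V" using l(1) by auto
    have e: "T x = T (pos x) \<ominus> T (neg x)" using l(6)[of "pos x" "neg x"] by (simp add: pos_neg[symmetric])
    have "T x \<preceq> T (pos x)" unfolding e using le[of "neg x"] by simp
    moreover have "\<ominus> T x \<preceq> T (neg x)"
    proof -
      have "\<ominus> T x = T (neg x) \<ominus> T (pos x)" unfolding e by (simp add: a_minus_def minus_add a_comm)
      then show ?thesis using le[of "pos x"] by simp
    qed
    moreover have "T \<bbar>x\<bbar> = T (pos x) \<oplus> T (neg x)" using l(2) by (simp add: pos_add_neg[of x])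
    ultimately have "\<bbar>T x\<bbar> \<preceq> T \<bbar>x\<bbar>" using le[of "pos x"] le[of "neg x"]
      by (auto simp: abs_le_iff intro: le_trans[OF _ le_add_right] le_trans[OF _ le_add_left])
    then show ?thesis by (rule le_trans) (use le[of "\<bbar>x\<bbar>"] in auto)
  qed
  show ?thesis
  proof (rule orthomorphismI[OF lin])
    show "T x \<in> B" if B: "band E B" and x: "x \<in> B" for B x
    proof -
      have [simp]: "x \<in> V" using band_subset[OF B] x by (rule subsetD)
      have [simp]: "T x \<in> V" using l(1) by simp
      have "\<bbar>r \<odot> x\<bbar> = r \<odot> \<bbar>x\<bbar>" using r by (simp add: abs_smult)
      then show ?thesis using abs[of x] by (intro band_solid[OF B band_smult[OF B x, of r]]) auto
    qed
    show "\<exists>c\<in>V. \<forall>x\<in>V. \<bbar>x\<bbar> \<preceq> z \<longrightarrow> \<bbar>T x\<bbar> \<preceq> c" if z: "z \<in> V" for z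
    proof (intro bexI[of _ "r \<odot> z"] ballI impI)
      fix x assume x: "x \<in> V" "\<bbar>x\<bbar> \<preceq> z"
      have "r \<odot> \<bbar>x\<bbar> \<preceq> r \<odot> z" using x r z by (intro smult_mono) auto
      then show "\<bbar>T x\<bbar> \<preceq> r \<odot> z" using le_trans[OF abs[OF x(1)]] x(1) z l(1)[OF x(1)] by simp
    qed (use z in auto)
  qed
qed

text \<open>Kantorovich extension: every element is a difference \<open>a - b\<close> of positive elements, and
  \<open>f a - f b\<close> does not depend on the choice of \<open>a\<close> and \<open>b\<close>.\<close>

lemma extend_from_positive_cone:
  assumes fV: "\<And>x. x \<in> V \<Longrightarrow> \<zero> \<preceq> x \<Longrightarrow> f x \<in> V"
    and fadd: "\<And>x y. x \<in> V \<Longrightarrow> \<zero> \<preceq> x \<Longrightarrow> y \<in> V \<Longrightarrow> \<zero> \<preceq> y \<Longrightarrow> f (x \<oplus> y) = f x \<oplus> f y"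
    and fhom: "\<And>x r. x \<in> V \<Longrightarrow> \<zero> \<preceq> x \<Longrightarrow> 0 \<le> r \<Longrightarrow> f (r \<odot> x) = r \<odot> f x"
  shows "\<exists>T\<in>extensional V. linear_operator E T \<and> (\<forall>x\<in>V. \<zero> \<preceq> x \<longrightarrow> T x = f x) \<and>
    (\<forall>x\<in>V. T x = f (pos x) \<ominus> f (neg x))"
proof -
  define T where "T = (\<lambda>x\<in>V. f (pos x) \<ominus> f (neg x))"
  have TV: "T x \<in> V" if "x \<in> V" for x using that fV[of "pos x"] fV[of "neg x"] by (simp add: T_def)
  have diff: "T (a \<ominus> b) = f a \<ominus> f b" if ab: "a \<in> V" "\<zero> \<preceq> a" "b \<in> V" "\<zero> \<preceq> b" for a b
  proof -
    define x where "x = a \<ominus> b"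
    have x [simp]: "x \<in> V" and px: "pos x \<in> V" "neg x \<in> V" using ab by (auto simp: x_def)
    have "pos x \<oplus> b = a \<oplus> neg x"
    proof -
      have "pos x \<oplus> b = (pos x \<ominus> x) \<oplus> (x \<oplus> b)" using px x ab by algebra
      also have "x \<oplus> b = a" unfolding x_def using ab by algebra
      finally show ?thesis using px ab by (simp add: pos_diff a_comm)
    qed
    then have "f (pos x \<oplus> b) = f (a \<oplus> neg x)" by simp
    then have e: "f (pos x) \<oplus> f b = f a \<oplus> f (neg x)" using ab by (simp add: fadd)
    have V: "f (pos x) \<in> V" "f (neg x) \<in> V" "f a \<in> V" "f b \<in> V" using ab by (auto intro: fV)
    have "f (pos x) \<ominus> f (neg x) = (f (pos x) \<oplus> f b) \<ominus> (f (neg x) \<oplus> f b)" using V by algebra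
    also have "\<dots> = f a \<ominus> f b" unfolding e using V by algebra
    finally show ?thesis by (simp add: T_def x_def ab)
  qed
  have f0: "f \<zero> = \<zero>" using fhom[of \<zero> 0] fV[of \<zero>] by simp
  have "T \<in> extensional V" by (simp add: T_def)
  moreover have "T x = f x" if "x \<in> V" "\<zero> \<preceq> x" for x
    using diff[of x \<zero>] that f0 fV[of x] by (simp add: a_minus_def)
  moreover have "linear_operator E T" unfolding linear_operator_def
  proof (intro conjI ballI allI)
    fix x y assume [simp]: "x \<in> V" "y \<in> V"
    have V: "f (pos x) \<in> V" "f (neg x) \<in> V" "f (pos y) \<in> V" "f (neg y) \<in> V" by (auto intro: fV)
    have pV: "pos x \<in> V" "neg x \<in> V" "pos y \<in> V" "neg y \<in> V" by auto
    have "(pos x \<ominus> neg x) \<oplus> (pos y \<ominus> neg y) = (pos x \<oplus> pos y) \<ominus> (neg x \<oplus> neg y)"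
      using pV by algebra
    then have "x \<oplus> y = (pos x \<oplus> pos y) \<ominus> (neg x \<oplus> neg y)" by (simp add: pos_neg[symmetric])
    then have "T (x \<oplus> y) = f (pos x \<oplus> pos y) \<ominus> f (neg x \<oplus> neg y)" by (simp only:) (rule diff, auto intro: add_nonneg)
    also have "\<dots> = (f (pos x) \<oplus> f (pos y)) \<ominus> (f (neg x) \<oplus> f (neg y))" by (simp add: fadd)
    also have "\<dots> = (f (pos x) \<ominus> f (neg x)) \<oplus> (f (pos y) \<ominus> f (neg y))" using V by algebra
    finally show "T (x \<oplus> y) = T x \<oplus> T y" by (simp add: T_def)
    fix r
    show "T (r \<odot> x) = r \<odot> T x"
    proof (cases "0 \<le> r")
      case True
      have "r \<odot> x = r \<odot> pos x \<ominus> r \<odot> neg x" by (simp add: smult_diff_right[symmetric] pos_neg[symmetric])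
      then have "T (r \<odot> x) = f (r \<odot> pos x) \<ominus> f (r \<odot> neg x)" using True
        by (simp only:) (rule diff, auto intro: smult_nonneg)
      then show ?thesis using True V by (simp add: fhom T_def smult_diff_right)
    next
      case False
      have "(-r) \<odot> neg x \<ominus> (-r) \<odot> pos x = r \<odot> (pos x \<ominus> neg x)"
        by (simp add: smult_add_right smult_minus_right a_minus_def smult_minus_left a_comm)
      then have "r \<odot> x = (-r) \<odot> neg x \<ominus> (-r) \<odot> pos x" by (simp add: pos_neg[symmetric])
      then have "T (r \<odot> x) = f ((-r) \<odot> neg x) \<ominus> f ((-r) \<odot> pos x)" using False
        by (simp only:) (rule diff, auto intro: smult_nonneg)
      also have "\<dots> = (-r) \<odot> f (neg x) \<ominus> (-r) \<odot> f (pos x)" using False fhom[of "neg x" "-r"] fhom[of "pos x" "-r"] by simp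
      also have "\<dots> = r \<odot> (f (pos x) \<ominus> f (neg x))"
        using V by (simp add: smult_add_right smult_minus_right a_minus_def smult_minus_left a_comm)
      finally show ?thesis by (simp add: T_def)
    qed
  qed (use TV in auto)
  ultimately show ?thesis using T_def by (intro bexI[of _ T]) auto
qed

lemma le_zero_of_power2:
  assumes [simp]: "w \<in> V" "u \<in> V" and le: "\<And>k::nat. 2 ^ k \<odot> w \<preceq> u"
  shows "w \<preceq> \<zero>"
proof -
  have "real n \<odot> pos w \<preceq> pos u" for n
  proof -
    have "2 ^ n \<odot> w \<preceq> pos u" using le by (rule le_trans) auto
    then have "(1 / 2 ^ n) \<odot> (2 ^ n \<odot> w) \<preceq> (1 / 2 ^ n) \<odot> pos u" by (rule smult_mono) auto
    then have "pos w \<preceq> (1 / 2 ^ n) \<odot> pos u" by (simp add: smult_smult sup_le_iff smult_nonneg)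
    then have "2 ^ n \<odot> pos w \<preceq> 2 ^ n \<odot> ((1 / 2 ^ n) \<odot> pos u)" by (rule smult_mono) auto
    then have "2 ^ n \<odot> pos w \<preceq> pos u" by (simp add: smult_smult)
    moreover have "real n \<le> 2 ^ n" using of_nat_less_two_power[of n, where 'a=real] by linarith
    ultimately show ?thesis by (intro le_trans[OF smult_mono_left[of "real n" "2^n"]]) auto
  qed
  then have "pos w \<preceq> \<zero>" by (intro le_of_smult_le[of _ "pos u"]) auto
  then show ?thesis by (rule le_trans[rotated]) auto
qed

end

context dvlattice
begin

lemma orth_proj:
  assumes T: "orthomorphism E T" and B: "band E B" and x: "x \<in> V"
  shows "T (proj B x) = proj B (T x)"
proof (rule proj_eqI[OF B, symmetric])
  note l = linear_operatorD[OF orth_linear[OF T]]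
  show "T x \<in> V" "T (proj B x) \<in> B" using l(1) x orth_band[OF T B proj_in[OF B x]] by auto
  have "T x \<ominus> T (proj B x) = T (x \<ominus> proj B x)" using l(6)[of x "proj B x"] x B by simp
  then show "T x \<ominus> T (proj B x) \<in> dcompl B"
    using orth_band[OF T band_dcompl[OF band_subset[OF B]] proj_compl[OF B x]] by simp
qed

text \<open>The key property of orthomorphisms. If \<open>T\<close> is multiplication by a function, this is clear since
  \<open>x\<close> is a fraction of \<open>z\<close> at each point. In general, one extracts the binary digits of this fraction
  with the doubling map: \<open>y' = 2 y - P z\<close>, where \<open>P\<close> is the projection to the region where
  \<open>2 y \<ge> z\<close>, again lies between \<open>0\<close> and \<open>z\<close>, and the excess of \<open>T y\<close> over \<open>pos (T z)\<close> at
  least doubles. As \<open>T\<close> is order bounded, there is no excess.\<close>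

lemma orth_le_pos:
  assumes T: "orthomorphism E T" and xz [simp]: "x \<in> V" "z \<in> V" "\<zero> \<preceq> x" "x \<preceq> z"
  shows "T x \<preceq> pos (T z)"
proof -
  note l = linear_operatorD[OF orth_linear[OF T]]
  define c where "c = pos (T z)"
  have [simp]: "c \<in> V" "T x \<in> V" "T z \<in> V" using l(1) by (auto simp: c_def)
  have step: "\<exists>y. y \<in> V \<and> \<zero> \<preceq> y \<and> y \<preceq> z \<and> 2 ^ k \<odot> (T x \<ominus> c) \<preceq> T y \<ominus> c" for k
  proof (induction k)
    case 0
    then show ?case by (intro exI[of _ x]) simp
  next
    case (Suc k)
    then obtain y where y [simp]: "y \<in> V" "\<zero> \<preceq> y" "y \<preceq> z" and ind: "2 ^ k \<odot> (T x \<ominus> c) \<preceq> T y \<ominus> c" by blast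
    have [simp]: "T y \<in> V" using l(1) by simp
    define v where "v = (y \<oplus> y) \<ominus> z"
    define B where "B = dcompl {neg v}"
    have v [simp]: "v \<in> V" by (simp add: v_def)
    have B: "band E B" unfolding B_def by (rule band_dcompl) auto
    note [simp] = proj_closed[OF B]
    have Pv: "proj B v = pos v" unfolding B_def by (rule proj_disjoint_neg) simp
    define y' where "y' = (y \<oplus> y) \<ominus> proj B z"
    have y'V [simp]: "y' \<in> V" by (simp add: y'_def)
    have "proj B v = proj B (y \<oplus> y) \<ominus> proj B z" unfolding v_def by (rule proj_diff[OF B]) auto
    then have "\<zero> \<preceq> proj B (y \<oplus> y) \<ominus> proj B z" using Pv by (metis pos_nonneg v)
    then have "proj B z \<preceq> proj B (y \<oplus> y)" by (simp add: le_iff_diff[symmetric])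
    then have "proj B z \<preceq> y \<oplus> y" by (rule le_trans) (auto intro!: proj_nonneg(2)[OF B] add_nonneg)
    then have 1: "\<zero> \<preceq> y'" by (simp add: y'_def le_iff_diff[symmetric])
    have "v \<preceq> z" unfolding v_def by (simp add: diff_le_iff add_mono)
    then have "pos v \<preceq> proj B z" using proj_mono[OF B, of v z] Pv by simp
    then have "v \<preceq> proj B z" by (rule le_trans[rotated]) auto
    then have "y \<oplus> y \<preceq> proj B z \<oplus> z" by (simp add: v_def diff_le_iff)
    then have 2: "y' \<preceq> z" by (simp add: y'_def diff_le_iff a_comm)
    have "proj B (T z) \<preceq> proj B c" by (rule proj_mono[OF B]) (auto simp: c_def)
    moreover have "proj B c \<preceq> c" by (rule proj_nonneg[OF B]) (auto simp: c_def)
    ultimately have Pc: "proj B (T z) \<preceq> c" by (rule le_trans) auto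
    have Ty': "T y' = (T y \<oplus> T y) \<ominus> proj B (T z)" unfolding y'_def using B by (simp add: l(2,6) orth_proj[OF T B])
    have "2 ^ Suc k \<odot> (T x \<ominus> c) = 2 \<odot> (2 ^ k \<odot> (T x \<ominus> c))" by (simp add: smult_smult)
    also have "\<dots> \<preceq> 2 \<odot> (T y \<ominus> c)" using ind by (rule smult_mono) auto
    also have "2 \<odot> (T y \<ominus> c) = ((T y \<oplus> T y) \<ominus> c) \<ominus> c"
    proof -
      have "(T y \<ominus> c) \<oplus> (T y \<ominus> c) = ((T y \<oplus> T y) \<ominus> c) \<ominus> c" using \<open>T y \<in> V\<close> \<open>c \<in> V\<close> by algebra
      then show ?thesis by (simp add: smult_2)
    qed
    finally have "2 ^ Suc k \<odot> (T x \<ominus> c) \<preceq> ((T y \<oplus> T y) \<ominus> c) \<ominus> c" .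
    moreover have "((T y \<oplus> T y) \<ominus> c) \<ominus> c \<preceq> T y' \<ominus> c"
      using diff_mono_left[OF Pc, of "T y \<oplus> T y"] unfolding Ty' by (simp add: a_minus_def)
    ultimately have "2 ^ Suc k \<odot> (T x \<ominus> c) \<preceq> T y' \<ominus> c" by (rule le_trans) (use l(1) in auto)
    with 1 2 y'V show ?case by (intro exI[of _ y'] conjI)
  qed
  obtain d where d: "d \<in> V" "\<And>y. y \<in> V \<Longrightarrow> \<bbar>y\<bbar> \<preceq> z \<Longrightarrow> \<bbar>T y\<bbar> \<preceq> d" using orth_bounded[OF T xz(2)] by blast
  have "2 ^ k \<odot> (T x \<ominus> c) \<preceq> d \<ominus> c" for k
  proof -
    obtain y where y: "y \<in> V" "\<zero> \<preceq> y" "y \<preceq> z" "2 ^ k \<odot> (T x \<ominus> c) \<preceq> T y \<ominus> c" using step by blast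
    have "\<bbar>T y\<bbar> \<preceq> d" using d(2)[of y] y by simp
    then have "T y \<preceq> d" using y d(1) l(1)[of y] by (simp add: abs_le_iff)
    then have "T y \<ominus> c \<preceq> d \<ominus> c" using y d l(1) by (simp add: a_minus_def)
    then show ?thesis using y d l(1) by (intro le_trans[OF y(4)]) auto
  qed
  then have "T x \<ominus> c \<preceq> \<zero>" using d(1) by (intro le_zero_of_power2[of _ "d \<ominus> c"]) auto
  then show ?thesis by (simp add: diff_le_iff c_def)
qed

text \<open>This is the key property for \<open>T - S\<close>. It replaces upward directedness in the proof that
  pointwise suprema are additive.\<close>

lemma orth_sup_superadditive:
  assumes S: "orthomorphism E S" and T: "orthomorphism E T"
    and [simp]: "x \<in> V" "y \<in> V" "\<zero> \<preceq> x" "\<zero> \<preceq> y"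
  shows "S x \<oplus> T y \<preceq> S (x \<oplus> y) \<squnion> T (x \<oplus> y)"
proof -
  note l = linear_operatorD[OF orth_linear[OF T]] and k = linear_operatorD[OF orth_linear[OF S]]
  note [simp] = l(1) k(1)
  define R where "R = (\<lambda>x\<in>V. T x \<oplus> (\<lambda>x\<in>V. (-1) \<odot> S x) x)"
  have R: "orthomorphism E R" unfolding R_def by (intro orthomorphism_add T orthomorphism_smult S)
  have Rx: "R u = T u \<ominus> S u" if "u \<in> V" for u using that by (simp add: R_def smult_minus_left a_minus_def)
  have "R y \<preceq> pos (R (x \<oplus> y))" using orth_le_pos[OF R, of y "x \<oplus> y"] by (simp add: le_add_left)
  then have "T y \<ominus> S y \<preceq> pos (T (x \<oplus> y) \<ominus> S (x \<oplus> y))" by (simp add: Rx)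
  then have "(T y \<ominus> S y) \<oplus> S (x \<oplus> y) \<preceq> pos (T (x \<oplus> y) \<ominus> S (x \<oplus> y)) \<oplus> S (x \<oplus> y)" by simp
  also have "(T y \<ominus> S y) \<oplus> S (x \<oplus> y) = S x \<oplus> T y"
  proof -
    have "(T y \<ominus> S y) \<oplus> (S x \<oplus> S y) = S x \<oplus> T y" using k(1)[OF assms(3)] k(1)[OF assms(4)] l(1)[OF assms(4)] by algebra
    then show ?thesis by (simp add: k(2))
  qed
  also have "pos (T (x \<oplus> y) \<ominus> S (x \<oplus> y)) \<oplus> S (x \<oplus> y) = T (x \<oplus> y) \<squnion> S (x \<oplus> y)"
    by (simp add: sup_add) (simp add: a_minus_def a_assoc l_neg)
  finally show ?thesis by (simp add: sup_comm)
qed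

end

lemma Orth_simps:
  "carrier (Orth E) = {T \<in> extensional (carrier E). orthomorphism E T}"
  "\<zero>\<^bsub>Orth E\<^esub> = (\<lambda>x\<in>carrier E. \<zero>\<^bsub>E\<^esub>)"
  "S \<oplus>\<^bsub>Orth E\<^esub> T = (\<lambda>x\<in>carrier E. S x \<oplus>\<^bsub>E\<^esub> T x)"
  "r \<odot>\<^bsub>Orth E\<^esub> T = (\<lambda>x\<in>carrier E. r \<odot>\<^bsub>E\<^esub> T x)"
  "vle (Orth E) S T \<longleftrightarrow> (\<forall>x\<in>carrier E. vle E \<zero>\<^bsub>E\<^esub> x \<longrightarrow> vle E (S x) (T x))"
  by (simp_all add: Orth_def)

context vlattice
begin

abbreviation "OE \<equiv> carrier (Orth E)"

lemma OrthD: "T \<in> OE \<Longrightarrow> orthomorphism E T" "T \<in> OE \<Longrightarrow> T \<in> extensional V" "T \<in> OE \<Longrightarrow> linear_operator E T"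
  by (auto simp: Orth_simps orth_linear)

lemma Orth_closed [simp]: "T \<in> OE \<Longrightarrow> x \<in> V \<Longrightarrow> T x \<in> V"
  using OrthD lin_closed by blast

lemma Orth_eqI:
  assumes T: "T \<in> OE" and S: "S \<in> OE" and eq: "\<And>x. x \<in> V \<Longrightarrow> \<zero> \<preceq> x \<Longrightarrow> T x = S x"
  shows "T = S"
proof (rule extensionalityI[OF OrthD(2)[OF T] OrthD(2)[OF S]])
  fix x assume [simp]: "x \<in> V"
  have "T (pos x \<ominus> neg x) = S (pos x \<ominus> neg x)"
    using lin_diff[OF OrthD(3)[OF T], of "pos x" "neg x"] lin_diff[OF OrthD(3)[OF S], of "pos x" "neg x"] eq by simp
  then show "T x = S x" by (simp add: pos_neg[symmetric])
qed

lemma Orth_add_closed: "S \<in> OE \<Longrightarrow> T \<in> OE \<Longrightarrow> S \<oplus>\<^bsub>Orth E\<^esub> T \<in> OE"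
  using orthomorphism_add by (simp add: Orth_simps)

lemma Orth_smult_closed: "T \<in> OE \<Longrightarrow> r \<odot>\<^bsub>Orth E\<^esub> T \<in> OE"
  using orthomorphism_smult by (simp add: Orth_simps)

lemma Orth_zero_closed: "\<zero>\<^bsub>Orth E\<^esub> \<in> OE"
proof -
  have "orthomorphism E (\<lambda>x\<in>V. \<zero>)"
    by (rule orthomorphism_of_le_smult[of _ 0]) (auto simp: linear_operator_def)
  then show ?thesis by (simp add: Orth_simps)
qed

lemma Orth_le_antisym:
  "S \<in> OE \<Longrightarrow> T \<in> OE \<Longrightarrow> vle (Orth E) S T \<Longrightarrow> vle (Orth E) T S \<Longrightarrow> S = T"
  by (rule Orth_eqI) (auto simp: Orth_simps(5) intro: le_antisym)

lemma module_Orth: "Module.module real_ring (Orth E)"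
proof (rule moduleI[OF cring_real_ring])
  have eq: "S = T" if "S \<in> OE" "T \<in> OE" "\<And>x. x \<in> V \<Longrightarrow> S x = T x" for S T
    using that Orth_eqI by blast
  show "abelian_group (Orth E)"
  proof (rule abelian_groupI)
    show "\<exists>T\<in>OE. T \<oplus>\<^bsub>Orth E\<^esub> S = \<zero>\<^bsub>Orth E\<^esub>" if S: "S \<in> OE" for S
    proof (intro bexI[of _ "(-1) \<odot>\<^bsub>Orth E\<^esub> S"] eq)
      show "((-1) \<odot>\<^bsub>Orth E\<^esub> S \<oplus>\<^bsub>Orth E\<^esub> S) x = \<zero>\<^bsub>Orth E\<^esub> x" if "x \<in> V" for x
        using that S by (simp add: Orth_simps(2-4) smult_minus_left l_neg)
    qed (auto simp: S Orth_add_closed Orth_smult_closed Orth_zero_closed)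
    show "\<zero>\<^bsub>Orth E\<^esub> \<oplus>\<^bsub>Orth E\<^esub> S = S" if "S \<in> OE" for S
      using that by (intro eq) (simp_all add: Orth_add_closed Orth_zero_closed, simp add: Orth_simps(2,3))
    show "S \<oplus>\<^bsub>Orth E\<^esub> T = T \<oplus>\<^bsub>Orth E\<^esub> S" if "S \<in> OE" "T \<in> OE" for S T
      using that by (intro eq) (simp_all add: Orth_add_closed, simp add: Orth_simps(3) a_comm)
    show "S \<oplus>\<^bsub>Orth E\<^esub> T \<oplus>\<^bsub>Orth E\<^esub> U = S \<oplus>\<^bsub>Orth E\<^esub> (T \<oplus>\<^bsub>Orth E\<^esub> U)" if "S \<in> OE" "T \<in> OE" "U \<in> OE" for S T U
      using that by (intro eq) (simp_all add: Orth_add_closed, simp add: Orth_simps(3) a_assoc)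
  qed (auto simp: Orth_add_closed Orth_zero_closed)
  note cl = Orth_add_closed Orth_smult_closed
  show "(a \<oplus>\<^bsub>real_ring\<^esub> b) \<odot>\<^bsub>Orth E\<^esub> T = a \<odot>\<^bsub>Orth E\<^esub> T \<oplus>\<^bsub>Orth E\<^esub> b \<odot>\<^bsub>Orth E\<^esub> T" if "T \<in> OE" for a b T
    using that by (intro eq) (simp_all add: cl, simp add: Orth_simps(3,4) smult_add_left)
  show "a \<odot>\<^bsub>Orth E\<^esub> (S \<oplus>\<^bsub>Orth E\<^esub> T) = a \<odot>\<^bsub>Orth E\<^esub> S \<oplus>\<^bsub>Orth E\<^esub> a \<odot>\<^bsub>Orth E\<^esub> T" if "S \<in> OE" "T \<in> OE" for a S T
    using that by (intro eq) (simp_all add: cl, simp add: Orth_simps(3,4) smult_add_right)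
  show "(a \<otimes>\<^bsub>real_ring\<^esub> b) \<odot>\<^bsub>Orth E\<^esub> T = a \<odot>\<^bsub>Orth E\<^esub> (b \<odot>\<^bsub>Orth E\<^esub> T)" if "T \<in> OE" for a b T
    using that by (intro eq) (simp_all add: cl, simp add: Orth_simps(4) smult_smult)
  show "\<one>\<^bsub>real_ring\<^esub> \<odot>\<^bsub>Orth E\<^esub> T = T" if "T \<in> OE" for T
    using that by (intro eq) (simp_all add: cl, simp add: Orth_simps(4))
qed (auto simp: Orth_smult_closed)

lemma Orth_minus:
  assumes T: "T \<in> OE" and x: "x \<in> V"
  shows "(\<ominus>\<^bsub>Orth E\<^esub> T) x = \<ominus> T x"
proof -
  have "(-1) \<odot>\<^bsub>Orth E\<^esub> T \<oplus>\<^bsub>Orth E\<^esub> T = \<zero>\<^bsub>Orth E\<^esub>"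
    using T by (simp add: Orth_simps(2-4) smult_minus_left l_neg cong: restrict_cong)
  moreover have "abelian_group (Orth E)" using module_Orth by (simp add: module_def)
  ultimately have "\<ominus>\<^bsub>Orth E\<^esub> T = (-1) \<odot>\<^bsub>Orth E\<^esub> T"
    using T by (intro abelian_group.minus_equality) (auto simp: Orth_smult_closed)
  then show ?thesis using T x by (simp add: Orth_simps(4) smult_minus_left)
qed

lemma Orth_diff: "S \<in> OE \<Longrightarrow> T \<in> OE \<Longrightarrow> x \<in> V \<Longrightarrow> (S \<ominus>\<^bsub>Orth E\<^esub> T) x = S x \<ominus> T x"
  by (simp add: a_minus_def Orth_simps(3) Orth_minus)

end

context dvlattice
begin

text \<open>The pointwise supremum is additive because of \<open>orth_sup_superadditive\<close>, order bounded because of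
  \<open>orth_le_pos\<close>, and it preserves bands because bands are closed under suprema.\<close>

lemma ex_pointwise_lub:
  assumes A: "A \<subseteq> OE" "A \<noteq> {}"
    and bdd: "\<And>x. x \<in> V \<Longrightarrow> \<zero> \<preceq> x \<Longrightarrow> \<exists>u\<in>V. \<forall>T\<in>A. T x \<preceq> u"
  shows "\<exists>H\<in>OE. \<forall>x\<in>V. \<zero> \<preceq> x \<longrightarrow> is_lub E (H x) ((\<lambda>T. T x) ` A)"
proof -
  have AO: "orthomorphism E T" "T \<in> OE" if "T \<in> A" for T using A(1) that OrthD(1) by blast+
  have lin: "linear_operator E T" if "T \<in> A" for T using AO(1)[OF that] orth_linear by blast
  have TV [simp]: "T x \<in> V" if "T \<in> A" "x \<in> V" for T x using AO that by simp
  have "\<exists>s. is_lub E s ((\<lambda>T. T x) ` A)" if x: "x \<in> V" "\<zero> \<preceq> x" for x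
  proof -
    obtain u where u: "u \<in> V" "\<And>T. T \<in> A \<Longrightarrow> T x \<preceq> u" using bdd[OF x] by blast
    show ?thesis by (rule ex_lub[OF _ _ u(1)]) (use A u x in auto)
  qed
  then obtain f where f: "\<And>x. x \<in> V \<Longrightarrow> \<zero> \<preceq> x \<Longrightarrow> is_lub E (f x) ((\<lambda>T. T x) ` A)" by metis
  have fV: "f x \<in> V" if "x \<in> V" "\<zero> \<preceq> x" for x using is_lubD(1)[OF f[OF that]] .
  have ub: "T x \<preceq> f x" if "x \<in> V" "\<zero> \<preceq> x" "T \<in> A" for x T using is_lubD(2)[OF f[OF that(1,2)]] that(3) by blast
  have least: "f x \<preceq> u" if "x \<in> V" "\<zero> \<preceq> x" "u \<in> V" "\<And>T. T \<in> A \<Longrightarrow> T x \<preceq> u" for x u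
    using is_lubD(3)[OF f[OF that(1,2)] that(3)] that(4) by blast
  have fadd: "f (x \<oplus> y) = f x \<oplus> f y" if xy: "x \<in> V" "\<zero> \<preceq> x" "y \<in> V" "\<zero> \<preceq> y" for x y
  proof (rule le_antisym)
    have xy': "x \<oplus> y \<in> V" "\<zero> \<preceq> x \<oplus> y" using xy by (auto intro: add_nonneg)
    note [simp] = fV[OF xy(1,2)] fV[OF xy(3,4)] fV[OF xy'] xy
    show "f (x \<oplus> y) \<in> V" "f x \<oplus> f y \<in> V" by auto
    show "f (x \<oplus> y) \<preceq> f x \<oplus> f y"
    proof (rule least[OF xy'])
      fix T assume T: "T \<in> A"
      then show "T (x \<oplus> y) \<preceq> f x \<oplus> f y" using lin_add[OF lin[OF T], of x y] ub by (simp add: add_mono)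
    qed auto
    have "f y \<preceq> f (x \<oplus> y) \<ominus> f x"
    proof (rule least[OF xy(3,4)])
      fix T assume T: "T \<in> A"
      have "f x \<preceq> f (x \<oplus> y) \<ominus> T y"
      proof (rule least[OF xy(1,2)])
        fix S assume S: "S \<in> A"
        have "S x \<oplus> T y \<preceq> S (x \<oplus> y) \<squnion> T (x \<oplus> y)"
          by (rule orth_sup_superadditive) (use S T AO in auto)
        also have "S (x \<oplus> y) \<squnion> T (x \<oplus> y) \<preceq> f (x \<oplus> y)"
          using ub[OF xy'] S T xy' by (intro sup_least) auto
        finally (le_trans) show "S x \<preceq> f (x \<oplus> y) \<ominus> T y" using S T xy' by (simp add: le_diff_iff)
      qed (use T in auto)
      then show "T y \<preceq> f (x \<oplus> y) \<ominus> f x" using T by (simp add: le_diff_iff a_comm)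
    qed auto
    then show "f x \<oplus> f y \<preceq> f (x \<oplus> y)" by (simp add: le_diff_iff a_comm)
  qed
  have fhom: "f (r \<odot> x) = r \<odot> f x" if x: "x \<in> V" "\<zero> \<preceq> x" and r: "0 \<le> r" for r x
  proof -
    have le: "f (s \<odot> y) \<preceq> s \<odot> f y" if "0 \<le> s" "y \<in> V" "\<zero> \<preceq> y" for s y
    proof (rule least)
      fix T assume T: "T \<in> A"
      show "T (s \<odot> y) \<preceq> s \<odot> f y"
        using lin_smult[OF lin[OF T], of y s] smult_mono[OF ub[of y T] that(1)] fV T that by simp
    qed (use that fV in \<open>auto intro: smult_nonneg\<close>)
    note [simp] = fV[OF x] x
    show ?thesis
    proof (cases "r = 0")
      case True
      have "is_lub E (f \<zero>) ((\<lambda>T. T \<zero>) ` A)" using f by simp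
      moreover have "(\<lambda>T. T \<zero>) ` A = {\<zero>}" using A(2) image_cong[OF refl lin_zero[OF lin], of A] by (simp add: image_constant_conv)
      ultimately have "f \<zero> = \<zero>" using is_lub_unique[OF vlattice_axioms, of "f \<zero>" "{\<zero>}" \<zero>] by (simp add: is_lub_def)
      then show ?thesis using True by simp
    next
      case False
      then have r: "0 < r" using r by simp
      have rx: "r \<odot> x \<in> V" "\<zero> \<preceq> r \<odot> x" using r by (auto intro: smult_nonneg)
      note [simp] = fV[OF rx]
      have "f x \<preceq> (1/r) \<odot> f (r \<odot> x)" using le[of "1/r" "r \<odot> x"] rx r by (simp add: smult_smult)
      then have "r \<odot> f x \<preceq> r \<odot> ((1/r) \<odot> f (r \<odot> x))" by (rule smult_mono) (use r in auto)
      then have "r \<odot> f x \<preceq> f (r \<odot> x)" using r by (simp add: smult_smult)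
      then show ?thesis using le[of r x] r by (intro le_antisym) auto
    qed
  qed
  obtain H where H: "H \<in> extensional V" "linear_operator E H" "\<And>x. x \<in> V \<Longrightarrow> \<zero> \<preceq> x \<Longrightarrow> H x = f x"
    "\<And>x. x \<in> V \<Longrightarrow> H x = f (pos x) \<ominus> f (neg x)"
    using extend_from_positive_cone[OF fV fadd fhom] by blast
  have "orthomorphism E H"
  proof (rule orthomorphismI[OF H(2)])
    fix z assume z [simp]: "z \<in> V" "\<zero> \<preceq> z"
    obtain T0 where T0: "T0 \<in> A" using A(2) by blast
    obtain c where c [simp]: "c \<in> V" "\<zero> \<preceq> c" and cT: "\<And>x. x \<in> V \<Longrightarrow> \<bbar>x\<bbar> \<preceq> z \<Longrightarrow> \<bbar>T0 x\<bbar> \<preceq> c"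
      using orth_bounded[OF AO(1)[OF T0] z(1)] by blast
    note [simp] = fV[OF z]
    have fb: "\<bbar>f x\<bbar> \<preceq> pos (f z) \<oplus> c" if x: "x \<in> V" "\<zero> \<preceq> x" "x \<preceq> z" for x
    proof -
      note [simp] = fV[OF x(1,2)] x
      have "f x \<preceq> pos (f z)"
      proof (rule least[OF x(1,2)])
        fix T assume T: "T \<in> A"
        have "T x \<preceq> pos (T z)" by (rule orth_le_pos[OF AO(1)[OF T]]) auto
        moreover have "pos (T z) \<preceq> pos (f z)"
          using le_trans[OF ub[OF z T] sup_ge1[of "f z" \<zero>]] T by (simp add: sup_le_iff)
        ultimately show "T x \<preceq> pos (f z)" by (rule le_trans) (use T in auto)
      qed auto
      then have 1: "f x \<preceq> pos (f z) \<oplus> c" by (rule le_trans) (auto intro: le_add_right)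
      have "\<ominus> f x \<preceq> \<ominus> T0 x" using ub[OF x(1,2) T0] T0 by simp
      also have "\<ominus> T0 x \<preceq> c" using cT[of x] T0 by (simp add: abs_le_iff)
      finally (le_trans) have "\<ominus> f x \<preceq> c" using T0 by simp
      then have 2: "\<ominus> f x \<preceq> pos (f z) \<oplus> c" by (rule le_trans) (auto intro: le_add_left)
      from 1 2 show ?thesis by (simp add: abs_le_iff)
    qed
    have "\<bbar>H x\<bbar> \<preceq> (pos (f z) \<oplus> c) \<oplus> (pos (f z) \<oplus> c)" if x [simp]: "x \<in> V" and xz: "\<bbar>x\<bbar> \<preceq> z" for x
    proof -
      have p: "pos x \<preceq> z" by (rule le_trans[OF pos_le_abs xz]) auto
      have n: "neg x \<preceq> z" by (rule le_trans[OF neg_le_abs xz]) auto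
      have [simp]: "f (pos x) \<in> V" "f (neg x) \<in> V" by (auto intro: fV)
      have "\<bbar>f (pos x) \<oplus> \<ominus> f (neg x)\<bbar> \<preceq> \<bbar>f (pos x)\<bbar> \<oplus> \<bbar>\<ominus> f (neg x)\<bbar>" by (rule abs_triangle) auto
      then have "\<bbar>H x\<bbar> \<preceq> \<bbar>f (pos x)\<bbar> \<oplus> \<bbar>f (neg x)\<bbar>" by (simp add: H(4) a_minus_def)
      moreover have "\<bbar>f (pos x)\<bbar> \<oplus> \<bbar>f (neg x)\<bbar> \<preceq> (pos (f z) \<oplus> c) \<oplus> (pos (f z) \<oplus> c)"
        using fb[of "pos x"] fb[of "neg x"] p n by (intro add_mono) auto
      ultimately show ?thesis by (rule le_trans) (auto simp: H(4))
    qed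
    then show "\<exists>c\<in>V. \<forall>x\<in>V. \<bbar>x\<bbar> \<preceq> z \<longrightarrow> \<bbar>H x\<bbar> \<preceq> c"
      by (intro bexI[of _ "(pos (f z) \<oplus> c) \<oplus> (pos (f z) \<oplus> c)"]) auto
  next
    fix B x assume B: "band E B" and x: "x \<in> B"
    have [simp]: "x \<in> V" using band_subset[OF B] x by (rule subsetD)
    have fB: "f y \<in> B" if "y \<in> B" "y \<in> V" "\<zero> \<preceq> y" for y
    proof (rule band_lub[OF B _ _ f[OF that(2,3)]])
      show "(\<lambda>T. T y) ` A \<subseteq> B" using orth_band[OF AO(1) B that(1)] by blast
    qed (use A in auto)
    show "H x \<in> B" using band_diff[OF B fB fB, of "pos x" "neg x"] band_pos[OF B x] band_negpart[OF B x] by (simp add: H(4))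
  qed
  then have "H \<in> OE" using H(1) by (simp add: Orth_simps)
  moreover have "is_lub E (H x) ((\<lambda>T. T x) ` A)" if "x \<in> V" "\<zero> \<preceq> x" for x
    using f[OF that] H(3)[OF that] by simp
  ultimately show ?thesis by blast
qed

lemma Orth_is_lubI:
  assumes "H \<in> OE" "\<And>x. x \<in> V \<Longrightarrow> \<zero> \<preceq> x \<Longrightarrow> is_lub E (H x) ((\<lambda>T. T x) ` A)"
  shows "is_lub (Orth E) H A"
  using assms unfolding is_lub_def by (fastforce simp: Orth_simps(5))

lemma vector_lattice_Orth: "vector_lattice (Orth E)"
proof (rule vector_latticeI[OF module_Orth])
  show "\<exists>s. is_lub (Orth E) s {S, T}" if "S \<in> OE" "T \<in> OE" for S T
  proof -
    have "\<exists>H\<in>OE. \<forall>x\<in>V. \<zero> \<preceq> x \<longrightarrow> is_lub E (H x) ((\<lambda>T. T x) ` {S, T})"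
    proof (rule ex_pointwise_lub)
      show "\<exists>u\<in>V. \<forall>U\<in>{S, T}. U x \<preceq> u" if "x \<in> V" for x
        using that \<open>S \<in> OE\<close> \<open>T \<in> OE\<close> by (intro bexI[of _ "S x \<squnion> T x"]) auto
    qed (use that in auto)
    then show ?thesis using Orth_is_lubI by blast
  qed
  show "archimedean (Orth E)" unfolding archimedean_def
  proof (intro ballI impI)
    fix S T assume S: "S \<in> OE" and T: "T \<in> OE" and le: "\<forall>n. vle (Orth E) (real n \<odot>\<^bsub>Orth E\<^esub> S) T"
    have "S x \<preceq> \<zero>" if x: "x \<in> V" "\<zero> \<preceq> x" for x
    proof (rule le_of_smult_le)
      show "real n \<odot> S x \<preceq> T x" for n using le[rule_format, of n] x by (simp add: Orth_simps(4,5))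
    qed (use S T x in auto)
    then show "vle (Orth E) S \<zero>\<^bsub>Orth E\<^esub>" by (simp add: Orth_simps(2,5))
  qed
qed (auto simp: Orth_simps(3-5) Orth_le_antisym smult_mono intro: le_trans[OF _ _ Orth_closed Orth_closed Orth_closed])

lemma dvlattice_Orth: "dvlattice (Orth E)"
proof
  show "vector_lattice (Orth E)" by (rule vector_lattice_Orth)
  show "dedekind_complete (Orth E)" unfolding dedekind_complete_def
  proof (intro allI impI)
    fix A assume A: "A \<subseteq> OE \<and> A \<noteq> {} \<and> Upper (ord_of (Orth E)) A \<noteq> {}"
    then obtain U where U: "U \<in> OE" "\<And>T. T \<in> A \<Longrightarrow> vle (Orth E) T U" by (auto simp: Upper_def)
    have "\<exists>H\<in>OE. \<forall>x\<in>V. \<zero> \<preceq> x \<longrightarrow> is_lub E (H x) ((\<lambda>T. T x) ` A)"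
    proof (rule ex_pointwise_lub)
      show "\<exists>u\<in>V. \<forall>T\<in>A. T x \<preceq> u" if "x \<in> V" "\<zero> \<preceq> x" for x
        using that U by (intro bexI[of _ "U x"]) (auto simp: Orth_simps(5))
    qed (use A in auto)
    then obtain H where "is_lub (Orth E) H A" using Orth_is_lubI by blast
    then show "\<exists>s. least (ord_of (Orth E)) s (Upper (ord_of (Orth E)) A)"
      using least_Upper_iff[of A "Orth E"] A by blast
  qed
qed

interpretation Or: dvlattice "Orth E" by (rule dvlattice_Orth)

lemma Orth_lub_pointwise:
  assumes A: "A \<subseteq> OE" "A \<noteq> {}" and H: "is_lub (Orth E) H A" and x: "x \<in> V" "\<zero> \<preceq> x"
  shows "is_lub E (H x) ((\<lambda>T. T x) ` A)"
proof -
  have HO: "H \<in> OE" using H by (rule Or.is_lubD)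
  have "\<exists>H\<in>OE. \<forall>x\<in>V. \<zero> \<preceq> x \<longrightarrow> is_lub E (H x) ((\<lambda>T. T x) ` A)"
  proof (rule ex_pointwise_lub[OF A])
    show "\<exists>u\<in>V. \<forall>T\<in>A. T x \<preceq> u" if "x \<in> V" "\<zero> \<preceq> x" for x
      using that Or.is_lubD(2)[OF H] HO by (intro bexI[of _ "H x"]) (auto simp: Orth_simps(5))
  qed
  then obtain H' where H': "H' \<in> OE" "\<forall>x\<in>V. \<zero> \<preceq> x \<longrightarrow> is_lub E (H' x) ((\<lambda>T. T x) ` A)" by blast
  then have "is_lub (Orth E) H' A" using Orth_is_lubI by blast
  then have "H = H'" using is_lub_unique[OF Or.vlattice_axioms H] by simp
  then show ?thesis using H' x by blast
qed

lemma Orth_glb_pointwise: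
  assumes A: "A \<subseteq> OE" "A \<noteq> {}" and H: "is_glb (Orth E) H A" and x: "x \<in> V" "\<zero> \<preceq> x"
  shows "is_glb E (H x) ((\<lambda>T. T x) ` A)"
proof -
  have HO: "H \<in> OE" using H by (rule Or.is_glbD)
  obtain L where L: "is_lub (Orth E) L (a_inv (Orth E) ` A)"
  proof -
    have "\<ominus>\<^bsub>Orth E\<^esub> T \<in> OE \<and> vle (Orth E) (\<ominus>\<^bsub>Orth E\<^esub> T) (\<ominus>\<^bsub>Orth E\<^esub> H)" if "T \<in> A" for T
      using subsetD[OF A(1) that] Or.is_glbD(2)[OF H that] HO by simp
    then have "\<exists>L. is_lub (Orth E) L (a_inv (Orth E) ` A)"
      using A(2) HO by (intro Or.ex_lub[of _ "\<ominus>\<^bsub>Orth E\<^esub> H"]) auto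
    then show ?thesis using that by blast
  qed
  have LO: "L \<in> OE" using L by (rule Or.is_lubD)
  have "is_glb (Orth E) (\<ominus>\<^bsub>Orth E\<^esub> L) A" by (rule Or.is_glb_neg[OF A(1) L])
  then have HL: "H = \<ominus>\<^bsub>Orth E\<^esub> L" using is_glb_unique[OF Or.vlattice_axioms H] by simp
  have "is_lub E (L x) ((\<lambda>T. T x) ` (a_inv (Orth E) ` A))"
    by (rule Orth_lub_pointwise[OF _ _ L x]) (use A in auto)
  also have "(\<lambda>T. T x) ` (a_inv (Orth E) ` A) = a_inv E ` ((\<lambda>T. T x) ` A)"
    unfolding image_image by (rule image_cong[OF refl], rule Orth_minus) (use A x in auto)
  finally have "is_glb E (\<ominus> L x) ((\<lambda>T. T x) ` A)" by (rule is_glb_neg[rotated]) (use A x in auto)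
  then show ?thesis unfolding HL using Orth_minus[OF LO x(1)] by simp
qed

lemma Orth_inf:
  assumes "S \<in> OE" "T \<in> OE" "x \<in> V" "\<zero> \<preceq> x"
  shows "(S \<sqinter>\<^bsub>ord_of (Orth E)\<^esub> T) x = S x \<sqinter> T x"
proof -
  have "is_glb E ((S \<sqinter>\<^bsub>ord_of (Orth E)\<^esub> T) x) ((\<lambda>T. T x) ` {S, T})"
    by (rule Orth_glb_pointwise[OF _ _ Or.is_glb_inf]) (use assms in auto)
  then show ?thesis using is_glb_unique[OF vlattice_axioms _ is_glb_inf[of "S x" "T x"]] assms by simp
qed

lemma Orth_abs:
  assumes "T \<in> OE" "x \<in> V" "\<zero> \<preceq> x"
  shows "(vabs (Orth E) T) x = \<bbar>T x\<bbar>"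
proof -
  have "is_lub E ((vabs (Orth E) T) x) ((\<lambda>T. T x) ` {T, \<ominus>\<^bsub>Orth E\<^esub> T})"
    unfolding vabs_def by (rule Orth_lub_pointwise[OF _ _ Or.is_lub_sup]) (use assms in auto)
  then have "is_lub E ((vabs (Orth E) T) x) {T x, \<ominus> T x}" using assms by (simp add: Orth_minus)
  then show ?thesis
    unfolding vabs_def[of E] using is_lub_unique[OF vlattice_axioms _ is_lub_sup[of "T x" "\<ominus> T x"]] assms by simp
qed

lemma Orth_abs_le:
  assumes T: "T \<in> OE" and [simp]: "x \<in> V"
  shows "\<bbar>T x\<bbar> \<preceq> (vabs (Orth E) T) (\<bbar>x\<bbar>)"
proof -
  define M where "M = vabs (Orth E) T"
  have M: "M \<in> OE" using T by (simp add: M_def)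
  note [simp] = Orth_closed[OF T] Orth_closed[OF M]
  have e: "T x = T (pos x) \<oplus> \<ominus> T (neg x)"
    using lin_diff[OF OrthD(3)[OF T], of "pos x" "neg x"] by (simp add: pos_neg[symmetric]) (simp add: a_minus_def)
  have "\<bbar>T x\<bbar> \<preceq> \<bbar>T (pos x)\<bbar> \<oplus> \<bbar>T (neg x)\<bbar>" unfolding e using abs_triangle[of "T (pos x)" "\<ominus> T (neg x)"] by simp
  also have "\<bbar>T (pos x)\<bbar> \<oplus> \<bbar>T (neg x)\<bbar> = M (pos x \<oplus> neg x)"
    using T by (simp add: Orth_abs M_def[symmetric] lin_add[OF OrthD(3)[OF M]]) (simp add: Orth_abs M_def)
  finally show ?thesis by (simp add: pos_add_neg[of x, symmetric] M_def)
qed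

end

section \<open>Order convergence along a filter\<close>

text \<open>Order convergence to zero of positive elements, in terms of the filter of tails of the net. The
  eventual upper bounds take the place of the dominating net, and the index type is arbitrary.\<close>

definition ub_set :: "'a vlat \<Rightarrow> 'i filter \<Rightarrow> ('i \<Rightarrow> 'a) \<Rightarrow> 'a set" where
  "ub_set G F z = {u \<in> carrier G. \<forall>\<^sub>F i in F. vle G (z i) u}"

definition o_null :: "'a vlat \<Rightarrow> 'i filter \<Rightarrow> ('i \<Rightarrow> 'a) \<Rightarrow> bool" where
  "o_null G F z \<longleftrightarrow> is_glb G \<zero>\<^bsub>G\<^esub> (ub_set G F z)"

definition uo_null :: "'a vlat \<Rightarrow> 'i filter \<Rightarrow> ('i \<Rightarrow> 'a) \<Rightarrow> bool" where
  "uo_null G F z \<longleftrightarrow> (\<forall>y\<in>carrier G. vle G \<zero>\<^bsub>G\<^esub> y \<longrightarrow> o_null G F (\<lambda>i. vabs G (z i) \<sqinter>\<^bsub>ord_of G\<^esub> y))"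

lemma net_filter_ne_bot: "directed A lq \<Longrightarrow> net_filter A lq \<noteq> bot"
  unfolding trivial_limit_def eventually_net_filter by (auto simp: directed_def reflp_on_def)

lemma eventually_net_mem: "directed A lq \<Longrightarrow> \<forall>\<^sub>F i in net_filter A lq. i \<in> A"
  by (simp add: eventually_net_filter) (auto simp: directed_def)

lemma ub_set_cong: "\<forall>\<^sub>F i in F. z i = z' i \<Longrightarrow> ub_set G F z = ub_set G F z'"
proof -
  assume *: "\<forall>\<^sub>F i in F. z i = z' i"
  have "(\<forall>\<^sub>F i in F. vle G (z i) u) \<longleftrightarrow> (\<forall>\<^sub>F i in F. vle G (z' i) u)" for u
    by (rule eventually_cong[OF *]) simp
  then show ?thesis by (simp add: ub_set_def)
qed

lemma o_null_cong: "\<forall>\<^sub>F i in F. z i = z' i \<Longrightarrow> o_null G F z \<longleftrightarrow> o_null G F z'"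
  unfolding o_null_def by (simp add: ub_set_cong)

context vlattice
begin

lemma o_nullD:
  assumes "o_null E F z" "w \<in> V" "\<And>u. u \<in> V \<Longrightarrow> \<forall>\<^sub>F i in F. z i \<preceq> u \<Longrightarrow> w \<preceq> u"
  shows "w \<preceq> \<zero>"
  using is_glbD(3)[of \<zero> "ub_set E F z" w] assms unfolding o_null_def ub_set_def by blast

lemma o_nullI:
  assumes F: "F \<noteq> bot" and z: "\<forall>\<^sub>F i in F. z i \<in> V \<and> \<zero> \<preceq> z i"
    and w: "\<And>w. w \<in> V \<Longrightarrow> \<zero> \<preceq> w \<Longrightarrow> (\<And>u. u \<in> V \<Longrightarrow> \<forall>\<^sub>F i in F. z i \<preceq> u \<Longrightarrow> w \<preceq> u) \<Longrightarrow> w \<preceq> \<zero>"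
  shows "o_null E F z"
  unfolding o_null_def
proof (rule is_glb_zeroI)
  fix u assume "u \<in> ub_set E F z"
  then have u: "u \<in> V" "\<forall>\<^sub>F i in F. z i \<preceq> u" by (auto simp: ub_set_def)
  have "\<exists>i. (z i \<in> V \<and> \<zero> \<preceq> z i) \<and> z i \<preceq> u"
    using eventually_happens'[OF F eventually_conj[OF z u(2)]] .
  then show "u \<in> V \<and> \<zero> \<preceq> u" using u(1) le_trans[of \<zero> _ u] by auto
next
  fix u assume u: "u \<in> V" "\<zero> \<preceq> u" "\<And>a. a \<in> ub_set E F z \<Longrightarrow> u \<preceq> a"
  have "u \<preceq> \<zero>" by (rule w[OF u(1,2)]) (simp add: u(3) ub_set_def)
  then show "u = \<zero>" using u le_antisym by simp
qed

lemma o_null_ub_nonempty: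
  assumes "o_null E F z" "\<forall>\<^sub>F i in F. z i \<in> V"
  shows "ub_set E F z \<noteq> {}"
proof
  assume e: "ub_set E F z = {}"
  have "\<forall>u\<in>V. u \<preceq> \<zero>" using assms(1) unfolding o_null_def e is_glb_def by simp
  then have "\<forall>\<^sub>F i in F. z i \<preceq> \<zero>" using assms(2) by (auto elim: eventually_mono)
  then show False using e by (auto simp: ub_set_def)
qed

lemma o_null_mono:
  assumes F: "F \<noteq> bot" and null: "o_null E F z"
    and z: "\<forall>\<^sub>F i in F. z' i \<in> V \<and> z i \<in> V \<and> \<zero> \<preceq> z' i \<and> z' i \<preceq> z i"
  shows "o_null E F z'"
proof (rule o_nullI[OF F])
  show "\<forall>\<^sub>F i in F. z' i \<in> V \<and> \<zero> \<preceq> z' i" using z by (auto elim: eventually_mono)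
  fix w assume w: "w \<in> V" "\<And>u. u \<in> V \<Longrightarrow> \<forall>\<^sub>F i in F. z' i \<preceq> u \<Longrightarrow> w \<preceq> u"
  show "w \<preceq> \<zero>"
  proof (rule o_nullD[OF null w(1)])
    fix u assume u: "u \<in> V" "\<forall>\<^sub>F i in F. z i \<preceq> u"
    have "\<forall>\<^sub>F i in F. z' i \<preceq> u" using z u(2)
    proof eventually_elim
      case (elim i)
      then show ?case using le_trans[of "z' i" "z i" u] u(1) by simp
    qed
    then show "w \<preceq> u" using w u by blast
  qed
qed

text \<open>Each member of a dominating net is an eventual upper bound, and the eventual upper bounds form
  a decreasing net themselves.\<close>

lemma o_conv_iff:
  assumes d: "directed A lq" and x: "\<And>a. a \<in> A \<Longrightarrow> x a \<in> V" and l: "l \<in> V"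
  shows "o_conv E A lq x l \<longleftrightarrow> o_null E (net_filter A lq) (\<lambda>a. \<bbar>l \<ominus> x a\<bbar>)"
proof
  let ?F = "net_filter A lq" and ?z = "\<lambda>a. \<bbar>l \<ominus> x a\<bbar>"
  have z: "\<forall>\<^sub>F a in ?F. ?z a \<in> V \<and> \<zero> \<preceq> ?z a"
    using eventually_net_mem[OF d] by eventually_elim (use x l in auto)
  show "o_null E ?F ?z" if conv: "o_conv E A lq x l"
  proof -
    obtain B :: "'a set" and lq' y where B: "decreases_to_zero E B lq' y"
       "\<forall>b0\<in>B. \<exists>a0\<in>A. \<forall>a\<in>A. lq a0 a \<longrightarrow> ?z a \<preceq> y b0"
      using conv unfolding o_conv_def by blast
    then have yV: "\<And>b. b \<in> B \<Longrightarrow> y b \<in> V" and glb: "is_glb E \<zero> (y ` B)"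
      using greatest_Lower_iff[of "y ` B" E] unfolding decreases_to_zero_def by auto
    show ?thesis
    proof (rule o_nullI[OF net_filter_ne_bot[OF d] z])
      fix w assume w: "w \<in> V" "\<And>u. u \<in> V \<Longrightarrow> \<forall>\<^sub>F a in ?F. ?z a \<preceq> u \<Longrightarrow> w \<preceq> u"
      show "w \<preceq> \<zero>"
      proof (rule is_glbD(3)[OF glb w(1)])
        fix v assume "v \<in> y ` B"
        then obtain b where b: "b \<in> B" "v = y b" by blast
        have "\<forall>\<^sub>F a in ?F. ?z a \<preceq> y b" using B(2) b unfolding eventually_net_filter[OF d] by blast
        then show "w \<preceq> v" using w(2) yV b by blast
      qed
    qed
  qed
  show "o_conv E A lq x l" if null: "o_null E ?F ?z"
  proof -
    let ?B = "ub_set E ?F ?z"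
    have BV: "?B \<subseteq> V" by (auto simp: ub_set_def)
    have ne: "?B \<noteq> {}" by (rule o_null_ub_nonempty[OF null]) (use z in \<open>auto elim: eventually_mono\<close>)
    have inf: "u \<sqinter> v \<in> ?B" if "u \<in> ?B" "v \<in> ?B" for u v
    proof -
      have uv: "u \<in> V" "v \<in> V" "\<forall>\<^sub>F a in ?F. ?z a \<preceq> u" "\<forall>\<^sub>F a in ?F. ?z a \<preceq> v" using that by (auto simp: ub_set_def)
      have "\<forall>\<^sub>F a in ?F. ?z a \<preceq> u \<sqinter> v" using uv(3,4) z
        by eventually_elim (use uv in \<open>simp add: le_inf_iff\<close>)
      then show ?thesis using uv by (simp add: ub_set_def)
    qed
    have "directed ?B (\<lambda>u v. v \<preceq> u)" unfolding directed_def
    proof (intro conjI ballI)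
      show "reflp_on ?B (\<lambda>u v. v \<preceq> u)" using BV by (auto simp: reflp_on_def)
      show "transp_on ?B (\<lambda>u v. v \<preceq> u)" using subsetD[OF BV] by (intro transp_onI) (rule le_trans)
      fix u v assume "u \<in> ?B" "v \<in> ?B"
      then show "\<exists>c\<in>?B. c \<preceq> u \<and> c \<preceq> v" using inf[of u v] subsetD[OF BV, of u] subsetD[OF BV, of v] by (intro bexI[of _ "u \<sqinter> v"]) simp_all
    qed (rule ne)
    moreover have "decreases_to_zero E ?B (\<lambda>u v. v \<preceq> u) (\<lambda>u. u)"
      using BV null unfolding decreases_to_zero_def o_null_def by (auto simp: greatest_Lower_iff)
    moreover have "\<forall>b0\<in>?B. \<exists>a0\<in>A. \<forall>a\<in>A. lq a0 a \<longrightarrow> ?z a \<preceq> b0"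
      by (auto simp: ub_set_def eventually_net_filter[OF d])
    ultimately show ?thesis unfolding o_conv_def by blast
  qed
qed

lemma uo_conv_iff:
  assumes d: "directed A lq" and x: "\<And>a. a \<in> A \<Longrightarrow> x a \<in> V" and l: "l \<in> V"
  shows "uo_conv E A lq x l \<longleftrightarrow> uo_null E (net_filter A lq) (\<lambda>a. x a \<ominus> l)"
proof -
  have "o_conv E A lq (\<lambda>a. \<bbar>x a \<ominus> l\<bbar> \<sqinter> y) \<zero> \<longleftrightarrow> o_null E (net_filter A lq) (\<lambda>a. \<bbar>x a \<ominus> l\<bbar> \<sqinter> y)"
    if y: "y \<in> V" "\<zero> \<preceq> y" for y
  proof -
    have "\<forall>\<^sub>F a in net_filter A lq. \<bbar>\<zero> \<ominus> \<bbar>x a \<ominus> l\<bbar> \<sqinter> y\<bbar> = \<bbar>x a \<ominus> l\<bbar> \<sqinter> y"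
      using eventually_net_mem[OF d] by eventually_elim (use x l y in \<open>simp add: a_minus_def inf_nonneg\<close>)
    then show ?thesis using d x l y by (subst o_conv_iff) (auto simp: o_null_cong)
  qed
  then show ?thesis unfolding uo_conv_def uo_null_def by blast
qed

lemma uo_null_of_o_null:
  assumes F: "F \<noteq> bot" and z: "\<forall>\<^sub>F i in F. z i \<in> V" and null: "o_null E F (\<lambda>i. \<bbar>z i\<bbar>)"
  shows "uo_null E F z"
  unfolding uo_null_def
proof (intro ballI impI)
  fix y assume y: "y \<in> V" "\<zero> \<preceq> y"
  show "o_null E F (\<lambda>i. \<bbar>z i\<bbar> \<sqinter> y)"
    by (rule o_null_mono[OF F null], use z in eventually_elim) (use y in \<open>auto intro: inf_nonneg\<close>)
qed

lemma o_conv_imp_uo_conv: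
  assumes d: "directed A lq" and x: "\<And>a. a \<in> A \<Longrightarrow> x a \<in> V" and l: "l \<in> V" and "o_conv E A lq x l"
  shows "uo_conv E A lq x l"
proof -
  have "\<forall>\<^sub>F a in net_filter A lq. \<bbar>l \<ominus> x a\<bbar> = \<bbar>x a \<ominus> l\<bbar>"
    using eventually_net_mem[OF d] by eventually_elim (use x l abs_diff_comm in auto)
  then have "o_null E (net_filter A lq) (\<lambda>a. \<bbar>x a \<ominus> l\<bbar>)"
    using assms(4) o_conv_iff[where x=x and l=l, OF d x l] by (simp add: o_null_cong)
  moreover have "\<forall>\<^sub>F a in net_filter A lq. x a \<ominus> l \<in> V"
    using eventually_net_mem[OF d] by eventually_elim (use x l in auto)
  ultimately have "uo_null E (net_filter A lq) (\<lambda>a. x a \<ominus> l)"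
    by (intro uo_null_of_o_null net_filter_ne_bot[OF d])
  moreover have "uo_conv E A lq x l \<longleftrightarrow> uo_null E (net_filter A lq) (\<lambda>a. x a \<ominus> l)"
    by (rule uo_conv_iff[OF d _ l]) (use x in auto)
  ultimately show ?thesis by simp
qed

end

section \<open>Order and unbounded order convergence of orthomorphisms\<close>

context dvlattice
begin

interpretation Or: dvlattice "Orth E" by (rule dvlattice_Orth)

lemma o_null_Orth_pointwise:
  assumes F: "F \<noteq> bot" and T: "\<forall>\<^sub>F i in F. T i \<in> OE"
    and null: "o_null (Orth E) F (\<lambda>i. vabs (Orth E) (T i))" and x: "x \<in> V"
  shows "o_null E F (\<lambda>i. \<bbar>T i x\<bbar>)"
proof (rule o_nullI[OF F])
  show "\<forall>\<^sub>F i in F. \<bbar>T i x\<bbar> \<in> V \<and> \<zero> \<preceq> \<bbar>T i x\<bbar>" using T x by (auto elim: eventually_mono)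
  let ?U = "ub_set (Orth E) F (\<lambda>i. vabs (Orth E) (T i))"
  have "?U \<noteq> {}" by (rule Or.o_null_ub_nonempty[OF null]) (use T in \<open>auto elim: eventually_mono\<close>)
  then have glb: "is_glb E (\<zero>\<^bsub>Orth E\<^esub> (\<bbar>x\<bbar>)) ((\<lambda>U. U (\<bbar>x\<bbar>)) ` ?U)"
    using null x unfolding o_null_def by (intro Orth_glb_pointwise) (auto simp: ub_set_def)
  fix w assume w: "w \<in> V" "\<And>u. u \<in> V \<Longrightarrow> \<forall>\<^sub>F i in F. \<bbar>T i x\<bbar> \<preceq> u \<Longrightarrow> w \<preceq> u"
  have "w \<preceq> \<zero>\<^bsub>Orth E\<^esub> (\<bbar>x\<bbar>)"
  proof (rule is_glbD(3)[OF glb w(1)])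
    fix v assume "v \<in> (\<lambda>U. U (\<bbar>x\<bbar>)) ` ?U"
    then obtain U where U: "U \<in> OE" "\<forall>\<^sub>F i in F. vle (Orth E) (vabs (Orth E) (T i)) U" "v = U (\<bbar>x\<bbar>)"
      by (auto simp: ub_set_def)
    have "\<forall>\<^sub>F i in F. \<bbar>T i x\<bbar> \<preceq> v" using U(2) T
    proof eventually_elim
      case (elim i)
      have "vabs (Orth E) (T i) (\<bbar>x\<bbar>) \<preceq> v" using elim(1) x U(3) by (simp add: Orth_simps(5))
      then show ?case using Orth_abs_le[OF elim(2) x] elim(2) x U by (intro le_trans[of "\<bbar>T i x\<bbar>" "vabs (Orth E) (T i) (\<bbar>x\<bbar>)" v]) auto
    qed
    then show "w \<preceq> v" using w(2)[of v] U x by simp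
  qed
  then show "w \<preceq> \<zero>" using x by (simp add: Orth_simps(2))
qed

text \<open>If \<open>w\<close> stays below all remainders of \<open>y\<close>, then \<open>n (w \<sqinter> h) \<le> y\<close> for all \<open>n\<close>, by induction. So
  \<open>w\<close> is disjoint from \<open>h\<close>, but it also lies in the band generated by \<open>h\<close>.\<close>

lemma double_dcompl_exhausted:
  assumes h: "h \<in> V" "\<zero> \<preceq> h" and y: "y \<in> dcompl (dcompl {h})" "\<zero> \<preceq> y"
    and w: "w \<in> V" "\<zero> \<preceq> w" "\<And>n::nat. w \<preceq> y \<ominus> y \<sqinter> (real n \<odot> h)"
  shows "w = \<zero>"
proof -
  have B: "band E (dcompl (dcompl {h}))" by (rule band_dcompl) (auto simp: dcompl_def)
  have yV: "y \<in> V" using y by (simp add: dcompl_def)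
  note [simp] = h w(1,2) yV y(2)
  define c where "c = w \<sqinter> h"
  have c [simp]: "c \<in> V" "\<zero> \<preceq> c" "c \<preceq> w" "c \<preceq> h" by (auto simp: c_def inf_nonneg)
  have "real n \<odot> c \<preceq> y" for n
  proof (induction n)
    case (Suc n)
    have "real n \<odot> c \<preceq> real n \<odot> h" by (rule smult_mono) auto
    then have "real n \<odot> c \<preceq> y \<sqinter> (real n \<odot> h)" using Suc by (simp add: le_inf_iff)
    moreover have "c \<preceq> y \<ominus> y \<sqinter> (real n \<odot> h)" using w(3)[of n] by (rule le_trans[OF c(3)]) auto
    ultimately have "real n \<odot> c \<oplus> c \<preceq> y \<sqinter> (real n \<odot> h) \<oplus> (y \<ominus> y \<sqinter> (real n \<odot> h))" by (rule add_mono) auto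
    also have "y \<sqinter> (real n \<odot> h) \<oplus> (y \<ominus> y \<sqinter> (real n \<odot> h)) = y" using yV h(1) by algebra
    finally show ?case using smult_add_left[of c "real n" 1] by (simp add: add.commute)
  qed simp
  then have "c \<preceq> \<zero>" using le_of_smult_le[of c y] by simp
  then have "c = \<zero>" using le_antisym[of c \<zero>] by simp
  then have wd: "w \<in> dcompl {h}" by (simp add: dcompl_def c_def)
  have "w \<preceq> y" using w(3)[of 0] by (simp add: inf_comm[of y] inf_absorb1 a_minus_def)
  then have "w \<in> dcompl (dcompl {h})" using band_solid_pos[OF B y(1)] by simp
  moreover have "dcompl {h} \<subseteq> V" unfolding dcompl_def by blast
  ultimately show ?thesis using dcompl_Int[OF wd] by blast
qed

lemma inf_le_inf_add_diff:
  assumes [simp]: "a \<in> V" "b \<in> V" "c \<in> V"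
  shows "a \<sqinter> b \<preceq> a \<sqinter> c \<oplus> (b \<ominus> b \<sqinter> c)"
proof -
  have n: "\<zero> \<preceq> b \<ominus> b \<sqinter> c" by (simp add: le_iff_diff[symmetric])
  have "a \<sqinter> b \<preceq> a \<oplus> (b \<ominus> b \<sqinter> c)" by (rule le_trans[of _ a]) (auto intro: le_add_right n)
  then have 1: "a \<sqinter> b \<ominus> (b \<ominus> b \<sqinter> c) \<preceq> a" by (subst diff_le_iff) auto
  have "c \<oplus> (b \<ominus> b \<sqinter> c) = b \<oplus> (c \<ominus> b \<sqinter> c)" using assms by algebra
  moreover have "\<zero> \<preceq> c \<ominus> b \<sqinter> c" by (simp add: le_iff_diff[symmetric])
  ultimately have "b \<preceq> c \<oplus> (b \<ominus> b \<sqinter> c)" using le_add_right[of b "c \<ominus> b \<sqinter> c"] by simp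
  then have "a \<sqinter> b \<preceq> c \<oplus> (b \<ominus> b \<sqinter> c)" by (rule le_trans[of _ b, rotated]) auto
  then have 2: "a \<sqinter> b \<ominus> (b \<ominus> b \<sqinter> c) \<preceq> c" by (subst diff_le_iff) auto
  from 1 2 have "a \<sqinter> b \<ominus> (b \<ominus> b \<sqinter> c) \<preceq> a \<sqinter> c" by (simp add: le_inf_iff)
  then show ?thesis by (subst (asm) diff_le_iff) auto
qed

lemma scalar_in_Orth: "0 \<le> r \<Longrightarrow> (\<lambda>x\<in>V. r \<odot> x) \<in> OE"
proof -
  assume r: "0 \<le> r"
  have "linear_operator E (\<lambda>x\<in>V. r \<odot> x)"
    by (auto simp: linear_operator_def smult_add_right smult_smult mult.commute)
  then show ?thesis using r by (auto simp: Orth_simps intro!: orthomorphism_of_le_smult[of _ r] smult_nonneg)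
qed

text \<open>Testing \<open>uo\<close>-convergence in \<open>Orth E\<close> against multiples of the identity controls \<open>\<bar>T i x\<bar>\<close>
  below multiples of \<open>\<bar>x\<bar>\<close>. The values of \<open>T i x\<close> lie in the band generated by \<open>x\<close>, and in
  this band every \<open>y\<close> is exhausted by its truncations at multiples of \<open>\<bar>x\<bar>\<close>.\<close>

lemma uo_null_Orth_pointwise:
  assumes F: "F \<noteq> bot" and T: "\<forall>\<^sub>F i in F. T i \<in> OE"
    and null: "uo_null (Orth E) F T" and x: "x \<in> V"
  shows "uo_null E F (\<lambda>i. T i x)"
  unfolding uo_null_def
proof (intro ballI impI)
  fix y assume y: "y \<in> V" "\<zero> \<preceq> y"
  define h where "h = \<bbar>x\<bbar>"
  define R where "R i = vabs (Orth E) (T i)" for i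
  define B where "B = dcompl (dcompl {h})"
  have h [simp]: "h \<in> V" "\<zero> \<preceq> h" using x by (auto simp: h_def)
  have B: "band E B" unfolding B_def by (rule band_dcompl) (auto simp: dcompl_def)
  have hB: "h \<in> B" unfolding B_def dcompl_def by (auto simp: inf_comm)
  define y1 where "y1 = proj B y"
  have y1: "y1 \<in> V" "\<zero> \<preceq> y1" "y1 \<in> B" and y1max: "\<And>b. b \<in> B \<Longrightarrow> b \<preceq> y \<Longrightarrow> b \<preceq> y1"
    using proj_nonneg[OF B y] proj_in[OF B y(1)] proj_closed[OF B y(1)] by (auto simp: y1_def)
  note [simp] = y y1(1,2)
  have R: "\<forall>\<^sub>F i in F. R i \<in> OE \<and> \<zero> \<preceq> R i h \<and> \<bbar>T i x\<bbar> \<preceq> R i h \<and> T i x \<in> V"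
    using T
  proof eventually_elim
    case (elim i)
    then show ?case using Orth_abs_le[OF elim x] Orth_abs[OF elim h] x by (simp add: R_def h_def)
  qed
  have main: "o_null E F (\<lambda>i. R i h \<sqinter> y)"
  proof (rule o_nullI[OF F])
    show "\<forall>\<^sub>F i in F. R i h \<sqinter> y \<in> V \<and> \<zero> \<preceq> R i h \<sqinter> y"
      using R by eventually_elim (simp add: inf_nonneg)
    fix w assume w: "w \<in> V" "\<zero> \<preceq> w" "\<And>u. u \<in> V \<Longrightarrow> \<forall>\<^sub>F i in F. R i h \<sqinter> y \<preceq> u \<Longrightarrow> w \<preceq> u"
    have "w \<preceq> y1 \<ominus> y1 \<sqinter> (real n \<odot> h)" for n
    proof -
      define N where "N = (\<lambda>x\<in>V. real n \<odot> x)"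
      have N: "N \<in> OE" unfolding N_def by (rule scalar_in_Orth) simp
      have N0: "vle (Orth E) \<zero>\<^bsub>Orth E\<^esub> N" by (auto simp: Orth_simps N_def smult_nonneg)
      have Nh: "N h = real n \<odot> h" by (simp add: N_def)
      let ?U = "ub_set (Orth E) F (\<lambda>i. R i \<sqinter>\<^bsub>ord_of (Orth E)\<^esub> N)"
      define r where "r = y1 \<ominus> y1 \<sqinter> (real n \<odot> h)"
      have [simp]: "r \<in> V" by (simp add: r_def)
      have nullN: "o_null (Orth E) F (\<lambda>i. R i \<sqinter>\<^bsub>ord_of (Orth E)\<^esub> N)"
        using null N N0 unfolding uo_null_def R_def by blast
      have "?U \<noteq> {}" by (rule Or.o_null_ub_nonempty[OF nullN]) (use R N in \<open>auto elim: eventually_mono\<close>)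
      then have glb: "is_glb E (\<zero>\<^bsub>Orth E\<^esub> h) ((\<lambda>U. U h) ` ?U)"
        using nullN h unfolding o_null_def by (intro Orth_glb_pointwise) (auto simp: ub_set_def)
      have "w \<ominus> r \<preceq> \<zero>\<^bsub>Orth E\<^esub> h"
      proof (rule is_glbD(3)[OF glb])
        fix v assume "v \<in> (\<lambda>U. U h) ` ?U"
        then obtain U where U: "U \<in> OE" "\<forall>\<^sub>F i in F. vle (Orth E) (R i \<sqinter>\<^bsub>ord_of (Orth E)\<^esub> N) U" "v = U h"
          by (auto simp: ub_set_def)
        have vV: "v \<in> V" using U by simp
        have "\<forall>\<^sub>F i in F. R i h \<sqinter> y \<preceq> v \<oplus> r" using U(2) R
        proof eventually_elim
          case (elim i)
          note Ri = conjunct1[OF elim(2)]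
          have [simp]: "R i h \<in> V" "\<zero> \<preceq> R i h" using elim(2) by auto
          have "R i h \<sqinter> y \<in> B"
          proof (rule band_solid_pos[OF B])
            show "R i h \<in> B" using orth_band[OF OrthD(1)[OF Ri] B hB] .
          qed (auto intro: inf_nonneg)
          then have 1: "R i h \<sqinter> y \<preceq> R i h \<sqinter> y1" using y1max[of "R i h \<sqinter> y"] by (simp add: le_inf_iff)
          have 2: "R i h \<sqinter> y1 \<preceq> R i h \<sqinter> (real n \<odot> h) \<oplus> r" unfolding r_def by (rule inf_le_inf_add_diff) auto
          have "(R i \<sqinter>\<^bsub>ord_of (Orth E)\<^esub> N) h \<preceq> U h" using elim(1) h unfolding Orth_simps(5) by blast
          then have "R i h \<sqinter> (real n \<odot> h) \<preceq> v" using Orth_inf[OF Ri N h] U(3) Nh by simp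
          then have 3: "R i h \<sqinter> (real n \<odot> h) \<oplus> r \<preceq> v \<oplus> r" using vV by simp
          show ?case using vV by (intro le_trans[OF 1 le_trans[OF 2 3]]) auto
        qed
        then have "w \<preceq> v \<oplus> r" using w(3)[of "v \<oplus> r"] vV by simp
        then show "w \<ominus> r \<preceq> v" using vV w(1) by (simp add: diff_le_iff)
      qed (use w in auto)
      then have "w \<ominus> r \<preceq> \<zero>" by (simp add: Orth_simps(2))
      then show ?thesis using w(1) by (simp add: diff_le_iff r_def[symmetric])
    qed
    then have "w = \<zero>" using y1 w unfolding B_def by (intro double_dcompl_exhausted[of h y1]) auto
    then show "w \<preceq> \<zero>" by simp
  qed
  show "o_null E F (\<lambda>i. \<bbar>T i x\<bbar> \<sqinter> y)"
    by (rule o_null_mono[OF F main], use R in eventually_elim) (auto intro: inf_nonneg inf_mono)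
qed

text \<open>Conversely, the supremum of a tail of the net in \<open>Orth E\<close> is formed pointwise. So if \<open>v\<close> bounds a
  tail at the point \<open>x\<close>, then some bound of this tail in \<open>Orth E\<close> takes a value below \<open>v\<close> at \<open>x\<close>.\<close>

lemma uo_null_Orth_of_pointwise:
  assumes F: "F \<noteq> bot" and T: "\<forall>\<^sub>F i in F. T i \<in> OE"
    and null: "\<And>x. x \<in> V \<Longrightarrow> uo_null E F (\<lambda>i. T i x)"
  shows "uo_null (Orth E) F T"
  unfolding uo_null_def
proof (intro ballI impI)
  fix Y assume Y: "Y \<in> OE" "vle (Orth E) \<zero>\<^bsub>Orth E\<^esub> Y"
  define R where "R i = vabs (Orth E) (T i) \<sqinter>\<^bsub>ord_of (Orth E)\<^esub> Y" for i
  have R: "R i \<in> OE \<and> vle (Orth E) \<zero>\<^bsub>Orth E\<^esub> (R i) \<and> vle (Orth E) (R i) Y" if "T i \<in> OE" for i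
    using that Y by (simp add: R_def Or.inf_nonneg)
  have Rx: "R i x = \<bbar>T i x\<bbar> \<sqinter> Y x" if "T i \<in> OE" "x \<in> V" "\<zero> \<preceq> x" for i x
    using that Y by (simp add: R_def Orth_inf Orth_abs)
  show "o_null (Orth E) F (\<lambda>i. vabs (Orth E) (T i) \<sqinter>\<^bsub>ord_of (Orth E)\<^esub> Y)"
    unfolding R_def[symmetric]
  proof (rule Or.o_nullI[OF F])
    show "\<forall>\<^sub>F i in F. R i \<in> OE \<and> vle (Orth E) \<zero>\<^bsub>Orth E\<^esub> (R i)" using T R by (auto elim: eventually_mono)
    fix W assume W: "W \<in> OE" "\<And>U. U \<in> OE \<Longrightarrow> \<forall>\<^sub>F i in F. vle (Orth E) (R i) U \<Longrightarrow> vle (Orth E) W U"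
    have "W x \<preceq> \<zero>" if x: "x \<in> V" "\<zero> \<preceq> x" for x
    proof (rule o_nullD)
      have "\<zero> \<preceq> Y x" "Y x \<in> V" using Y x by (auto simp: Orth_simps(2,5))
      then show "o_null E F (\<lambda>i. \<bbar>T i x\<bbar> \<sqinter> Y x)" using null[OF x(1)] unfolding uo_null_def by blast
      fix v assume v: "v \<in> V" "\<forall>\<^sub>F i in F. \<bbar>T i x\<bbar> \<sqinter> Y x \<preceq> v"
      define Q where "Q = {i. T i \<in> OE \<and> \<bbar>T i x\<bbar> \<sqinter> Y x \<preceq> v}"
      have Q: "\<forall>\<^sub>F i in F. i \<in> Q" unfolding Q_def using T v(2) by eventually_elim simp
      have "Q \<noteq> {}" using eventually_happens'[OF F Q] by blast
      then have QR: "R ` Q \<subseteq> OE" "R ` Q \<noteq> {}" using R by (auto simp: Q_def)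
      obtain L where L: "is_lub (Orth E) L (R ` Q)"
        using Or.ex_lub[OF QR Y(1)] R by (auto simp: Q_def)
      have LO: "L \<in> OE" using L by (rule Or.is_lubD)
      have "\<forall>\<^sub>F i in F. vle (Orth E) (R i) L" using Q by eventually_elim (use Or.is_lubD(2)[OF L] in blast)
      then have "W x \<preceq> L x" using W(2)[OF LO] x by (simp add: Orth_simps(5))
      moreover have "L x \<preceq> v"
        by (rule is_lubD(3)[OF Orth_lub_pointwise[OF QR L x] v(1)]) (use Rx x in \<open>auto simp: Q_def\<close>)
      ultimately show "W x \<preceq> v" by (rule le_trans) (use W LO v x in auto)
    qed (use W x in auto)
    then show "vle (Orth E) W \<zero>\<^bsub>Orth E\<^esub>" by (simp add: Orth_simps(2,5))
  qed
qed

lemma Orth_diff_eventually: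
  assumes d: "directed A lq" and T: "\<And>a. a \<in> A \<Longrightarrow> T a \<in> OE" and S: "S \<in> OE" and x: "x \<in> V"
  shows "\<forall>\<^sub>F a in net_filter A lq. (T a \<ominus>\<^bsub>Orth E\<^esub> S) x = T a x \<ominus> S x"
    "\<forall>\<^sub>F a in net_filter A lq. T a \<ominus>\<^bsub>Orth E\<^esub> S \<in> OE"
  subgoal using eventually_net_mem[OF d] by eventually_elim (use T S x Orth_diff in auto)
  subgoal using eventually_net_mem[OF d] by eventually_elim (use T S in auto)
  done

lemma uo_conv_Orth_iff:
  assumes d: "directed A lq" and T: "\<And>a. a \<in> A \<Longrightarrow> T a \<in> OE" and S: "S \<in> OE"
  shows "uo_conv (Orth E) A lq T S \<longleftrightarrow> (\<forall>x\<in>V. uo_conv E A lq (\<lambda>a. T a x) (S x))"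
proof -
  let ?F = "net_filter A lq"
  have 1: "uo_conv (Orth E) A lq T S \<longleftrightarrow> uo_null (Orth E) ?F (\<lambda>a. T a \<ominus>\<^bsub>Orth E\<^esub> S)"
    by (rule Or.uo_conv_iff[OF d T S])
  have "uo_conv E A lq (\<lambda>a. T a x) (S x) \<longleftrightarrow> uo_null E ?F (\<lambda>a. T a x \<ominus> S x)" if x: "x \<in> V" for x
    by (rule uo_conv_iff[OF d]) (use T S x in auto)
  moreover have "uo_null E ?F (\<lambda>a. T a x \<ominus> S x) \<longleftrightarrow> uo_null E ?F (\<lambda>a. (T a \<ominus>\<^bsub>Orth E\<^esub> S) x)" if x: "x \<in> V" for x
    unfolding uo_null_def
  proof (intro ball_cong refl imp_cong o_null_cong)
    fix y
    have "\<forall>\<^sub>F a in ?F. (T a \<ominus>\<^bsub>Orth E\<^esub> S) x = T a x \<ominus> S x"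
      by (rule Orth_diff_eventually(1)[OF d _ S x]) (use T in auto)
    then show "\<forall>\<^sub>F a in ?F. \<bbar>T a x \<ominus> S x\<bbar> \<sqinter> y = \<bbar>(T a \<ominus>\<^bsub>Orth E\<^esub> S) x\<bbar> \<sqinter> y"
      by eventually_elim simp
  qed
  ultimately have 2: "(\<forall>x\<in>V. uo_conv E A lq (\<lambda>a. T a x) (S x)) \<longleftrightarrow>
      (\<forall>x\<in>V. uo_null E ?F (\<lambda>a. (T a \<ominus>\<^bsub>Orth E\<^esub> S) x))" by blast
  have "\<forall>\<^sub>F a in ?F. T a \<ominus>\<^bsub>Orth E\<^esub> S \<in> OE"
    by (rule Orth_diff_eventually(2)[OF d _ S zero_closed]) (use T in auto)
  note b = net_filter_ne_bot[OF d] this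
  show ?thesis unfolding 1 2 using uo_null_Orth_pointwise[OF b] uo_null_Orth_of_pointwise[OF b] by blast
qed

lemma o_conv_Orth_imp_pointwise:
  assumes d: "directed A lq" and T: "\<And>a. a \<in> A \<Longrightarrow> T a \<in> OE" and S: "S \<in> OE"
    and conv: "o_conv (Orth E) A lq T S" and x: "x \<in> V"
  shows "o_conv E A lq (\<lambda>a. T a x) (S x)"
proof -
  let ?F = "net_filter A lq"
  have "o_null (Orth E) ?F (\<lambda>a. vabs (Orth E) (S \<ominus>\<^bsub>Orth E\<^esub> T a))"
    using conv Or.o_conv_iff[where x=T and l=S, OF d T S] by simp
  then have "o_null E ?F (\<lambda>a. \<bbar>(S \<ominus>\<^bsub>Orth E\<^esub> T a) x\<bbar>)"
    by (rule o_null_Orth_pointwise[OF net_filter_ne_bot[OF d] _ _ x, rotated])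
       (use eventually_net_mem[OF d] in eventually_elim, use T S in auto)
  moreover have "\<forall>\<^sub>F a in ?F. \<bbar>(S \<ominus>\<^bsub>Orth E\<^esub> T a) x\<bbar> = \<bbar>S x \<ominus> T a x\<bbar>"
    using eventually_net_mem[OF d] by eventually_elim (use T S x Orth_diff in auto)
  ultimately have "o_null E ?F (\<lambda>a. \<bbar>S x \<ominus> T a x\<bbar>)" by (simp add: o_null_cong)
  then show ?thesis by (subst o_conv_iff[OF d]) (use T S x in auto)
qed

end

section \<open>Neighbourhoods of zero in a uo-Lebesgue topology\<close>

context vlattice
begin

definition nb :: "'a topology \<Rightarrow> 'a set \<Rightarrow> bool" where
  "nb \<tau> U \<longleftrightarrow> U \<subseteq> V \<and> (\<exists>W. openin \<tau> W \<and> \<zero> \<in> W \<and> W \<subseteq> U)"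

lemma nb_mono: "nb \<tau> U \<Longrightarrow> U \<subseteq> U' \<Longrightarrow> U' \<subseteq> V \<Longrightarrow> nb \<tau> U'"
  unfolding nb_def by blast

lemma nb_Int: "nb \<tau> U \<Longrightarrow> nb \<tau> U' \<Longrightarrow> nb \<tau> (U \<inter> U')"
  unfolding nb_def by (meson Int_iff Int_mono openin_Int le_infI1)

lemma nb_zero: "nb \<tau> U \<Longrightarrow> \<zero> \<in> U"
  unfolding nb_def by blast

lemma solid_abs_iff: "solid E S \<Longrightarrow> x \<in> V \<Longrightarrow> \<bbar>x\<bbar> \<in> S \<longleftrightarrow> x \<in> S"
  unfolding solid_def using le_refl[of "\<bbar>x\<bbar>"] abs_of_nonneg[of "\<bbar>x\<bbar>"] by (metis abs_closed abs_nonneg)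

lemma solid_nonneg: "solid E S \<Longrightarrow> x \<in> S \<Longrightarrow> y \<in> V \<Longrightarrow> \<zero> \<preceq> y \<Longrightarrow> y \<preceq> \<bbar>x\<bbar> \<Longrightarrow> y \<in> S"
  unfolding solid_def by (metis abs_of_nonneg)

lemma solid_Int: "solid E S \<Longrightarrow> solid E T \<Longrightarrow> solid E (S \<inter> T)"
  unfolding solid_def by blast

lemma topspace_linear: "linear_topology E \<tau> \<Longrightarrow> topspace \<tau> = V"
  by (simp add: linear_topology_def)

lemma nb_V: "linear_topology E \<tau> \<Longrightarrow> nb \<tau> V"
  unfolding nb_def using topspace_linear openin_topspace by (metis subset_refl zero_closed)

lemma nb_half:
  assumes lin: "linear_topology E \<tau>" and ls: "locally_solid E \<tau>" and U: "nb \<tau> U"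
  shows "\<exists>S. solid E S \<and> nb \<tau> S \<and> S \<subseteq> U \<and> (\<forall>x\<in>S. \<forall>y\<in>S. x \<oplus> y \<in> U)"
proof -
  obtain W where W: "openin \<tau> W" "\<zero> \<in> W" "W \<subseteq> U" using U by (auto simp: nb_def)
  have top: "topspace \<tau> = V" by (rule topspace_linear[OF lin])
  let ?P = "{z \<in> topspace (prod_topology \<tau> \<tau>). (\<lambda>(x, y). x \<oplus> y) z \<in> W}"
  have "openin (prod_topology \<tau> \<tau>) ?P"
    using lin W(1) unfolding linear_topology_def by (intro openin_continuous_map_preimage) auto
  then have *: "\<forall>x y. (x, y) \<in> ?P \<longrightarrow> (\<exists>A B. openin \<tau> A \<and> openin \<tau> B \<and> x \<in> A \<and> y \<in> B \<and> A \<times> B \<subseteq> ?P)"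
    unfolding openin_prod_topology_alt .
  have "(\<zero>, \<zero>) \<in> ?P" using W(2) by (simp add: top)
  from *[rule_format, OF this]
  obtain A B where AB: "openin \<tau> A" "openin \<tau> B" "\<zero> \<in> A" "\<zero> \<in> B" "A \<times> B \<subseteq> ?P"
    by (elim exE conjE) (rule that)
  have "openin \<tau> (A \<inter> B \<inter> W)" "\<zero> \<in> A \<inter> B \<inter> W" using AB W by auto
  then obtain S W' where S: "solid E S" "openin \<tau> W'" "\<zero> \<in> W'" "W' \<subseteq> S" "S \<subseteq> A \<inter> B \<inter> W"
    using ls unfolding locally_solid_def by meson
  have "S \<subseteq> V" using S(1) by (simp add: solid_def)
  then have "nb \<tau> S" using S unfolding nb_def by blast
  moreover have "x \<oplus> y \<in> U" if "x \<in> S" "y \<in> S" for x y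
  proof -
    have "(x, y) \<in> ?P" by (rule subsetD[OF AB(5)]) (use S(5) that in blast)
    then show ?thesis using W(3) by auto
  qed
  ultimately show ?thesis using S W by (intro exI[of _ S]) auto
qed

lemma continuous_translation:
  assumes lin: "linear_topology E \<tau>" and l: "l \<in> V"
  shows "continuous_map \<tau> \<tau> (\<lambda>x. x \<oplus> l)"
proof -
  have top: "topspace \<tau> = V" by (rule topspace_linear[OF lin])
  have "continuous_map \<tau> (prod_topology \<tau> \<tau>) (\<lambda>x. (x, l))"
    using l top by (simp add: continuous_map_paired)
  moreover have "continuous_map (prod_topology \<tau> \<tau>) \<tau> (\<lambda>(x, y). x \<oplus> y)"
    using lin by (simp add: linear_topology_def)
  ultimately show ?thesis by (auto dest: continuous_map_compose simp: o_def)
qed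

lemma nb_translate:
  assumes lin: "linear_topology E \<tau>" and U: "openin \<tau> U" "x \<in> U"
  shows "nb \<tau> {z \<in> V. z \<oplus> x \<in> U}"
proof -
  have top: "topspace \<tau> = V" by (rule topspace_linear[OF lin])
  have x: "x \<in> V" using U openin_subset top by blast
  have "openin \<tau> {z \<in> topspace \<tau>. z \<oplus> x \<in> U}"
    by (rule openin_continuous_map_preimage[OF continuous_translation[OF lin x] U(1)])
  then show ?thesis unfolding nb_def top using U x by (intro conjI exI[of _ "{z \<in> V. z \<oplus> x \<in> U}"]) auto
qed

lemma openin_of_nb:
  assumes lin: "linear_topology E \<tau>" and U: "U \<subseteq> V" "\<And>x. x \<in> U \<Longrightarrow> nb \<tau> {z \<in> V. z \<oplus> x \<in> U}"
  shows "openin \<tau> U"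
proof (subst openin_subopen, intro ballI)
  fix x assume x: "x \<in> U"
  have top: "topspace \<tau> = V" by (rule topspace_linear[OF lin])
  have xV: "x \<in> V" using x U by blast
  obtain W where W: "openin \<tau> W" "\<zero> \<in> W" "W \<subseteq> {z \<in> V. z \<oplus> x \<in> U}" using U(2)[OF x] by (auto simp: nb_def)
  have "openin \<tau> {z \<in> topspace \<tau>. z \<oplus> \<ominus> x \<in> W}"
    using xV by (intro openin_continuous_map_preimage[OF continuous_translation[OF lin] W(1)]) auto
  moreover have "{z \<in> V. z \<oplus> \<ominus> x \<in> W} \<subseteq> U"
  proof
    fix z assume "z \<in> {z \<in> V. z \<oplus> \<ominus> x \<in> W}"
    then have z: "z \<in> V" "(z \<oplus> \<ominus> x) \<oplus> x \<in> U" using W(3) by auto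
    then show "z \<in> U" using xV by (simp add: a_assoc l_neg)
  qed
  ultimately show "\<exists>T. openin \<tau> T \<and> x \<in> T \<and> T \<subseteq> U"
    using xV W(2) top by (intro exI[of _ "{z \<in> V. z \<oplus> \<ominus> x \<in> W}"]) (auto simp: r_neg)
qed

text \<open>The net \<open>(p, S) \<mapsto> p\<close> has the same tails as the given family, whatever the index type of the
  latter.\<close>

lemma uo_lebesgue_eventually:
  assumes uoL: "uo_lebesgue E \<tau>" and F: "F \<noteq> bot" and x: "\<forall>\<^sub>F i in F. x i \<in> V"
    and null: "uo_null E F x" and U: "nb \<tau> U"
  shows "\<forall>\<^sub>F i in F. x i \<in> U"
proof -
  define A where "A = {(p, S). p \<in> S \<and> p \<in> V \<and> (\<forall>\<^sub>F i in F. x i \<in> S)}"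
  define lq where "lq = (\<lambda>(a :: 'a \<times> 'a set) (b :: 'a \<times> 'a set). snd b \<subseteq> snd a)"
  have ex: "\<exists>p. (p, S) \<in> A" if "\<forall>\<^sub>F i in F. x i \<in> S" for S
    using eventually_happens'[OF F eventually_conj[OF that x]] that unfolding A_def by auto
  have d: "directed A lq" unfolding directed_def
  proof (intro conjI ballI)
    show "A \<noteq> {}" using ex[of UNIV] by auto
    show "reflp_on A lq" "transp_on A lq" by (auto simp: reflp_on_def transp_on_def lq_def)
    fix a b assume "a \<in> A" "b \<in> A"
    then have "\<forall>\<^sub>F i in F. x i \<in> snd a \<inter> snd b" unfolding A_def by (auto elim: eventually_elim2)
    from ex[OF this] obtain p where "(p, snd a \<inter> snd b) \<in> A" ..
    then show "\<exists>c\<in>A. lq a c \<and> lq b c" unfolding lq_def by (intro bexI[of _ "(p, snd a \<inter> snd b)"]) auto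
  qed
  have ev: "(\<forall>\<^sub>F a in net_filter A lq. P (fst a)) \<longleftrightarrow> (\<forall>\<^sub>F i in F. P (x i))" for P
    unfolding eventually_net_filter[OF d]
  proof
    assume "\<exists>a\<in>A. \<forall>b\<in>A. lq a b \<longrightarrow> P (fst b)"
    then obtain a where a: "a \<in> A" "\<And>b. b \<in> A \<Longrightarrow> lq a b \<Longrightarrow> P (fst b)" by blast
    have "\<forall>\<^sub>F i in F. x i \<in> snd a" using a(1) by (auto simp: A_def)
    with x show "\<forall>\<^sub>F i in F. P (x i)"
      by eventually_elim (use a(1) a(2)[of "(x _, snd a)"] in \<open>auto simp: A_def lq_def\<close>)
  next
    assume P: "\<forall>\<^sub>F i in F. P (x i)"
    then obtain p where "(p, {q. P q}) \<in> A" using ex[of "{q. P q}"] by auto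
    then show "\<exists>a\<in>A. \<forall>b\<in>A. lq a b \<longrightarrow> P (fst b)"
      by (intro bexI[of _ "(p, {q. P q})"]) (auto simp: A_def lq_def)
  qed
  have "uo_conv E A lq fst \<zero>"
  proof (subst uo_conv_iff[OF d])
    show "fst a \<in> V" if "a \<in> A" for a using that by (auto simp: A_def)
    have "ub_set E (net_filter A lq) (\<lambda>a. \<bbar>fst a \<ominus> \<zero>\<bbar> \<sqinter> y) = ub_set E F (\<lambda>i. \<bbar>x i\<bbar> \<sqinter> y)" for y
    proof -
      have "(\<forall>\<^sub>F a in net_filter A lq. \<bbar>fst a \<ominus> \<zero>\<bbar> \<sqinter> y \<preceq> u) \<longleftrightarrow> (\<forall>\<^sub>F i in F. \<bbar>x i \<ominus> \<zero>\<bbar> \<sqinter> y \<preceq> u)" for u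
        using ev[of "\<lambda>p. \<bbar>p \<ominus> \<zero>\<bbar> \<sqinter> y \<preceq> u"] .
      also have "(\<forall>\<^sub>F i in F. \<bbar>x i \<ominus> \<zero>\<bbar> \<sqinter> y \<preceq> u) \<longleftrightarrow> (\<forall>\<^sub>F i in F. \<bbar>x i\<bbar> \<sqinter> y \<preceq> u)" for u
        by (rule eventually_cong[OF x]) (simp add: a_minus_def)
      finally show ?thesis by (simp add: ub_set_def)
    qed
    then show "uo_null E (net_filter A lq) (\<lambda>a. fst a \<ominus> \<zero>)"
      using null unfolding uo_null_def o_null_def by simp
  qed auto
  moreover have "\<forall>a\<in>A. fst a \<in> V" by (auto simp: A_def)
  ultimately have "limitin \<tau> fst \<zero> (net_filter A lq)"
    using uoL d unfolding uo_lebesgue_def by blast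
  moreover obtain W where W: "openin \<tau> W" "\<zero> \<in> W" "W \<subseteq> U" using U by (auto simp: nb_def)
  ultimately have "\<forall>\<^sub>F a in net_filter A lq. fst a \<in> W" by (intro limitinD)
  then have "\<forall>\<^sub>F a in net_filter A lq. fst a \<in> U" by (rule eventually_mono) (use W(3) in blast)
  then show ?thesis using ev[of "\<lambda>p. p \<in> U"] by simp
qed

lemma uo_lebesgueD: "uo_lebesgue E \<tau> \<Longrightarrow> linear_topology E \<tau>" "uo_lebesgue E \<tau> \<Longrightarrow> locally_solid E \<tau>"
  by (auto simp: uo_lebesgue_def)

lemma uo_lebesgue_limit:
  assumes uoL: "uo_lebesgue E \<tau>" and F: "F \<noteq> bot" and x: "\<forall>\<^sub>F i in F. x i \<in> V" and l: "l \<in> V"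
    and null: "uo_null E F (\<lambda>i. x i \<ominus> l)"
  shows "limitin \<tau> x l F"
  unfolding limitin_def
proof (intro conjI allI impI)
  note lin = uo_lebesgueD(1)[OF uoL]
  show "l \<in> topspace \<tau>" using l topspace_linear[OF lin] by simp
  fix U assume U: "openin \<tau> U \<and> l \<in> U"
  have "\<forall>\<^sub>F i in F. x i \<ominus> l \<in> V" using x by eventually_elim (use l in auto)
  then have "\<forall>\<^sub>F i in F. x i \<ominus> l \<in> {z \<in> V. z \<oplus> l \<in> U}"
    by (rule uo_lebesgue_eventually[OF uoL F _ null nb_translate[OF lin]]) (use U in auto)
  with x show "\<forall>\<^sub>F i in F. x i \<in> U"
  proof eventually_elim
    case (elim i)
    have "x i \<ominus> l \<oplus> l = x i" using elim(1) l by algebra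
    then show ?case using elim(2) by simp
  qed
qed

text \<open>Order continuity: the differences \<open>s - d\<close>, indexed by \<open>D\<close> itself, decrease to zero.\<close>

lemma uo_lebesgue_lub:
  assumes uoL: "uo_lebesgue E \<tau>" and D: "D \<subseteq> V" "D \<noteq> {}" and s: "is_lub E s D"
    and dir: "\<And>a b. a \<in> D \<Longrightarrow> b \<in> D \<Longrightarrow> \<exists>c\<in>D. a \<preceq> c \<and> b \<preceq> c" and U: "nb \<tau> U"
  shows "\<exists>d\<in>D. s \<ominus> d \<in> U"
proof -
  have sV: "s \<in> V" using s by (rule is_lubD)
  note DV = subsetD[OF D(1)]
  have d: "directed D (\<preceq>)" unfolding directed_def
  proof (intro conjI ballI dir)
    show "reflp_on D (\<preceq>)" using DV by (auto simp: reflp_on_def)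
    show "transp_on D (\<preceq>)" using DV by (intro transp_onI) (rule le_trans)
  qed (use D in auto)
  let ?F = "net_filter D (\<preceq>)"
  have F: "?F \<noteq> bot" by (rule net_filter_ne_bot[OF d])
  have V: "\<forall>\<^sub>F a in ?F. s \<ominus> a \<in> V \<and> \<zero> \<preceq> s \<ominus> a"
    using eventually_net_mem[OF d]
    by eventually_elim (use sV DV is_lubD(2)[OF s] in \<open>auto simp: le_iff_diff[symmetric]\<close>)
  have "uo_null E ?F (\<lambda>a. s \<ominus> a)"
  proof (rule uo_null_of_o_null[OF F])
    show "\<forall>\<^sub>F a in ?F. s \<ominus> a \<in> V" using V by eventually_elim simp
    have "o_null E ?F (\<lambda>a. s \<ominus> a)"
    proof (rule o_nullI[OF F V])
      fix w assume w: "w \<in> V" "\<And>u. u \<in> V \<Longrightarrow> \<forall>\<^sub>F a in ?F. s \<ominus> a \<preceq> u \<Longrightarrow> w \<preceq> u"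
      have "s \<preceq> s \<ominus> w"
      proof (rule is_lubD(3)[OF s])
        fix e assume e: "e \<in> D"
        have "\<forall>\<^sub>F a in ?F. s \<ominus> a \<preceq> s \<ominus> e" unfolding eventually_net_filter[OF d]
          using e DV sV by (intro bexI[of _ e] ballI impI diff_mono_left) auto
        then have "w \<preceq> s \<ominus> e" using w(2)[of "s \<ominus> e"] sV DV[OF e] by simp
        then show "e \<preceq> s \<ominus> w" using sV w(1) DV[OF e] by (simp add: le_diff_iff a_comm)
      qed (use sV w in auto)
      then have "w \<oplus> s \<preceq> \<zero> \<oplus> s" using sV w(1) by (simp add: le_diff_iff a_comm)
      then show "w \<preceq> \<zero>" using sV w(1) by (subst (asm) add_le_cancel_right) auto
    qed
    moreover have "\<forall>\<^sub>F a in ?F. s \<ominus> a = \<bbar>s \<ominus> a\<bbar>" using V by eventually_elim simp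
    ultimately show "o_null E ?F (\<lambda>a. \<bbar>s \<ominus> a\<bbar>)" by (simp add: o_null_cong)
  qed
  then have "\<forall>\<^sub>F a in ?F. s \<ominus> a \<in> U"
    using V by (intro uo_lebesgue_eventually[OF uoL F _ _ U]) (auto elim: eventually_mono)
  from eventually_happens'[OF F eventually_conj[OF this eventually_net_mem[OF d]]] show ?thesis by blast
qed

section \<open>Uniqueness of the Hausdorff uo-Lebesgue topology\<close>

text \<open>Such a sequence is a base of the neighbourhoods of zero for a Riesz pseudonorm, which need not
  separate points.\<close>

definition nb_seq :: "'a topology \<Rightarrow> (nat \<Rightarrow> 'a set) \<Rightarrow> bool" where
  "nb_seq \<tau> Vs \<longleftrightarrow> (\<forall>n. solid E (Vs n) \<and> nb \<tau> (Vs n) \<and> Vs (Suc n) \<subseteq> Vs n \<and>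
     (\<forall>x\<in>Vs (Suc n). \<forall>y\<in>Vs (Suc n). x \<oplus> y \<in> Vs n))"

lemma ex_nb_seq:
  assumes lin: "linear_topology E \<tau>" and ls: "locally_solid E \<tau>" and U: "nb \<tau> U"
  shows "\<exists>Vs. nb_seq \<tau> Vs \<and> Vs 0 \<subseteq> U"
proof -
  obtain h where h: "\<And>U. nb \<tau> U \<Longrightarrow> solid E (h U) \<and> nb \<tau> (h U) \<and> h U \<subseteq> U \<and> (\<forall>x\<in>h U. \<forall>y\<in>h U. x \<oplus> y \<in> U)"
    using nb_half[OF lin ls] by metis
  define Vs where "Vs n = (h ^^ Suc n) U" for n
  have nb: "nb \<tau> ((h ^^ n) U)" for n by (induction n) (use U h in auto)
  have "nb_seq \<tau> Vs" unfolding nb_seq_def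
  proof
    fix n
    show "solid E (Vs n) \<and> nb \<tau> (Vs n) \<and> Vs (Suc n) \<subseteq> Vs n \<and> (\<forall>x\<in>Vs (Suc n). \<forall>y\<in>Vs (Suc n). x \<oplus> y \<in> Vs n)"
      using h[OF nb[of n]] h[OF nb[of "Suc n"]] by (simp add: Vs_def)
  qed
  moreover have "Vs 0 \<subseteq> U" using h[OF U] by (simp add: Vs_def)
  ultimately show ?thesis by blast
qed

lemma nb_seq_Int: "nb_seq \<tau> Vs \<Longrightarrow> nb_seq \<tau> Ws \<Longrightarrow> nb_seq \<tau> (\<lambda>n. Vs n \<inter> Ws n)"
  unfolding nb_seq_def by (auto simp: solid_Int nb_Int)

text \<open>The intersection is closed under addition, since \<open>Vs (n + 1) + Vs (n + 1) \<subseteq> Vs n\<close>, and under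
  suprema, since for each \<open>n\<close> some \<open>d\<close> in it differs from the supremum by an element of
  \<open>Vs (n + 1)\<close>.\<close>

lemma band_Inter_nb_seq:
  assumes uoL: "uo_lebesgue E \<tau>" and Vs: "nb_seq \<tau> Vs"
  shows "band E (\<Inter>n. Vs n)"
proof (rule bandI)
  let ?N = "\<Inter>n. Vs n"
  have solid: "solid E (Vs n)" and nb: "nb \<tau> (Vs n)"
    and add: "\<And>x y. x \<in> Vs (Suc n) \<Longrightarrow> y \<in> Vs (Suc n) \<Longrightarrow> x \<oplus> y \<in> Vs n" for n
    using Vs by (auto simp: nb_seq_def)
  have "Vs 0 \<subseteq> V" using solid[of 0] by (simp add: solid_def)
  then show NV: "?N \<subseteq> V" by blast
  show 0: "\<zero> \<in> ?N" using nb nb_zero by blast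
  show add': "x \<oplus> y \<in> ?N" if "x \<in> ?N" "y \<in> ?N" for x y using that add by blast
  show solid': "y \<in> ?N" if "x \<in> ?N" "y \<in> V" "\<bbar>y\<bbar> \<preceq> \<bbar>x\<bbar>" for x y
    using that solid unfolding solid_def by blast
  show "r \<odot> x \<in> ?N" if x: "x \<in> ?N" for r x
  proof -
    have xV [simp]: "x \<in> V" using x NV by blast
    have n: "real n \<odot> x \<in> ?N" for n
    proof (induction n)
      case (Suc n)
      then show ?case using add'[OF Suc x] smult_add_left[of x "real n" 1] by (simp add: add.commute)
    qed (use 0 in simp)
    obtain n where "\<bar>r\<bar> \<le> real n" using real_arch_simple by blast
    then have "\<bbar>r \<odot> x\<bbar> \<preceq> \<bbar>real n \<odot> x\<bbar>" by (simp add: abs_smult smult_mono_left)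
    then show ?thesis using solid'[OF n] by simp
  qed
  show "s \<in> ?N" if D: "D \<subseteq> ?N" "D \<noteq> {}" and s: "is_lub E s D" for D s
  proof
    fix n
    let ?D = "{x \<in> ?N. x \<preceq> s}"
    have sV: "s \<in> V" using s by (rule is_lubD)
    have DD: "D \<subseteq> ?D" using D is_lubD(2)[OF s] by blast
    have s': "is_lub E s ?D" using s DD unfolding is_lub_def by blast
    have "\<exists>d\<in>?D. s \<ominus> d \<in> Vs (Suc n)"
    proof (rule uo_lebesgue_lub[OF uoL _ _ s' _ nb])
      show "\<exists>c\<in>?D. a \<preceq> c \<and> b \<preceq> c" if ab: "a \<in> ?D" "b \<in> ?D" for a b
      proof -
        have [simp]: "a \<in> V" "b \<in> V" using ab NV by blast+
        have "\<bbar>a\<bbar> \<oplus> \<bbar>b\<bbar> \<in> ?N" using ab solid_abs_iff[OF solid] by (intro add') auto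
        moreover have "\<bbar>a \<squnion> b\<bbar> \<preceq> \<bbar>a\<bbar> \<oplus> \<bbar>b\<bbar>"
        proof -
          have "a \<preceq> \<bbar>a\<bbar> \<oplus> \<bbar>b\<bbar>" by (rule le_trans[of _ "\<bbar>a\<bbar>"]) (auto intro: le_add_right)
          moreover have "b \<preceq> \<bbar>a\<bbar> \<oplus> \<bbar>b\<bbar>" by (rule le_trans[of _ "\<bbar>b\<bbar>"]) (auto intro: le_add_left)
          moreover have "\<ominus> (a \<squnion> b) \<preceq> \<ominus> a" by simp
          then have "\<ominus> (a \<squnion> b) \<preceq> \<bbar>a\<bbar>" by (rule le_trans) auto
          then have "\<ominus> (a \<squnion> b) \<preceq> \<bbar>a\<bbar> \<oplus> \<bbar>b\<bbar>" by (rule le_trans) (auto intro: le_add_right)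
          ultimately show ?thesis by (simp add: abs_le_iff sup_le_iff)
        qed
        ultimately have "a \<squnion> b \<in> ?N" using solid'[of "\<bbar>a\<bbar> \<oplus> \<bbar>b\<bbar>" "a \<squnion> b"] by (simp add: add_nonneg)
        then show ?thesis using ab sV by (intro bexI[of _ "a \<squnion> b"]) (auto simp: sup_le_iff)
      qed
      show "?D \<subseteq> V" using NV by blast
      show "?D \<noteq> {}" using DD D(2) by blast
    qed
    then obtain d where d: "d \<in> ?N" "s \<ominus> d \<in> Vs (Suc n)" by blast
    then have "(s \<ominus> d) \<oplus> d \<in> Vs n" by (intro add) auto
    moreover have "(s \<ominus> d) \<oplus> d = s"
    proof -
      have "d \<in> V" using d NV by blast
      with sV show ?thesis by algebra
    qed
    ultimately show "s \<in> Vs n" by simp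
  qed
qed

end

context dvlattice
begin

text \<open>First step: the intersections \<open>N\<close> of the sequences become small. Otherwise one picks for each
  sequence an element of \<open>N\<close> outside \<open>U\<close>; these elements form a net that is uo-null, as the
  projections of any \<open>y\<close> to the bands \<open>N\<close> decrease to zero.\<close>

lemma ex_nb_seq_Inter_subset:
  assumes s: "uo_lebesgue E \<sigma>" and H: "Hausdorff_space \<sigma>" and t: "uo_lebesgue E \<tau>" and U: "nb \<tau> U"
  shows "\<exists>Vs. nb_seq \<sigma> Vs \<and> (\<Inter>n. Vs n) \<subseteq> U"
proof (rule ccontr)
  note lin = uo_lebesgueD(1)[OF s] and ls = uo_lebesgueD(2)[OF s]
  assume "\<not> ?thesis"
  then have "\<forall>Vs. \<exists>z. nb_seq \<sigma> Vs \<longrightarrow> z \<in> (\<Inter>n. Vs n) \<and> z \<notin> U" by blast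
  then obtain x where x: "\<And>Vs. nb_seq \<sigma> Vs \<Longrightarrow> x Vs \<in> (\<Inter>n. Vs n) \<and> x Vs \<notin> U" by metis
  let ?A = "{Vs. nb_seq \<sigma> Vs}"
  define lq where "lq = (\<lambda>Vs Ws :: nat \<Rightarrow> 'a set. \<forall>n. Ws n \<subseteq> Vs n)"
  have d: "directed ?A lq" unfolding directed_def
  proof (intro conjI ballI)
    show "?A \<noteq> {}" using ex_nb_seq[OF lin ls nb_V[OF lin]] by blast
    show "reflp_on ?A lq" by (simp add: reflp_on_def lq_def)
    show "transp_on ?A lq" by (rule transp_onI) (auto simp: lq_def)
    fix Vs Ws assume "Vs \<in> ?A" "Ws \<in> ?A"
    then show "\<exists>c\<in>?A. lq Vs c \<and> lq Ws c"
      by (intro bexI[of _ "\<lambda>n. Vs n \<inter> Ws n"]) (auto simp: lq_def nb_seq_Int)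
  qed
  let ?F = "net_filter ?A lq"
  have F: "?F \<noteq> bot" by (rule net_filter_ne_bot[OF d])
  have band: "band E (\<Inter>n. Vs n)" if "nb_seq \<sigma> Vs" for Vs by (rule band_Inter_nb_seq[OF s that])
  have xV: "x Vs \<in> V" if "nb_seq \<sigma> Vs" for Vs using x[OF that] band_subset[OF band[OF that]] by blast
  have ev: "\<forall>\<^sub>F Vs in ?F. nb_seq \<sigma> Vs" using eventually_net_mem[OF d] by simp
  have "uo_null E ?F x" unfolding uo_null_def
  proof (intro ballI impI)
    fix y assume y: "y \<in> V" "\<zero> \<preceq> y"
    show "o_null E ?F (\<lambda>Vs. \<bbar>x Vs\<bbar> \<sqinter> y)"
    proof (rule o_nullI[OF F])
      show "\<forall>\<^sub>F Vs in ?F. \<bbar>x Vs\<bbar> \<sqinter> y \<in> V \<and> \<zero> \<preceq> \<bbar>x Vs\<bbar> \<sqinter> y"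
        using ev by eventually_elim (use xV y in \<open>auto intro: inf_nonneg\<close>)
      fix w assume w: "w \<in> V" "\<zero> \<preceq> w" "\<And>u. u \<in> V \<Longrightarrow> \<forall>\<^sub>F Vs in ?F. \<bbar>x Vs\<bbar> \<sqinter> y \<preceq> u \<Longrightarrow> w \<preceq> u"
      have wN: "w \<in> (\<Inter>n. Vs n)" if Vs: "nb_seq \<sigma> Vs" for Vs
      proof -
        let ?N = "\<Inter>n. Vs n"
        note B = band[OF Vs]
        have "\<forall>\<^sub>F Ws in ?F. \<bbar>x Ws\<bbar> \<sqinter> y \<preceq> proj ?N y" unfolding eventually_net_filter[OF d]
        proof (intro bexI[of _ Vs] ballI impI)
          fix Ws assume Ws: "Ws \<in> ?A" "lq Vs Ws"
          have [simp]: "x Ws \<in> V" using xV Ws by blast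
          have "x Ws \<in> ?N" using x[of Ws] Ws unfolding lq_def by blast
          then have "\<bbar>x Ws\<bbar> \<in> ?N" by (rule band_abs[OF B])
          then have "\<bbar>x Ws\<bbar> \<sqinter> y \<in> ?N" by (rule band_solid_pos[OF B]) (simp_all add: y inf_nonneg)
          then show "\<bbar>x Ws\<bbar> \<sqinter> y \<preceq> proj ?N y" using y by (intro proj_nonneg(3)[OF B]) auto
        qed (use Vs in auto)
        then have "w \<preceq> proj ?N y" using w(3) B y by simp
        then show ?thesis by (rule band_solid_pos[OF B proj_in[OF B y(1)] w(1,2)])
      qed
      have "w = \<zero>"
      proof (rule ccontr)
        assume "w \<noteq> \<zero>"
        then obtain W W' where W: "openin \<sigma> W" "openin \<sigma> W'" "\<zero> \<in> W" "w \<in> W'" "disjnt W W'"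
          using H w(1) topspace_linear[OF lin] unfolding Hausdorff_space_def by (metis zero_closed)
        have "nb \<sigma> W" using W openin_subset[OF W(1)] topspace_linear[OF lin] unfolding nb_def by blast
        then obtain Vs where "nb_seq \<sigma> Vs" "Vs 0 \<subseteq> W" using ex_nb_seq[OF lin ls] by blast
        with wN have "w \<in> W" by blast
        then show False using W by (auto simp: disjnt_iff)
      qed
      then show "w \<preceq> \<zero>" by simp
    qed
  qed
  then have "\<forall>\<^sub>F Vs in ?F. x Vs \<in> U"
    using ev xV by (intro uo_lebesgue_eventually[OF t F _ _ U]) (auto elim: eventually_mono)
  from eventually_happens'[OF F eventually_conj[OF this ev]] show False using x by blast
qed

text \<open>Second step: for \<open>q n \<in> Vs n\<close> the suprema of the tails of \<open>q n \<sqinter> y\<close> again lie in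
  \<open>Vs\<close>, so their infimum lies in \<open>N\<close>; if the \<open>q n\<close> are disjoint from \<open>N\<close>, then it is zero.\<close>

lemma uo_null_nb_seq:
  assumes s: "uo_lebesgue E \<sigma>" and Vs: "nb_seq \<sigma> Vs"
    and q: "\<And>n. q n \<in> Vs n" "\<And>n. \<zero> \<preceq> q n" "\<And>n. q n \<in> dcompl (\<Inter>n. Vs n)"
  shows "uo_null E sequentially q"
  unfolding uo_null_def
proof (intro ballI impI)
  fix y assume y [simp]: "y \<in> V" "\<zero> \<preceq> y"
  let ?N = "\<Inter>n. Vs n"
  have B: "band E ?N" by (rule band_Inter_nb_seq[OF s Vs])
  have dB: "band E (dcompl ?N)" by (rule band_dcompl[OF band_subset[OF B]])
  have solid: "solid E (Vs n)" and nb: "nb \<sigma> (Vs n)"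
    and add: "\<And>x y. x \<in> Vs (Suc n) \<Longrightarrow> y \<in> Vs (Suc n) \<Longrightarrow> x \<oplus> y \<in> Vs n" for n
    using Vs by (auto simp: nb_seq_def)
  have qV [simp]: "q n \<in> V" for n using q(3) by (simp add: dcompl_def)
  note [simp] = q(2)
  define S where "S m = rec_nat (\<lambda>k. \<zero>) (\<lambda>_ f k. q k \<oplus> f (Suc k)) m" for m
  have S0 [simp]: "S 0 k = \<zero>" and SS [simp]: "S (Suc m) k = q k \<oplus> S m (Suc k)" for m k
    by (simp_all add: S_def)
  have S_V [simp]: "S m k \<in> V" and S_nn [simp]: "\<zero> \<preceq> S m k" for m k
    by (induction m arbitrary: k) (auto intro: add_nonneg)
  have S_Vs: "S m (Suc k) \<in> Vs k" for m k
    by (induction m arbitrary: k) (use nb nb_zero q(1) add in auto)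
  have S_d: "S m k \<in> dcompl ?N" for m k
    by (induction m arbitrary: k) (use band_zero[OF dB] band_add[OF dB] q(3) in auto)
  have S_Suc: "S m k \<preceq> S (Suc m) k" for m k
  proof (induction m arbitrary: k)
    case (Suc m)
    show ?case by (subst (1 2) SS) (rule add_mono[OF le_refl Suc], auto)
  qed auto
  have S_mono: "S m k \<preceq> S m' k" if "m \<le> m'" for m m' k
    using that
  proof (induction rule: dec_induct)
    case (step n)
    show ?case by (rule le_trans[OF step.IH S_Suc]) (rule S_V)+
  qed simp
  have q_S: "q (k + j) \<preceq> S (Suc j) k" for k j
  proof (induction j arbitrary: k)
    case (Suc j)
    have "q (Suc k + j) \<preceq> S (Suc j) (Suc k)" by (rule Suc)
    moreover have "S (Suc j) (Suc k) \<preceq> q k \<oplus> S (Suc j) (Suc k)" by (rule le_add_left) auto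
    ultimately have "q (Suc k + j) \<preceq> q k \<oplus> S (Suc j) (Suc k)"
      by (rule le_trans) (rule qV S_V a_closed)+
    then show ?case by (subst SS) (simp only: add_Suc_right add_Suc)
  qed simp
  define D where "D k = {d \<in> V. \<zero> \<preceq> d \<and> d \<preceq> y \<and> (\<exists>m. d \<preceq> S m k)}" for k
  have DV: "D k \<subseteq> V" "D k \<noteq> {}" for k
    by (auto simp: D_def intro!: exI[of _ \<zero>] exI[of _ 0])
  have "\<exists>z. is_lub E z (D k)" for k
    by (rule ex_lub[OF DV y(1)]) (simp add: D_def)
  then obtain z where z: "\<And>k. is_lub E (z k) (D k)" by metis
  have zV [simp]: "z k \<in> V" for k using z by (rule is_lubD)
  have dir: "\<exists>c\<in>D k. a \<preceq> c \<and> b \<preceq> c" if ab: "a \<in> D k" "b \<in> D k" for a b k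
  proof -
    obtain m m' where m: "a \<preceq> S m k" "b \<preceq> S m' k" using ab by (auto simp: D_def)
    have [simp]: "a \<in> V" "b \<in> V" "\<zero> \<preceq> a" using ab by (auto simp: D_def)
    have "a \<preceq> S (max m m') k" by (rule le_trans[OF m(1) S_mono]) auto
    moreover have "b \<preceq> S (max m m') k" by (rule le_trans[OF m(2) S_mono]) auto
    ultimately have "a \<squnion> b \<preceq> S (max m m') k" by (simp add: sup_le_iff)
    moreover have "a \<squnion> b \<preceq> y" using ab by (simp add: D_def sup_le_iff)
    moreover have "\<zero> \<preceq> a \<squnion> b" by (rule le_trans[of _ a]) auto
    ultimately have "a \<squnion> b \<in> D k" by (auto simp: D_def)
    then show ?thesis by (intro bexI[of _ "a \<squnion> b"]) auto
  qed
  have z_Vs: "z (Suc (Suc k)) \<in> Vs k" for k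
  proof -
    obtain d where d: "d \<in> D (Suc (Suc k))" "z (Suc (Suc k)) \<ominus> d \<in> Vs (Suc k)"
      using uo_lebesgue_lub[OF s DV z dir nb] by blast
    then obtain m where m: "d \<in> V" "\<zero> \<preceq> d" "d \<preceq> S m (Suc (Suc k))" by (auto simp: D_def)
    have "d \<in> Vs (Suc k)" by (rule solid_nonneg[OF solid S_Vs m(1,2)]) (use m in simp)
    then have "(z (Suc (Suc k)) \<ominus> d) \<oplus> d \<in> Vs k" using d by (intro add)
    moreover have "(z (Suc (Suc k)) \<ominus> d) \<oplus> d = z (Suc (Suc k))" using m(1) zV by algebra
    ultimately show ?thesis by simp
  qed
  have z_d: "z k \<in> dcompl ?N" for k
  proof (rule band_lub[OF dB _ DV(2) z])
    show "D k \<subseteq> dcompl ?N" using band_solid_pos[OF dB S_d] by (auto simp: D_def)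
  qed
  show "o_null E sequentially (\<lambda>n. \<bbar>q n\<bbar> \<sqinter> y)"
  proof (rule o_nullI)
    show "\<forall>\<^sub>F n in sequentially. \<bbar>q n\<bbar> \<sqinter> y \<in> V \<and> \<zero> \<preceq> \<bbar>q n\<bbar> \<sqinter> y" by (auto intro!: always_eventually inf_nonneg)
    fix w assume w: "w \<in> V" "\<zero> \<preceq> w" "\<And>u. u \<in> V \<Longrightarrow> \<forall>\<^sub>F n in sequentially. \<bbar>q n\<bbar> \<sqinter> y \<preceq> u \<Longrightarrow> w \<preceq> u"
    have wz: "w \<preceq> z k" for k
    proof (rule w(3))
      have "q n \<sqinter> y \<preceq> z k" if "k \<le> n" for n
      proof (rule is_lubD(2)[OF z])
        have "k + (n - k) = n" using that by simp
        then have "q n \<preceq> S (Suc (n - k)) k" using q_S[of k "n - k"] by (simp only:)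
        then have "q n \<sqinter> y \<preceq> S (Suc (n - k)) k" using le_trans[OF inf_le1[OF qV y(1)] _ _ qV S_V] by (simp del: SS)
        moreover have "\<zero> \<preceq> q n \<sqinter> y" by (rule inf_nonneg) auto
        ultimately show "q n \<sqinter> y \<in> D k" unfolding D_def by (auto simp del: SS)
      qed
      then show "\<forall>\<^sub>F n in sequentially. \<bbar>q n\<bbar> \<sqinter> y \<preceq> z k" by (auto simp: eventually_sequentially)
    qed auto
    have "w \<in> Vs k" for k
      by (rule solid_nonneg[OF solid z_Vs w(1,2)]) (rule le_trans[OF wz abs_ge_self], use w in auto)
    moreover have "w \<in> dcompl ?N" by (rule band_solid_pos[OF dB z_d w(1,2) wz])
    ultimately have "w = \<zero>" using dcompl_Int[of w ?N] band_subset[OF B] by blast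
    then show "w \<preceq> \<zero>" by simp
  qed simp
qed

text \<open>Every element of \<open>Vs n\<close> is the sum of an element of \<open>N\<close> and of one that is disjoint from \<open>N\<close>. The
  former lies in \<open>U1\<close> by the first step, the latter for some \<open>n\<close> by the second step.\<close>

lemma uo_lebesgue_nb_le:
  assumes s: "uo_lebesgue E \<sigma>" and H: "Hausdorff_space \<sigma>" and t: "uo_lebesgue E \<tau>" and U: "nb \<tau> U"
  shows "nb \<sigma> U"
proof -
  note lin = uo_lebesgueD(1)[OF t] and ls = uo_lebesgueD(2)[OF t]
  obtain U0 where U0: "solid E U0" "nb \<tau> U0" "U0 \<subseteq> U" using nb_half[OF lin ls U] by blast
  obtain U1 where U1: "solid E U1" "nb \<tau> U1" "\<And>x y. x \<in> U1 \<Longrightarrow> y \<in> U1 \<Longrightarrow> x \<oplus> y \<in> U0"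
    using nb_half[OF lin ls U0(2)] by blast
  obtain Vs where Vs: "nb_seq \<sigma> Vs" "(\<Inter>n. Vs n) \<subseteq> U1"
    using ex_nb_seq_Inter_subset[OF s H t U1(2)] by blast
  let ?N = "\<Inter>n. Vs n"
  have B: "band E ?N" by (rule band_Inter_nb_seq[OF s Vs(1)])
  have solid: "solid E (Vs n)" for n using Vs by (auto simp: nb_seq_def)
  have "\<exists>n. Vs n \<subseteq> U"
  proof (rule ccontr)
    assume "\<nexists>n. Vs n \<subseteq> U"
    then have "\<forall>n. \<exists>x. x \<in> Vs n \<and> x \<notin> U" by blast
    then obtain x where x: "\<And>n. x n \<in> Vs n" "\<And>n. x n \<notin> U" by metis
    have xV [simp]: "x n \<in> V" for n using x(1) solid by (auto simp: solid_def)
    define p where "p n = proj ?N (\<bbar>x n\<bbar>)" for n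
    define q where "q n = \<bbar>x n\<bbar> \<ominus> p n" for n
    have p: "p n \<in> V" "p n \<in> ?N" "p n \<preceq> \<bbar>x n\<bbar>" "\<zero> \<preceq> p n" for n
      using proj_nonneg[OF B, of "\<bbar>x n\<bbar>"] proj_in[OF B, of "\<bbar>x n\<bbar>"] proj_closed[OF B, of "\<bbar>x n\<bbar>"] by (auto simp: p_def)
    have qV [simp]: "q n \<in> V" for n using p by (simp add: q_def)
    have q0: "\<zero> \<preceq> q n" for n using p by (simp add: q_def le_iff_diff[symmetric])
    have "q n \<preceq> \<bbar>x n\<bbar>" for n using p by (simp add: q_def)
    then have qVs: "q n \<in> Vs n" for n by (intro solid_nonneg[OF solid x(1)]) (auto simp: q0)
    have qd: "q n \<in> dcompl ?N" for n unfolding q_def p_def by (rule proj_compl[OF B]) simp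
    have "\<forall>\<^sub>F n in sequentially. q n \<in> U1"
      by (rule uo_lebesgue_eventually[OF t _ _ uo_null_nb_seq[OF s Vs(1) qVs q0 qd] U1(2)]) auto
    then obtain n where n: "q n \<in> U1" by (auto simp: eventually_sequentially)
    have "p n \<oplus> q n \<in> U0" by (rule U1(3)[OF subsetD[OF Vs(2) p(2)] n])
    moreover have "p n \<oplus> q n = \<bbar>x n\<bbar>" unfolding q_def using p(1) xV by algebra
    ultimately have "\<bbar>x n\<bbar> \<in> U0" by simp
    then show False using x(2)[of n] U0 solid_abs_iff[OF U0(1), of "x n"] by auto
  qed
  then show ?thesis using Vs(1) U nb_mono unfolding nb_seq_def nb_def by (meson order_trans)
qed

lemma uo_lebesgue_unique:
  assumes "uo_lebesgue E \<sigma>" "Hausdorff_space \<sigma>" "uo_lebesgue E \<tau>" "Hausdorff_space \<tau>"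
  shows "\<sigma> = \<tau>"
proof -
  have *: "openin \<rho>' U" if "openin \<rho> U" "uo_lebesgue E \<rho>" "uo_lebesgue E \<rho>'" "Hausdorff_space \<rho>'" for \<rho> \<rho>' U
  proof (rule openin_of_nb[OF uo_lebesgueD(1)[OF that(3)]])
    note lin = uo_lebesgueD(1)[OF that(2)]
    show "U \<subseteq> V" using openin_subset[OF that(1)] topspace_linear[OF lin] by blast
    show "nb \<rho>' {z \<in> V. z \<oplus> x \<in> U}" if "x \<in> U" for x
      using uo_lebesgue_nb_le[OF \<open>uo_lebesgue E \<rho>'\<close> \<open>Hausdorff_space \<rho>'\<close> \<open>uo_lebesgue E \<rho>\<close>]
        nb_translate[OF lin \<open>openin \<rho> U\<close> that] by blast
  qed
  show ?thesis unfolding topology_eq using *[of \<sigma> _ \<tau>] *[of \<tau> _ \<sigma>] assms by blast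
qed

lemma uoL_eq: "uo_lebesgue E \<tau> \<Longrightarrow> Hausdorff_space \<tau> \<Longrightarrow> uoL E = \<tau>"
  unfolding uoL_def by (rule the_equality) (auto intro: uo_lebesgue_unique)

lemma uoL_props: "admits_uoL E \<Longrightarrow> uo_lebesgue E (uoL E) \<and> Hausdorff_space (uoL E)"
  unfolding admits_uoL_def using uoL_eq by metis

lemma uo_conv_imp_tau_conv:
  assumes adm: "admits_uoL E" and d: "directed A lq" and x: "\<And>a. a \<in> A \<Longrightarrow> x a \<in> V" and l: "l \<in> V"
    and conv: "uo_conv E A lq x l"
  shows "tau_conv E A lq x l"
  unfolding tau_conv_def
proof (rule uo_lebesgue_limit[OF _ net_filter_ne_bot[OF d] _ l])
  show "uo_lebesgue E (uoL E)" using uoL_props[OF adm] by simp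
  show "\<forall>\<^sub>F a in net_filter A lq. x a \<in> V" using eventually_net_mem[OF d] by eventually_elim (use x in auto)
  show "uo_null E (net_filter A lq) (\<lambda>a. x a \<ominus> l)"
    using conv by (subst uo_conv_iff[symmetric, OF d _ l]) (use x in auto)
qed

end

section \<open>The strong topology on the orthomorphisms\<close>

context dvlattice
begin

interpretation Or: dvlattice "Orth E" by (rule dvlattice_Orth)

definition strong_topology :: "'a topology \<Rightarrow> ('a \<Rightarrow> 'a) topology" where
  "strong_topology \<tau> = subtopology (product_topology (\<lambda>x. \<tau>) V) OE"

lemma Orth_PiE: "T \<in> OE \<Longrightarrow> T \<in> (\<Pi>\<^sub>E x\<in>V. V)"
  by (auto simp: PiE_def OrthD(2))

lemma topspace_strong: "linear_topology E \<tau> \<Longrightarrow> topspace (strong_topology \<tau>) = OE"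
  unfolding strong_topology_def using topspace_linear Orth_PiE by (auto simp: topspace_product_topology)

lemma limitin_strong_iff:
  assumes lin: "linear_topology E \<tau>"
  shows "limitin (strong_topology \<tau>) T S F \<longleftrightarrow>
    S \<in> OE \<and> (\<forall>\<^sub>F a in F. T a \<in> OE) \<and> (\<forall>x\<in>V. limitin \<tau> (\<lambda>a. T a x) (S x) F)"
proof -
  have "\<forall>\<^sub>F a in F. T a \<in> topspace (product_topology (\<lambda>x. \<tau>) V)" if "\<forall>\<^sub>F a in F. T a \<in> OE"
    using that by (rule eventually_mono) (use Orth_PiE topspace_linear[OF lin] in \<open>simp add: topspace_product_topology\<close>)
  then show ?thesis
    unfolding strong_topology_def limitin_subtopology limitin_componentwise using OrthD(2) by blast
qed

lemma continuous_eval: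
  assumes "x \<in> V" shows "continuous_map (strong_topology \<tau>) \<tau> (\<lambda>T. T x)"
  unfolding strong_topology_def using assms
  by (intro continuous_map_from_subtopology continuous_map_product_projection)

lemma continuous_into_strong:
  assumes "f ` topspace X \<subseteq> OE" "\<And>x. x \<in> V \<Longrightarrow> continuous_map X \<tau> (\<lambda>z. f z x)"
  shows "continuous_map X (strong_topology \<tau>) f"
  unfolding strong_topology_def
proof (rule continuous_map_into_subtopology)
  show "continuous_map X (product_topology (\<lambda>x. \<tau>) V) f"
    unfolding continuous_map_componentwise using assms OrthD(2) by blast
qed (use assms(1) in blast)

lemma linear_topology_strong:
  assumes lin: "linear_topology E \<tau>"
  shows "linear_topology (Orth E) (strong_topology \<tau>)"
proof -
  let ?s = "strong_topology \<tau>"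
  have top: "topspace ?s = OE" by (rule topspace_strong[OF lin])
  have "continuous_map (prod_topology ?s ?s) ?s (\<lambda>(S, T). S \<oplus>\<^bsub>Orth E\<^esub> T)"
  proof (rule continuous_into_strong)
    fix x assume x: "x \<in> V"
    have "continuous_map (prod_topology ?s ?s) (prod_topology \<tau> \<tau>) (\<lambda>z. (fst z x, snd z x))"
      unfolding continuous_map_paired
      using continuous_map_compose[OF continuous_map_fst[of ?s ?s] continuous_eval[OF x]]
        continuous_map_compose[OF continuous_map_snd[of ?s ?s] continuous_eval[OF x]] by (simp add: o_def)
    moreover have "continuous_map (prod_topology \<tau> \<tau>) \<tau> (\<lambda>(x, y). x \<oplus> y)"
      using lin by (simp add: linear_topology_def)
    ultimately have "continuous_map (prod_topology ?s ?s) \<tau> ((\<lambda>(x, y). x \<oplus> y) \<circ> (\<lambda>z. (fst z x, snd z x)))"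
      by (rule continuous_map_compose)
    then show "continuous_map (prod_topology ?s ?s) \<tau> (\<lambda>z. (case z of (S, T) \<Rightarrow> S \<oplus>\<^bsub>Orth E\<^esub> T) x)"
      using x by (simp add: o_def case_prod_unfold Orth_simps(3))
  qed (auto simp: top)
  moreover have "continuous_map (prod_topology euclideanreal ?s) ?s (\<lambda>(r, T). r \<odot>\<^bsub>Orth E\<^esub> T)"
  proof (rule continuous_into_strong)
    fix x assume x: "x \<in> V"
    have "continuous_map (prod_topology euclideanreal ?s) (prod_topology euclideanreal \<tau>) (\<lambda>z. (fst z, snd z x))"
      unfolding continuous_map_paired
      using continuous_map_fst continuous_map_compose[OF continuous_map_snd[of euclideanreal ?s] continuous_eval[OF x]]
      by (auto simp add: o_def)
    moreover have "continuous_map (prod_topology euclideanreal \<tau>) \<tau> (\<lambda>(r, y). r \<odot> y)"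
      using lin by (simp add: linear_topology_def)
    ultimately have "continuous_map (prod_topology euclideanreal ?s) \<tau> ((\<lambda>(r, y). r \<odot> y) \<circ> (\<lambda>z. (fst z, snd z x)))"
      by (rule continuous_map_compose)
    then show "continuous_map (prod_topology euclideanreal ?s) \<tau> (\<lambda>z. (case z of (r, T) \<Rightarrow> r \<odot>\<^bsub>Orth E\<^esub> T) x)"
      using x by (simp add: o_def case_prod_unfold Orth_simps(4))
  qed (auto simp: top)
  ultimately show ?thesis using top by (simp add: linear_topology_def)
qed

text \<open>The operators have absolute values that are pointwise on the positive cone only. So solid
  neighbourhoods are obtained by testing the operators at the points \<open>\<bar>x\<bar>\<close>.\<close>

lemma locally_solid_strong:
  assumes lin: "linear_topology E \<tau>" and ls: "locally_solid E \<tau>"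
  shows "locally_solid (Orth E) (strong_topology \<tau>)"
  unfolding locally_solid_def
proof (intro allI impI)
  fix U assume U: "openin (strong_topology \<tau>) U \<and> \<zero>\<^bsub>Orth E\<^esub> \<in> U"
  have tops: "topspace \<tau> = V" by (rule topspace_linear[OF lin])
  obtain P where P: "openin (product_topology (\<lambda>x. \<tau>) V) P" "U = P \<inter> OE"
    using U unfolding strong_topology_def openin_subtopology by blast
  have 0: "\<zero>\<^bsub>Orth E\<^esub> \<in> P" using U P by blast
  have *: "\<forall>x\<in>P. \<exists>W. finite {i \<in> V. W i \<noteq> topspace \<tau>} \<and> (\<forall>i\<in>V. openin \<tau> (W i)) \<and> x \<in> Pi\<^sub>E V W \<and> Pi\<^sub>E V W \<subseteq> P"
    using P(1) unfolding openin_product_topology_alt .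
  obtain W where W: "finite {i \<in> V. W i \<noteq> topspace \<tau>}" "\<forall>i\<in>V. openin \<tau> (W i)"
    "\<zero>\<^bsub>Orth E\<^esub> \<in> Pi\<^sub>E V W" "Pi\<^sub>E V W \<subseteq> P"
    using bspec[OF * 0] by (elim exE conjE) (rule that)
  define K where "K = {i \<in> V. W i \<noteq> topspace \<tau>}"
  have "\<forall>i\<in>V. \<exists>S W'. solid E S \<and> openin \<tau> W' \<and> \<zero> \<in> W' \<and> W' \<subseteq> S \<and> S \<subseteq> W i"
  proof
    fix i assume i: "i \<in> V"
    have "\<zero> \<in> W i" using PiE_mem[OF W(3) i] i by (simp add: Orth_simps(2))
    then show "\<exists>S W'. solid E S \<and> openin \<tau> W' \<and> \<zero> \<in> W' \<and> W' \<subseteq> S \<and> S \<subseteq> W i"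
      using ls W(2) i unfolding locally_solid_def by blast
  qed
  from bchoice[OF this] obtain S where
    "\<forall>i\<in>V. \<exists>W'. solid E (S i) \<and> openin \<tau> W' \<and> \<zero> \<in> W' \<and> W' \<subseteq> S i \<and> S i \<subseteq> W i" ..
  from bchoice[OF this] obtain W' where
    "\<forall>i\<in>V. solid E (S i) \<and> openin \<tau> (W' i) \<and> \<zero> \<in> W' i \<and> W' i \<subseteq> S i \<and> S i \<subseteq> W i" ..
  then have SW: "\<And>i. i \<in> V \<Longrightarrow> solid E (S i)" "\<And>i. i \<in> V \<Longrightarrow> openin \<tau> (W' i)"
    "\<And>i. i \<in> V \<Longrightarrow> \<zero> \<in> W' i" "\<And>i. i \<in> V \<Longrightarrow> W' i \<subseteq> S i" "\<And>i. i \<in> V \<Longrightarrow> S i \<subseteq> W i"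
    by simp_all
  have KV: "i \<in> V" if "i \<in> K" for i using that by (simp add: K_def)
  define A where "A = {T \<in> OE. \<forall>i\<in>K. T (\<bbar>i\<bbar>) \<in> S i}"
  define B where "B = {T \<in> OE. \<forall>i\<in>K. T (\<bbar>i\<bbar>) \<in> W' i}"
  have "solid (Orth E) A" unfolding solid_def
  proof (intro conjI ballI impI)
    fix T R assume T: "T \<in> A" and R: "R \<in> OE" and le: "vle (Orth E) (vabs (Orth E) R) (vabs (Orth E) T)"
    have TO: "T \<in> OE" using T by (simp add: A_def)
    have "R (\<bbar>i\<bbar>) \<in> S i" if i: "i \<in> K" for i
    proof -
      note iV = KV[OF i]
      have "\<bbar>R (\<bbar>i\<bbar>)\<bbar> \<preceq> \<bbar>T (\<bbar>i\<bbar>)\<bbar>"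
        using le[unfolded Orth_simps(5), rule_format, of "\<bbar>i\<bbar>"] iV
          Orth_abs[OF TO, of "\<bbar>i\<bbar>"] Orth_abs[OF R, of "\<bbar>i\<bbar>"] by simp
      moreover have "T (\<bbar>i\<bbar>) \<in> S i" using T i by (simp add: A_def)
      ultimately show ?thesis using SW(1)[OF iV] R iV unfolding solid_def by simp
    qed
    then show "R \<in> A" using R by (simp add: A_def)
  qed (auto simp: A_def)
  moreover have "openin (strong_topology \<tau>) B"
  proof -
    have "openin (strong_topology \<tau>) ((\<Inter>i\<in>K. {T \<in> topspace (strong_topology \<tau>). T (\<bbar>i\<bbar>) \<in> W' i}) \<inter> topspace (strong_topology \<tau>))"
    proof (rule openin_INT)
      show "finite K" using W(1) by (simp add: K_def)
      show "openin (strong_topology \<tau>) {T \<in> topspace (strong_topology \<tau>). T (\<bbar>i\<bbar>) \<in> W' i}" if "i \<in> K" for i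
        by (rule openin_continuous_map_preimage[OF continuous_eval[OF abs_closed[OF KV[OF that]]] SW(2)[OF KV[OF that]]])
    qed
    moreover have "((\<Inter>i\<in>K. {T \<in> topspace (strong_topology \<tau>). T (\<bbar>i\<bbar>) \<in> W' i}) \<inter> topspace (strong_topology \<tau>)) = B"
      by (auto simp: B_def topspace_strong[OF lin])
    ultimately show ?thesis by simp
  qed
  moreover have "\<zero>\<^bsub>Orth E\<^esub> \<in> B" using SW(3) KV by (simp add: B_def Orth_simps(2) Orth_zero_closed[unfolded Orth_simps(2)])
  moreover have "B \<subseteq> A" using SW(4) KV unfolding A_def B_def by blast
  moreover have "A \<subseteq> U"
  proof
    fix T assume T: "T \<in> A"
    then have TO: "T \<in> OE" by (simp add: A_def)
    have "T i \<in> W i" if i: "i \<in> V" for i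
    proof (cases "i \<in> K")
      case True
      have "T (\<bbar>i\<bbar>) \<in> S i" using T True by (simp add: A_def)
      moreover have "\<bbar>T i\<bbar> \<preceq> \<bbar>T (\<bbar>i\<bbar>)\<bbar>" using Orth_abs_le[OF TO i] Orth_abs[OF TO, of "\<bbar>i\<bbar>"] i by simp
      ultimately have "T i \<in> S i" using SW(1)[OF i] TO i unfolding solid_def by simp
      then show ?thesis using SW(5)[OF i] by blast
    next
      case False
      then show ?thesis using i TO tops by (simp add: K_def)
    qed
    then have "T \<in> Pi\<^sub>E V W" using OrthD(2)[OF TO] by (auto simp: PiE_def)
    then show "T \<in> U" using W(4) TO P(2) by blast
  qed
  ultimately show "\<exists>A B. solid (Orth E) A \<and> openin (strong_topology \<tau>) B \<and> \<zero>\<^bsub>Orth E\<^esub> \<in> B \<and> B \<subseteq> A \<and> A \<subseteq> U"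
    by blast
qed

lemma uo_lebesgue_strong:
  assumes uoL: "uo_lebesgue E \<tau>"
  shows "uo_lebesgue (Orth E) (strong_topology \<tau>)"
proof -
  note lin = uo_lebesgueD(1)[OF uoL]
  have "limitin (strong_topology \<tau>) T \<zero>\<^bsub>Orth E\<^esub> (net_filter A lq)"
    if d: "directed A lq" and T: "\<forall>a\<in>A. T a \<in> OE" and conv: "uo_conv (Orth E) A lq T \<zero>\<^bsub>Orth E\<^esub>"
    for A :: "(('a \<Rightarrow> 'a) \<times> ('a \<Rightarrow> 'a) set) set" and lq T
  proof -
    have pt: "\<forall>x\<in>V. uo_conv E A lq (\<lambda>a. T a x) (\<zero>\<^bsub>Orth E\<^esub> x)"
      using conv by (subst (asm) uo_conv_Orth_iff[OF d]) (use T Orth_zero_closed in auto)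
    have "limitin \<tau> (\<lambda>a. T a x) (\<zero>\<^bsub>Orth E\<^esub> x) (net_filter A lq)" if x: "x \<in> V" for x
    proof (rule uo_lebesgue_limit[OF uoL net_filter_ne_bot[OF d]])
      show "\<forall>\<^sub>F a in net_filter A lq. T a x \<in> V"
        using eventually_net_mem[OF d] by eventually_elim (use T x in auto)
      show z: "\<zero>\<^bsub>Orth E\<^esub> x \<in> V" using x Orth_zero_closed by simp
      have "uo_conv E A lq (\<lambda>a. T a x) (\<zero>\<^bsub>Orth E\<^esub> x) \<longleftrightarrow> uo_null E (net_filter A lq) (\<lambda>a. T a x \<ominus> \<zero>\<^bsub>Orth E\<^esub> x)"
        by (rule uo_conv_iff[OF d _ z]) (use T x in auto)
      then show "uo_null E (net_filter A lq) (\<lambda>a. T a x \<ominus> \<zero>\<^bsub>Orth E\<^esub> x)" using pt x by blast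
    qed
    moreover have "\<forall>\<^sub>F a in net_filter A lq. T a \<in> OE"
      using eventually_net_mem[OF d] by eventually_elim (use T in auto)
    ultimately show ?thesis using Orth_zero_closed by (simp add: limitin_strong_iff[OF lin])
  qed
  then show ?thesis unfolding uo_lebesgue_def[of "Orth E"]
    using linear_topology_strong[OF lin] locally_solid_strong[OF lin uo_lebesgueD(2)[OF uoL]] by blast
qed

lemma Hausdorff_strong: "Hausdorff_space \<tau> \<Longrightarrow> Hausdorff_space (strong_topology \<tau>)"
  unfolding strong_topology_def
  by (rule Hausdorff_space_subtopology) (simp add: Hausdorff_space_product_topology)

lemma uoL_Orth: "admits_uoL E \<Longrightarrow> uoL (Orth E) = strong_topology (uoL E)"
  using uoL_props Or.uoL_eq uo_lebesgue_strong Hausdorff_strong by blast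

lemma tau_conv_Orth_iff:
  assumes adm: "admits_uoL E" and d: "directed A lq" and T: "\<And>a. a \<in> A \<Longrightarrow> T a \<in> OE" and S: "S \<in> OE"
  shows "tau_conv (Orth E) A lq T S \<longleftrightarrow> (\<forall>x\<in>V. tau_conv E A lq (\<lambda>a. T a x) (S x))"
proof -
  have lin: "linear_topology E (uoL E)" using uoL_props[OF adm] uo_lebesgueD by blast
  have "\<forall>\<^sub>F a in net_filter A lq. T a \<in> OE" using eventually_net_mem[OF d] by eventually_elim (use T in auto)
  then show ?thesis unfolding tau_conv_def uoL_Orth[OF adm] limitin_strong_iff[OF lin] using S by blast
qed

text \<open>The six modes fall into three pairs: both \<open>uo\<close>-modes agree, both \<open>\<tau>\<close>-modes agree, and the
  two \<open>o\<close>-modes imply them.\<close>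

lemma converges_imp:
  assumes d: "directed A lq" and T: "\<And>a. a \<in> A \<Longrightarrow> T a \<in> OE" and S: "S \<in> OE"
  shows converges_o_SO: "converges Mode_o E A lq T S \<Longrightarrow> converges Mode_SO E A lq T S"
    and converges_o_uo: "converges Mode_o E A lq T S \<Longrightarrow> converges Mode_uo E A lq T S"
    and converges_SO_SUO: "converges Mode_SO E A lq T S \<Longrightarrow> converges Mode_SUO E A lq T S"
    and converges_uo_iff_SUO: "converges Mode_uo E A lq T S \<longleftrightarrow> converges Mode_SUO E A lq T S"
    and converges_SUO_Stau: "admits_uoL E \<Longrightarrow> converges Mode_SUO E A lq T S \<Longrightarrow> converges Mode_Stau E A lq T S"
    and converges_tau_iff_Stau: "admits_uoL E \<Longrightarrow> converges Mode_tau E A lq T S \<longleftrightarrow> converges Mode_Stau E A lq T S"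
proof -
  show "converges Mode_o E A lq T S \<Longrightarrow> converges Mode_SO E A lq T S"
    using o_conv_Orth_imp_pointwise[OF d _ S] T by simp
  show "converges Mode_o E A lq T S \<Longrightarrow> converges Mode_uo E A lq T S"
    using Or.o_conv_imp_uo_conv[OF d _ S] T by simp
  show "converges Mode_SO E A lq T S \<Longrightarrow> converges Mode_SUO E A lq T S"
    using o_conv_imp_uo_conv[OF d, of "\<lambda>a. T a _"] T S by simp
  show "converges Mode_uo E A lq T S \<longleftrightarrow> converges Mode_SUO E A lq T S"
    using uo_conv_Orth_iff[OF d _ S] T by simp
  show "admits_uoL E \<Longrightarrow> converges Mode_SUO E A lq T S \<Longrightarrow> converges Mode_Stau E A lq T S"
    using uo_conv_imp_tau_conv[OF _ d, of "\<lambda>a. T a _"] T S by simp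
  show "admits_uoL E \<Longrightarrow> converges Mode_tau E A lq T S \<longleftrightarrow> converges Mode_Stau E A lq T S"
    using tau_conv_Orth_iff[OF _ d _ S] T by simp
qed

end

lemma dvlatticeI: "vector_lattice E \<Longrightarrow> dedekind_complete E \<Longrightarrow> dvlattice E"
  by unfold_locales

lemma mode_implies_of_valid:
  assumes "(c1, c2) \<in> valid_implications"
  shows "mode_implies TYPE('a) TYPE('i) c1 c2"
  unfolding mode_implies_def
proof (intro allI impI, elim conjE)
  fix E :: "'a vlat" and A :: "'i set" and lq T S
  assume "vector_lattice E" "dedekind_complete E" and d: "directed A lq"
    and T: "\<forall>a\<in>A. T a \<in> carrier (Orth E)" and S: "S \<in> carrier (Orth E)"
    and adm: "c1 \<in> {Mode_tau, Mode_Stau} \<or> c2 \<in> {Mode_tau, Mode_Stau} \<longrightarrow> admits_uoL E"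
    and conv: "converges c1 E A lq T S"
  then interpret dvlattice E by (intro dvlatticeI)
  have T': "\<And>a. a \<in> A \<Longrightarrow> T a \<in> carrier (Orth E)" using T by blast
  note imps = converges_imp[where T = T, OF d T' S]
  have *: "c1 \<noteq> Mode_tau \<Longrightarrow> c1 \<noteq> Mode_Stau \<Longrightarrow> converges Mode_SUO E A lq T S"
    using conv imps(1-4) by (cases c1) (simp_all del: converges.simps)
  have **: "admits_uoL E \<Longrightarrow> converges Mode_Stau E A lq T S"
    using conv imps(5,6) * by (cases c1) (simp_all del: converges.simps)
  show "converges c2 E A lq T S"
  proof (cases c2)
    case Mode_o
    then show ?thesis using assms conv by (auto simp: valid_implications_def simp del: converges.simps)
  next
    case Mode_SO
    then show ?thesis using assms conv imps(1) by (auto simp: valid_implications_def simp del: converges.simps)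
  next
    case Mode_uo
    then have "c1 \<noteq> Mode_tau" "c1 \<noteq> Mode_Stau" using assms by (auto simp: valid_implications_def)
    then show ?thesis using * imps(4) Mode_uo by (simp del: converges.simps)
  next
    case Mode_SUO
    then have "c1 \<noteq> Mode_tau" "c1 \<noteq> Mode_Stau" using assms by (auto simp: valid_implications_def)
    then show ?thesis using * Mode_SUO by blast
  next
    case Mode_tau
    then show ?thesis using ** imps(6) adm by (simp del: converges.simps)
  next
    case Mode_Stau
    then show ?thesis using ** adm by blast
  qed
qed

section \<open>Counterexamples in lattices of functions\<close>

definition fun_lattice :: "('x \<Rightarrow> real) set \<Rightarrow> ('x \<Rightarrow> real) vlat" where
  "fun_lattice C = \<lparr>carrier = C, mult = (\<lambda>f g. f), one = (\<lambda>x. 0), zero = (\<lambda>x. 0),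
     add = (\<lambda>f g x. f x + g x), smult = (\<lambda>r f x. r * f x), vle = (\<lambda>f g. \<forall>x. f x \<le> g x)\<rparr>"

lemma fun_lattice_simps [simp]:
  "carrier (fun_lattice C) = C" "\<zero>\<^bsub>fun_lattice C\<^esub> = (\<lambda>x. 0)"
  "f \<oplus>\<^bsub>fun_lattice C\<^esub> g = (\<lambda>x. f x + g x)" "r \<odot>\<^bsub>fun_lattice C\<^esub> f = (\<lambda>x. r * f x)"
  "vle (fun_lattice C) f g \<longleftrightarrow> (\<forall>x. f x \<le> g x)"
  by (simp_all add: fun_lattice_def)

locale function_ideal =
  fixes C :: "('x \<Rightarrow> real) set"
  assumes zero_in: "(\<lambda>x. 0) \<in> C"
    and add_in: "f \<in> C \<Longrightarrow> g \<in> C \<Longrightarrow> (\<lambda>x. f x + g x) \<in> C"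
    and smult_in: "f \<in> C \<Longrightarrow> (\<lambda>x. r * f x) \<in> C"
    and solid_in: "f \<in> C \<Longrightarrow> (\<And>x. \<bar>g x\<bar> \<le> \<bar>f x\<bar>) \<Longrightarrow> g \<in> C"
begin

lemma between_in:
  assumes "f \<in> C" "g \<in> C" "\<And>x. f x \<le> h x" "\<And>x. h x \<le> g x"
  shows "h \<in> C"
proof (rule solid_in)
  have "(\<lambda>x. \<bar>f x\<bar>) \<in> C" "(\<lambda>x. \<bar>g x\<bar>) \<in> C" using solid_in assms by auto
  then show "(\<lambda>x. \<bar>f x\<bar> + \<bar>g x\<bar>) \<in> C" by (rule add_in)
  show "\<bar>h x\<bar> \<le> \<bar>\<bar>f x\<bar> + \<bar>g x\<bar>\<bar>" for x using assms(3)[of x] assms(4)[of x] by linarith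
qed

lemma ex_fun_lub:
  assumes A: "A \<subseteq> C" "A \<noteq> {}" and u: "u \<in> C" "\<And>f x. f \<in> A \<Longrightarrow> f x \<le> u x"
  shows "\<exists>s. is_lub (fun_lattice C) s A"
proof -
  obtain f0 where f0: "f0 \<in> A" using A by blast
  define s where "s x = (SUP f\<in>A. f x)" for x
  have bdd: "bdd_above ((\<lambda>f. f x) ` A)" for x using u(2) by (auto intro!: bdd_aboveI[of _ "u x"])
  have ub: "f x \<le> s x" if "f \<in> A" for f x unfolding s_def using bdd that by (intro cSUP_upper)
  have least: "s x \<le> w x" if "\<And>f. f \<in> A \<Longrightarrow> f x \<le> w x" for w x
    unfolding s_def using A(2) that by (intro cSUP_least)
  have "s \<in> C"
  proof (rule between_in[OF subsetD[OF A(1) f0] u(1)])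
    show "f0 x \<le> s x" for x by (rule ub[OF f0])
    show "s x \<le> u x" for x by (rule least[OF u(2)])
  qed
  then have "is_lub (fun_lattice C) s A" unfolding is_lub_def using ub least by simp
  then show ?thesis by (intro exI[of _ s])
qed

lemma module_fun_lattice: "Module.module real_ring (fun_lattice C)"
proof (rule moduleI[OF cring_real_ring])
  show "abelian_group (fun_lattice C)"
  proof (rule abelian_groupI)
    show "\<exists>g\<in>carrier (fun_lattice C). g \<oplus>\<^bsub>fun_lattice C\<^esub> f = \<zero>\<^bsub>fun_lattice C\<^esub>"
      if "f \<in> carrier (fun_lattice C)" for f
      using smult_in[of f "-1"] that by (intro bexI[of _ "\<lambda>x. -1 * f x"]) auto
  qed (auto simp: add_in zero_in algebra_simps)
qed (auto simp: smult_in algebra_simps)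

lemma dvlattice_fun_lattice: "dvlattice (fun_lattice C)"
proof
  show "vector_lattice (fun_lattice C)"
  proof (rule vector_latticeI[OF module_fun_lattice])
    show "\<exists>s. is_lub (fun_lattice C) s {f, g}"
      if "f \<in> carrier (fun_lattice C)" "g \<in> carrier (fun_lattice C)" for f g
    proof (rule ex_fun_lub)
      have "(\<lambda>x. \<bar>f x\<bar>) \<in> C" "(\<lambda>x. \<bar>g x\<bar>) \<in> C" using solid_in that by auto
      then show "(\<lambda>x. \<bar>f x\<bar> + \<bar>g x\<bar>) \<in> C" by (rule add_in)
    qed (use that in auto)
    show "archimedean (fun_lattice C)" unfolding archimedean_def
    proof (intro ballI impI)
      fix f g assume le: "\<forall>n. vle (fun_lattice C) (real n \<odot>\<^bsub>fun_lattice C\<^esub> f) g"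
      have "f x \<le> 0" for x
      proof (rule ccontr)
        assume "\<not> f x \<le> 0"
        then obtain n where "g x < real n * f x" using reals_Archimedean3[of "f x"] by auto
        then show False using le by (auto simp: not_le[symmetric])
      qed
      then show "vle (fun_lattice C) f \<zero>\<^bsub>fun_lattice C\<^esub>" by simp
    qed
    show "vle (fun_lattice C) f h" if "vle (fun_lattice C) f g" "vle (fun_lattice C) g h" for f g h
      using that by (auto intro: order_trans)
    show "f = g" if "vle (fun_lattice C) f g" "vle (fun_lattice C) g f" for f g
      using that by (auto intro!: ext antisym)
  qed (auto intro: mult_left_mono)
  show "dedekind_complete (fun_lattice C)" unfolding dedekind_complete_def
  proof (intro allI impI)
    fix A assume A: "A \<subseteq> carrier (fun_lattice C) \<and> A \<noteq> {} \<and> Upper (ord_of (fun_lattice C)) A \<noteq> {}"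
    then obtain u where u: "u \<in> Upper (ord_of (fun_lattice C)) A" by blast
    have "\<exists>s. is_lub (fun_lattice C) s A" by (rule ex_fun_lub[of A u]) (use A u in \<open>auto simp: Upper_def\<close>)
    then show "\<exists>s. least (ord_of (fun_lattice C)) s (Upper (ord_of (fun_lattice C)) A)"
      using least_Upper_iff[of A "fun_lattice C"] A by blast
  qed
qed

interpretation L: dvlattice "fun_lattice C" by (rule dvlattice_fun_lattice)

lemma abs_in: "f \<in> C \<Longrightarrow> (\<lambda>x. \<bar>f x\<bar>) \<in> C"
  by (rule solid_in) auto

lemma fun_minus: "f \<in> C \<Longrightarrow> \<ominus>\<^bsub>fun_lattice C\<^esub> f = (\<lambda>x. - f x)"
  using smult_in[of f "-1"] by (intro L.minus_equality) auto

lemma fun_diff: "f \<in> C \<Longrightarrow> g \<in> C \<Longrightarrow> f \<ominus>\<^bsub>fun_lattice C\<^esub> g = (\<lambda>x. f x - g x)"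
  by (simp add: a_minus_def fun_minus)

lemma fun_abs: "f \<in> C \<Longrightarrow> vabs (fun_lattice C) f = (\<lambda>x. \<bar>f x\<bar>)"
proof -
  assume f: "f \<in> C"
  have "(\<lambda>x. - f x) \<in> C" using smult_in[OF f, of "-1"] by simp
  then show ?thesis unfolding vabs_def fun_minus[OF f] using f abs_in[OF f]
    by (intro L.sup_eqI) (simp_all add: abs_le_iff abs_ge_self abs_ge_minus_self)
qed

end

text \<open>All counterexamples use nets indexed by pairs, directed by the first component only. So a tail
  of the net contains all values of the second component.\<close>

abbreviation fst_le :: "nat \<times> nat \<Rightarrow> nat \<times> nat \<Rightarrow> bool" where
  "fst_le a b \<equiv> fst a \<le> fst b"

lemma directed_fst_le: "directed UNIV fst_le"
  unfolding directed_def
proof (intro conjI ballI)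
  show "reflp_on UNIV fst_le" "transp_on UNIV fst_le" by (auto intro: reflp_onI transp_onI)
  show "\<exists>c\<in>UNIV. fst_le a c \<and> fst_le b c" for a b
    by (rule bexI[of _ "(max (fst a) (fst b), 0)"]) auto
qed simp

abbreviation fst_filter :: "(nat \<times> nat) filter" where
  "fst_filter \<equiv> net_filter UNIV fst_le"

lemma eventually_fst_filter: "eventually P fst_filter \<longleftrightarrow> (\<exists>k. \<forall>m\<ge>k. \<forall>n. P (m, n))"
  unfolding eventually_net_filter[OF directed_fst_le] by auto

locale real_function_ideal = function_ideal C for C :: "(real \<Rightarrow> real) set"
begin

interpretation L: dvlattice "fun_lattice C" by (rule dvlattice_fun_lattice)

definition spike :: "nat \<times> nat \<Rightarrow> (real \<Rightarrow> real) \<Rightarrow> real \<Rightarrow> real" where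
  "spike a = (\<lambda>f\<in>C. \<lambda>x. if x = real (fst a) then real (snd a) * f x else 0)"

lemma spike_in_C: "f \<in> C \<Longrightarrow> (\<lambda>x. if x = r then q * f x else 0) \<in> C"
  by (rule solid_in[OF smult_in[of f q]]) (auto simp: abs_mult)

lemma spike_Orth: "spike a \<in> carrier (Orth (fun_lattice C))"
proof -
  have "linear_operator (fun_lattice C) (spike a)"
    unfolding linear_operator_def by (auto simp: spike_def spike_in_C add_in smult_in algebra_simps)
  then have "orthomorphism (fun_lattice C) (spike a)"
    by (rule L.orthomorphism_of_le_smult[where r="real (snd a)"]) (auto simp: spike_def)
  then show ?thesis by (simp add: Orth_simps(1)) (simp add: spike_def)
qed

lemma spike_abs:
  assumes f: "f \<in> C"
  shows "vabs (fun_lattice C) (spike a f \<ominus>\<^bsub>fun_lattice C\<^esub> \<zero>\<^bsub>Orth (fun_lattice C)\<^esub> f) =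
      (\<lambda>x. if x = real (fst a) then real (snd a) * \<bar>f x\<bar> else 0)"
    and "vabs (fun_lattice C) (\<zero>\<^bsub>Orth (fun_lattice C)\<^esub> f \<ominus>\<^bsub>fun_lattice C\<^esub> spike a f) =
      (\<lambda>x. if x = real (fst a) then real (snd a) * \<bar>f x\<bar> else 0)"
proof -
  have e: "spike a f = (\<lambda>x. if x = real (fst a) then real (snd a) * f x else 0)" using f by (simp add: spike_def)
  have "spike a f \<in> C" unfolding e by (rule spike_in_C[OF f])
  then show 1: "vabs (fun_lattice C) (spike a f \<ominus>\<^bsub>fun_lattice C\<^esub> \<zero>\<^bsub>Orth (fun_lattice C)\<^esub> f) =
      (\<lambda>x. if x = real (fst a) then real (snd a) * \<bar>f x\<bar> else 0)"
    using f zero_in by (auto simp: Orth_simps(2) fun_diff fun_abs e abs_mult)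
  show "vabs (fun_lattice C) (\<zero>\<^bsub>Orth (fun_lattice C)\<^esub> f \<ominus>\<^bsub>fun_lattice C\<^esub> spike a f) =
      (\<lambda>x. if x = real (fst a) then real (snd a) * \<bar>f x\<bar> else 0)"
    using 1 L.abs_diff_comm[of "spike a f" "\<zero>\<^bsub>Orth (fun_lattice C)\<^esub> f"] \<open>spike a f \<in> C\<close> f zero_in
    by (simp add: Orth_simps(2))
qed

text \<open>At the point \<open>k\<close> the members \<open>(k, n)\<close> of a tail take all values \<open>n\<close>.\<close>

lemma spike_unbounded:
  assumes u: "\<forall>\<^sub>F a in fst_filter. \<forall>x. (if x = real (fst a) then real (snd a) * \<bar>f a x\<bar> else 0) \<le> u a x"
    and f: "\<And>m n. f (m, n) (real m) = 1" and u1: "\<And>m n. u (m, n) (real m) = v m"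
  shows False
proof -
  obtain k where k: "\<And>m n x. k \<le> m \<Longrightarrow> (if x = real m then real n * \<bar>f (m, n) x\<bar> else 0) \<le> u (m, n) x"
    using u unfolding eventually_fst_filter by (auto cong: if_cong)
  have "real n \<le> v k" for n using k[of k "real k" n] f[of k n] u1[of k n] by simp
  then show False using reals_Archimedean2[of "v k"] by (meson not_le)
qed

text \<open>The restrictions of \<open>y\<close> to the points \<open>k, k + 1, \<dots>\<close> dominate a tail and decrease to zero.\<close>

lemma spike_uo: "converges Mode_SUO (fun_lattice C) UNIV fst_le spike \<zero>\<^bsub>Orth (fun_lattice C)\<^esub>"
proof -
  have "uo_conv (fun_lattice C) UNIV fst_le (\<lambda>a. spike a f) (\<zero>\<^bsub>Orth (fun_lattice C)\<^esub> f)" if f: "f \<in> C" for f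
  proof (subst L.uo_conv_iff[OF directed_fst_le])
    show sV: "spike a f \<in> carrier (fun_lattice C)" for a using L.Orth_closed[OF spike_Orth] f by simp
    show zV: "\<zero>\<^bsub>Orth (fun_lattice C)\<^esub> f \<in> carrier (fun_lattice C)" using f zero_in by (simp add: Orth_simps(2))
    show "uo_null (fun_lattice C) fst_filter (\<lambda>a. spike a f \<ominus>\<^bsub>fun_lattice C\<^esub> \<zero>\<^bsub>Orth (fun_lattice C)\<^esub> f)"
      unfolding uo_null_def
    proof (intro ballI impI)
      fix y assume y: "y \<in> carrier (fun_lattice C)" "vle (fun_lattice C) \<zero>\<^bsub>fun_lattice C\<^esub> y"
      let ?z = "\<lambda>a. vabs (fun_lattice C) (spike a f \<ominus>\<^bsub>fun_lattice C\<^esub> \<zero>\<^bsub>Orth (fun_lattice C)\<^esub> f)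
         \<sqinter>\<^bsub>ord_of (fun_lattice C)\<^esub> y"
      have dV: "vabs (fun_lattice C) (spike a f \<ominus>\<^bsub>fun_lattice C\<^esub> \<zero>\<^bsub>Orth (fun_lattice C)\<^esub> f) \<in> carrier (fun_lattice C)" for a
        using sV zV by (intro L.abs_closed L.minus_closed)
      show "o_null (fun_lattice C) fst_filter ?z"
      proof (rule L.o_nullI)
        show "fst_filter \<noteq> bot" by (rule net_filter_ne_bot[OF directed_fst_le])
        show "\<forall>\<^sub>F a in fst_filter. ?z a \<in> carrier (fun_lattice C) \<and> vle (fun_lattice C) \<zero>\<^bsub>fun_lattice C\<^esub> (?z a)"
          using sV zV y dV by (intro always_eventually allI conjI L.inf_closed L.inf_nonneg L.abs_nonneg L.minus_closed)
        fix w assume w: "w \<in> carrier (fun_lattice C)"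
          "\<And>u. u \<in> carrier (fun_lattice C) \<Longrightarrow> \<forall>\<^sub>F a in fst_filter. vle (fun_lattice C) (?z a) u \<Longrightarrow> vle (fun_lattice C) w u"
        define u where "u k x = (if \<exists>m\<ge>k. x = real m then y x else 0)" for k x
        have wu: "w x \<le> u k x" for k x
        proof -
          have "u k \<in> C" by (rule solid_in[of y]) (use y in \<open>auto simp: u_def\<close>)
          moreover have "\<forall>\<^sub>F a in fst_filter. vle (fun_lattice C) (?z a) (u k)"
            unfolding eventually_fst_filter
          proof (intro exI[of _ k] allI impI)
            fix m n assume m: "k \<le> m"
            have "vle (fun_lattice C) (?z (m, n)) y" using dV y by (intro L.inf_le2)
            moreover have "vle (fun_lattice C) (?z (m, n))
                 (vabs (fun_lattice C) (spike (m, n) f \<ominus>\<^bsub>fun_lattice C\<^esub> \<zero>\<^bsub>Orth (fun_lattice C)\<^esub> f))"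
              using dV y by (intro L.inf_le1)
            ultimately have "?z (m, n) x \<le> y x \<and> ?z (m, n) x \<le> (if x = real m then real n * \<bar>f x\<bar> else 0)" for x
              unfolding spike_abs[OF f] by (simp cong: if_cong)
            then have "?z (m, n) x \<le> u k x" for x
              using m by (cases "x = real m") (fastforce simp: u_def y[simplified] split: if_splits)+
            then show "vle (fun_lattice C) (?z (m, n)) (u k)" by simp
          qed
          ultimately have "vle (fun_lattice C) w (u k)" using w(2) by simp
          then show ?thesis by simp
        qed
        have "w x \<le> 0" for x
        proof -
          obtain k where k: "x < real k" using reals_Archimedean2 by blast
          then show ?thesis using wu[of x k] by (auto simp: u_def split: if_splits)
        qed
        then show "vle (fun_lattice C) w \<zero>\<^bsub>fun_lattice C\<^esub>" by simp
      qed
    qed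
  qed
  then show ?thesis by simp
qed

end

interpretation all_functions: real_function_ideal "UNIV"
  by unfold_locales auto

text \<open>A dominating net would contain a function that bounds all values \<open>n\<close> at some point \<open>k\<close>.\<close>

lemma all_functions_not_SO:
  "\<not> converges Mode_SO (fun_lattice UNIV) UNIV fst_le all_functions.spike \<zero>\<^bsub>Orth (fun_lattice UNIV)\<^esub>"
proof
  interpret L: dvlattice "fun_lattice (UNIV :: (real \<Rightarrow> real) set)" by (rule all_functions.dvlattice_fun_lattice)
  let ?f = "\<lambda>x::real. 1::real"
  assume "converges Mode_SO (fun_lattice UNIV) UNIV fst_le all_functions.spike \<zero>\<^bsub>Orth (fun_lattice UNIV)\<^esub>"
  then have "o_conv (fun_lattice UNIV) UNIV fst_le (\<lambda>a. all_functions.spike a ?f) (\<zero>\<^bsub>Orth (fun_lattice UNIV)\<^esub> ?f)"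
    by simp
  then have null: "o_null (fun_lattice UNIV) fst_filter
     (\<lambda>a. vabs (fun_lattice UNIV) (\<zero>\<^bsub>Orth (fun_lattice UNIV)\<^esub> ?f \<ominus>\<^bsub>fun_lattice UNIV\<^esub> all_functions.spike a ?f))"
    by (subst (asm) L.o_conv_iff[OF directed_fst_le]) auto
  obtain u where "\<forall>\<^sub>F a in fst_filter. vle (fun_lattice UNIV)
      (vabs (fun_lattice UNIV) (\<zero>\<^bsub>Orth (fun_lattice UNIV)\<^esub> ?f \<ominus>\<^bsub>fun_lattice UNIV\<^esub> all_functions.spike a ?f)) u"
    using L.o_null_ub_nonempty[OF null] by (auto simp: ub_set_def)
  then have "\<forall>\<^sub>F a in fst_filter. \<forall>x. (if x = real (fst a) then real (snd a) * \<bar>?f x\<bar> else 0) \<le> u x"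
    by (simp add: all_functions.spike_abs)
  then show False by (rule all_functions.spike_unbounded[where v="\<lambda>m. u (real m)"]) auto
qed

definition finite_support :: "(real \<Rightarrow> real) set" where
  "finite_support = {f. finite {x. f x \<noteq> 0}}"

interpretation finite_support: real_function_ideal finite_support
proof unfold_locales
  fix f g :: "real \<Rightarrow> real" and r :: real
  show "(\<lambda>x. 0) \<in> finite_support" by (simp add: finite_support_def)
  { assume "f \<in> finite_support" "g \<in> finite_support"
    then have "finite ({x. f x \<noteq> 0} \<union> {x. g x \<noteq> 0})" by (simp add: finite_support_def)
    then show "(\<lambda>x. f x + g x) \<in> finite_support"
      unfolding finite_support_def mem_Collect_eq by (rule finite_subset[rotated]) auto }
  assume f: "f \<in> finite_support"
  then show "(\<lambda>x. r * f x) \<in> finite_support" unfolding finite_support_def by (auto elim: rev_finite_subset)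
  assume "\<And>x. \<bar>g x\<bar> \<le> \<bar>f x\<bar>"
  then have "f x \<noteq> 0" if "g x \<noteq> 0" for x using that by (metis abs_le_zero_iff abs_zero)
  with f show "g \<in> finite_support" unfolding finite_support_def by (auto elim!: rev_finite_subset)
qed

text \<open>For a function \<open>f\<close> of finite support, \<open>spike a f\<close> vanishes eventually. The operators themselves
  do not become smaller.\<close>

lemma finite_support_SO:
  "converges Mode_SO (fun_lattice finite_support) UNIV fst_le finite_support.spike \<zero>\<^bsub>Orth (fun_lattice finite_support)\<^esub>"
proof -
  interpret L: dvlattice "fun_lattice finite_support" by (rule finite_support.dvlattice_fun_lattice)
  let ?E = "fun_lattice finite_support"
  have "o_conv ?E UNIV fst_le (\<lambda>a. finite_support.spike a f) (\<zero>\<^bsub>Orth ?E\<^esub> f)" if f: "f \<in> finite_support" for f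
  proof (subst L.o_conv_iff[OF directed_fst_le])
    show "finite_support.spike a f \<in> carrier ?E" for a using L.Orth_closed[OF finite_support.spike_Orth] f by simp
    show "\<zero>\<^bsub>Orth ?E\<^esub> f \<in> carrier ?E" using f finite_support.zero_in by (simp add: Orth_simps(2))
    have "finite {x. f x \<noteq> 0}" using f by (simp add: finite_support_def)
    then have "bdd_above {x. f x \<noteq> 0}" by (rule bdd_above_finite)
    then obtain M where M: "\<And>x. f x \<noteq> 0 \<Longrightarrow> x \<le> M" unfolding bdd_above_def by blast
    obtain k where k: "M < real k" using reals_Archimedean2 by blast
    have "f (real m) = 0" if "k \<le> m" for m using M[of "real m"] k that by (meson less_le_trans not_le of_nat_le_iff)
    then have ev: "\<forall>\<^sub>F a in fst_filter. vabs ?E (\<zero>\<^bsub>Orth ?E\<^esub> f \<ominus>\<^bsub>?E\<^esub> finite_support.spike a f) = \<zero>\<^bsub>?E\<^esub>"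
      unfolding eventually_fst_filter finite_support.spike_abs[OF f] by (intro exI[of _ k]) auto
    have "o_null ?E fst_filter (\<lambda>a. \<zero>\<^bsub>?E\<^esub>)"
      using net_filter_ne_bot[OF directed_fst_le] finite_support.zero_in by (intro L.o_nullI) auto
    then show "o_null ?E fst_filter (\<lambda>a. vabs ?E (\<zero>\<^bsub>Orth ?E\<^esub> f \<ominus>\<^bsub>?E\<^esub> finite_support.spike a f))"
      using o_null_cong[OF ev] by simp
  qed
  then show ?thesis by simp
qed

lemma finite_support_not_o:
  "\<not> converges Mode_o (fun_lattice finite_support) UNIV fst_le finite_support.spike \<zero>\<^bsub>Orth (fun_lattice finite_support)\<^esub>"
proof
  interpret L: dvlattice "fun_lattice finite_support" by (rule finite_support.dvlattice_fun_lattice)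
  let ?E = "fun_lattice finite_support"
  interpret O: dvlattice "Orth ?E" by (rule L.dvlattice_Orth)
  let ?T = "finite_support.spike" and ?Z = "\<zero>\<^bsub>Orth ?E\<^esub>"
  assume "converges Mode_o ?E UNIV fst_le ?T ?Z"
  then have "o_conv (Orth ?E) UNIV fst_le ?T ?Z" by simp
  then have null: "o_null (Orth ?E) fst_filter (\<lambda>a. vabs (Orth ?E) (?Z \<ominus>\<^bsub>Orth ?E\<^esub> ?T a))"
    by (subst (asm) O.o_conv_iff[OF directed_fst_le]) (auto simp: finite_support.spike_Orth)
  have dO: "?Z \<ominus>\<^bsub>Orth ?E\<^esub> ?T a \<in> carrier (Orth ?E)" for a using finite_support.spike_Orth by simp
  obtain U where U: "\<forall>\<^sub>F a in fst_filter. vle (Orth ?E) (vabs (Orth ?E) (?Z \<ominus>\<^bsub>Orth ?E\<^esub> ?T a)) U"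
    using O.o_null_ub_nonempty[OF null] dO by (auto simp: ub_set_def)
  define e where "e m = (\<lambda>x. if x = real m then 1 else (0::real))" for m
  have e: "e m \<in> finite_support" for m by (simp add: e_def finite_support_def)
  have "\<forall>\<^sub>F a in fst_filter. \<forall>x. (if x = real (fst a) then real (snd a) * \<bar>e (fst a) x\<bar> else 0) \<le> U (e (fst a)) x"
    using U
  proof eventually_elim
    case (elim a)
    have "vle ?E (vabs (Orth ?E) (?Z \<ominus>\<^bsub>Orth ?E\<^esub> ?T a) (e (fst a))) (U (e (fst a)))"
      using elim e by (auto simp: Orth_simps(5) e_def)
    moreover have "vabs (Orth ?E) (?Z \<ominus>\<^bsub>Orth ?E\<^esub> ?T a) (e (fst a)) = vabs ?E (?Z (e (fst a)) \<ominus>\<^bsub>?E\<^esub> ?T a (e (fst a)))"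
      using L.Orth_abs[OF dO[of a], of "e (fst a)"] L.Orth_diff[OF O.zero_closed finite_support.spike_Orth[of a], of "e (fst a)"] e
      by (simp add: e_def)
    ultimately show ?case using finite_support.spike_abs(2)[OF e[of "fst a"], of a] by simp
  qed
  then show False
    by (rule finite_support.spike_unbounded[where f="\<lambda>a. e (fst a)" and v="\<lambda>m. U (e m) (real m)"]) (auto simp: e_def)
qed

section \<open>A uo-Lebesgue topology from a strictly positive functional\<close>

text \<open>This is convergence in measure, if \<open>\<phi>\<close> is the integral and \<open>u\<close> the constant function 1.\<close>

locale order_continuous_functional = vlattice +
  fixes \<phi> :: "'a \<Rightarrow> real" and u :: 'a
  assumes phi_add: "x \<in> V \<Longrightarrow> y \<in> V \<Longrightarrow> \<phi> (x \<oplus> y) = \<phi> x + \<phi> y"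
    and phi_smult: "x \<in> V \<Longrightarrow> \<phi> (r \<odot> x) = r * \<phi> x"
    and phi_nonneg: "x \<in> V \<Longrightarrow> \<zero> \<preceq> x \<Longrightarrow> 0 \<le> \<phi> x"
    and phi_strict: "x \<in> V \<Longrightarrow> \<zero> \<preceq> x \<Longrightarrow> \<phi> x = 0 \<Longrightarrow> x = \<zero>"
    and phi_continuous: "D \<subseteq> V \<Longrightarrow> D \<noteq> {} \<Longrightarrow> is_glb E \<zero> D \<Longrightarrow>
       (\<And>a b. a \<in> D \<Longrightarrow> b \<in> D \<Longrightarrow> \<exists>c\<in>D. c \<preceq> a \<and> c \<preceq> b) \<Longrightarrow> 0 < \<epsilon> \<Longrightarrow> \<exists>d\<in>D. \<phi> d < \<epsilon>"
    and u: "u \<in> V" "\<zero> \<preceq> u"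
    and u_unit: "x \<in> V \<Longrightarrow> \<zero> \<preceq> x \<Longrightarrow> x \<sqinter> u = \<zero> \<Longrightarrow> x = \<zero>"
begin

definition trunc :: "'a \<Rightarrow> real" where "trunc x = \<phi> (\<bbar>x\<bbar> \<sqinter> u)"

lemma phi_mono:
  assumes "x \<preceq> y" and V: "x \<in> V" "y \<in> V" shows "\<phi> x \<le> \<phi> y"
proof -
  have "y = x \<oplus> (y \<ominus> x)" using V by algebra
  then have "\<phi> y = \<phi> x + \<phi> (y \<ominus> x)" using phi_add[of x "y \<ominus> x"] V by simp
  moreover have "0 \<le> \<phi> (y \<ominus> x)" using assms by (intro phi_nonneg) (auto simp: le_iff_diff[symmetric])
  ultimately show ?thesis by simp
qed

lemma trunc_nonneg: "x \<in> V \<Longrightarrow> 0 \<le> trunc x"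
  unfolding trunc_def using u by (intro phi_nonneg) (auto intro: inf_nonneg)

lemma trunc_mono: "x \<in> V \<Longrightarrow> y \<in> V \<Longrightarrow> \<bbar>x\<bbar> \<preceq> \<bbar>y\<bbar> \<Longrightarrow> trunc x \<le> trunc y"
  unfolding trunc_def using u by (intro phi_mono inf_mono) auto

lemma trunc_le: "x \<in> V \<Longrightarrow> trunc x \<le> \<phi> (\<bbar>x\<bbar>)"
  unfolding trunc_def using u by (intro phi_mono) auto

lemma trunc_zero_iff: "x \<in> V \<Longrightarrow> trunc x = 0 \<longleftrightarrow> x = \<zero>"
proof
  assume x: "x \<in> V" and "trunc x = 0"
  then have "\<bbar>x\<bbar> \<sqinter> u = \<zero>" unfolding trunc_def using u by (intro phi_strict) (auto intro: inf_nonneg)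
  then show "x = \<zero>" using u_unit[of "\<bbar>x\<bbar>"] x abs_zero_iff by simp
qed (use u phi_smult[of \<zero> 0] in \<open>simp add: trunc_def inf_absorb1\<close>)

lemma trunc_minus: "x \<in> V \<Longrightarrow> trunc (\<ominus> x) = trunc x"
  by (simp add: trunc_def)

lemma trunc_triangle: assumes [simp]: "x \<in> V" "y \<in> V" shows "trunc (x \<oplus> y) \<le> trunc x + trunc y"
proof -
  note [simp] = u
  have "\<bbar>x \<oplus> y\<bbar> \<sqinter> u \<preceq> (\<bbar>x\<bbar> \<oplus> \<bbar>y\<bbar>) \<sqinter> u" by (rule inf_mono[OF abs_triangle]) auto
  also have "(\<bbar>x\<bbar> \<oplus> \<bbar>y\<bbar>) \<sqinter> u \<preceq> \<bbar>x\<bbar> \<sqinter> u \<oplus> \<bbar>y\<bbar> \<sqinter> u" by (rule inf_add_le) auto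
  finally (le_trans) have "\<bbar>x \<oplus> y\<bbar> \<sqinter> u \<preceq> \<bbar>x\<bbar> \<sqinter> u \<oplus> \<bbar>y\<bbar> \<sqinter> u" by simp
  then show ?thesis unfolding trunc_def using phi_mono[of "\<bbar>x \<oplus> y\<bbar> \<sqinter> u" "\<bbar>x\<bbar> \<sqinter> u \<oplus> \<bbar>y\<bbar> \<sqinter> u"] by (simp add: phi_add)
qed

lemma trunc_smult_bound: assumes [simp]: "x \<in> V" and K: "\<bar>r\<bar> \<le> K" "1 \<le> K" shows "trunc (r \<odot> x) \<le> K * trunc x"
proof -
  note [simp] = u
  have "\<bbar>r \<odot> x\<bbar> \<sqinter> u \<preceq> K \<odot> (\<bbar>x\<bbar> \<sqinter> u)"
  proof -
    have "(1/K) \<odot> (\<bbar>r \<odot> x\<bbar> \<sqinter> u) \<preceq> (1/K) \<odot> (K \<odot> \<bbar>x\<bbar>)"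
    proof (rule smult_mono)
      have le: "\<bbar>r \<odot> x\<bbar> \<preceq> K \<odot> \<bbar>x\<bbar>" using K by (simp add: abs_smult smult_mono_left)
      show "\<bbar>r \<odot> x\<bbar> \<sqinter> u \<preceq> K \<odot> \<bbar>x\<bbar>" by (rule le_trans[OF inf_le1 le]) auto
    qed (use K in auto)
    then have 1: "(1/K) \<odot> (\<bbar>r \<odot> x\<bbar> \<sqinter> u) \<preceq> \<bbar>x\<bbar>" using K by (simp add: smult_smult)
    have "(1/K) \<odot> (\<bbar>r \<odot> x\<bbar> \<sqinter> u) \<preceq> 1 \<odot> (\<bbar>r \<odot> x\<bbar> \<sqinter> u)"
      using K by (intro smult_mono_left) (auto intro: inf_nonneg)
    then have "(1/K) \<odot> (\<bbar>r \<odot> x\<bbar> \<sqinter> u) \<preceq> \<bbar>r \<odot> x\<bbar> \<sqinter> u" by simp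
    then have 2: "(1/K) \<odot> (\<bbar>r \<odot> x\<bbar> \<sqinter> u) \<preceq> u" by (rule le_trans) auto
    have "K \<odot> ((1/K) \<odot> (\<bbar>r \<odot> x\<bbar> \<sqinter> u)) \<preceq> K \<odot> (\<bbar>x\<bbar> \<sqinter> u)"
      using 1 2 K by (intro smult_mono) (auto simp: le_inf_iff)
    then show ?thesis using K by (simp add: smult_smult)
  qed
  then have "\<phi> (\<bbar>r \<odot> x\<bbar> \<sqinter> u) \<le> \<phi> (K \<odot> (\<bbar>x\<bbar> \<sqinter> u))" by (rule phi_mono) auto
  then show ?thesis by (simp add: trunc_def phi_smult)
qed

definition udist :: "'a \<Rightarrow> 'a \<Rightarrow> real" where
  "udist x y = (if x \<in> V \<and> y \<in> V then trunc (x \<ominus> y) else 0)"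

sublocale U: Metric_space V udist
proof
  show "0 \<le> udist x y" for x y by (simp add: udist_def trunc_nonneg)
  show "udist x y = udist y x" for x y
    using abs_diff_comm[of x y] by (simp add: udist_def trunc_def)
  show "udist x y = 0 \<longleftrightarrow> x = y" if "x \<in> V" "y \<in> V" for x y
  proof -
    have "x = (x \<ominus> y) \<oplus> y" using that by algebra
    then have "x \<ominus> y = \<zero> \<longleftrightarrow> x = y" using that by (metis l_zero r_neg a_minus_def)
    then show ?thesis using that by (simp add: udist_def trunc_zero_iff)
  qed
  show "udist x z \<le> udist x y + udist y z" if V: "x \<in> V" "y \<in> V" "z \<in> V" for x y z
  proof -
    have "x \<ominus> z = (x \<ominus> y) \<oplus> (y \<ominus> z)" using V by algebra
    then show ?thesis using trunc_triangle[of "x \<ominus> y" "y \<ominus> z"] V by (simp add: udist_def)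
  qed
qed

lemma linear_topology_udist: "linear_topology E U.mtopology"
proof -
  have "continuous_map (prod_topology U.mtopology U.mtopology) U.mtopology (\<lambda>(x, y). x \<oplus> y)"
    unfolding U.continuous_map_to_metric
  proof (intro ballI allI impI)
    fix z and \<epsilon> :: real assume z: "z \<in> topspace (prod_topology U.mtopology U.mtopology)" and \<epsilon>: "0 < \<epsilon>"
    obtain x y where xy: "z = (x, y)" "x \<in> V" "y \<in> V" using z by auto
    have "x' \<oplus> y' \<in> U.mball (x \<oplus> y) \<epsilon>" if x': "x' \<in> U.mball x (\<epsilon>/2)" and y': "y' \<in> U.mball y (\<epsilon>/2)" for x' y'
    proof -
      have V: "x' \<in> V" "y' \<in> V" using x' y' by auto
      have "(x \<oplus> y) \<ominus> (x' \<oplus> y') = (x \<ominus> x') \<oplus> (y \<ominus> y')" using xy V by algebra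
      then show ?thesis using trunc_triangle[of "x \<ominus> x'" "y \<ominus> y'"] x' y' xy V by (simp add: udist_def)
    qed
    then show "\<exists>W. openin (prod_topology U.mtopology U.mtopology) W \<and> z \<in> W \<and>
        (\<forall>y\<in>W. (case y of (x, y) \<Rightarrow> x \<oplus> y) \<in> U.mball (case z of (x, y) \<Rightarrow> x \<oplus> y) \<epsilon>)"
      using \<epsilon> xy by (intro exI[of _ "U.mball x (\<epsilon>/2) \<times> U.mball y (\<epsilon>/2)"]) (auto simp: openin_prod_Times_iff simp del: U.in_mball)
  qed
  moreover have "continuous_map (prod_topology euclideanreal U.mtopology) U.mtopology (\<lambda>(r, x). r \<odot> x)"
    unfolding U.continuous_map_to_metric
  proof (intro ballI allI impI)
    fix z and \<epsilon> :: real assume z: "z \<in> topspace (prod_topology euclideanreal U.mtopology)" and \<epsilon>: "0 < \<epsilon>"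
    obtain r x where rx: "z = (r, x)" "x \<in> V" using z by auto
    define M where "M = \<phi> (\<bbar>x\<bbar>) + 1"
    define \<delta> where "\<delta> = min 1 (\<epsilon> / (2 * M))"
    define K where "K = \<bar>r\<bar> + 2"
    have M: "0 < M" using phi_nonneg[of "\<bbar>x\<bbar>"] rx by (simp add: M_def)
    have \<delta>: "0 < \<delta>" using M \<epsilon> by (simp add: \<delta>_def)
    have K: "0 < K" by (simp add: K_def)
    have "r' \<odot> x' \<in> U.mball (r \<odot> x) \<epsilon>" if r': "\<bar>r - r'\<bar> < \<delta>" and x': "x' \<in> U.mball x (\<epsilon> / (2 * K))" for r' x'
    proof -
      have V: "x' \<in> V" using x' by auto
      note [simp] = V rx(2)
      have "r \<odot> x \<ominus> r' \<odot> x' = (r - r') \<odot> x \<oplus> r' \<odot> (x \<ominus> x')"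
      proof -
        have "r \<odot> x = (r - r') \<odot> x \<oplus> r' \<odot> x" using smult_add_left[of x "r - r'" r'] by simp
        moreover have "(r - r') \<odot> x \<oplus> r' \<odot> x \<ominus> r' \<odot> x' = (r - r') \<odot> x \<oplus> (r' \<odot> x \<ominus> r' \<odot> x')"
          using V rx(2) by algebra
        ultimately show ?thesis by (simp add: smult_diff_right)
      qed
      then have "udist (r \<odot> x) (r' \<odot> x') \<le> trunc ((r - r') \<odot> x) + trunc (r' \<odot> (x \<ominus> x'))"
        using trunc_triangle[of "(r - r') \<odot> x" "r' \<odot> (x \<ominus> x')"] by (simp add: udist_def)
      also have "trunc (r' \<odot> (x \<ominus> x')) \<le> K * trunc (x \<ominus> x')"
        using r' by (intro trunc_smult_bound) (auto simp: K_def \<delta>_def)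
      also have "K * trunc (x \<ominus> x') < K * (\<epsilon> / (2 * K))"
        using x' K by (intro mult_strict_left_mono) (auto simp: udist_def)
      also have "trunc ((r - r') \<odot> x) \<le> \<bar>r - r'\<bar> * \<phi> (\<bbar>x\<bbar>)"
        using trunc_le[of "(r - r') \<odot> x"] by (simp add: abs_smult phi_smult)
      also have "\<bar>r - r'\<bar> * \<phi> (\<bbar>x\<bbar>) \<le> \<delta> * M"
        using r' phi_nonneg[of "\<bbar>x\<bbar>"] by (intro mult_mono) (auto simp: M_def)
      also have "\<delta> * M \<le> (\<epsilon> / (2 * M)) * M" using M by (intro mult_right_mono) (auto simp: \<delta>_def)
      finally show ?thesis using M K by simp
    qed
    moreover have "openin euclideanreal {r'. \<bar>r - r'\<bar> < \<delta>}"
      using open_ball[of r \<delta>] by (simp add: ball_def dist_real_def)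
    ultimately show "\<exists>W. openin (prod_topology euclideanreal U.mtopology) W \<and> z \<in> W \<and>
        (\<forall>y\<in>W. (case y of (x, y) \<Rightarrow> x \<odot> y) \<in> U.mball (case z of (x, y) \<Rightarrow> x \<odot> y) \<epsilon>)"
      using \<epsilon> \<delta> K rx
      by (intro exI[of _ "{r'. \<bar>r - r'\<bar> < \<delta>} \<times> U.mball x (\<epsilon> / (2 * K))"])
         (auto simp: openin_prod_Times_iff simp del: U.in_mball)
  qed
  ultimately show ?thesis by (simp add: linear_topology_def)
qed

lemma limitin_udist_zero:
  "limitin U.mtopology x \<zero> F \<longleftrightarrow> (\<forall>\<epsilon>>0. \<forall>\<^sub>F i in F. x i \<in> V \<and> trunc (x i) < \<epsilon>)"
proof -
  have "x i \<in> V \<and> udist (x i) \<zero> < \<epsilon> \<longleftrightarrow> x i \<in> V \<and> trunc (x i) < \<epsilon>" for i \<epsilon>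
    by (auto simp: udist_def a_minus_def)
  then show ?thesis by (simp add: U.limitin_metric)
qed

lemma uo_null_ub_small:
  assumes F: "F \<noteq> bot" and x: "\<forall>\<^sub>F i in F. x i \<in> V" and null: "uo_null E F x" and \<epsilon>: "0 < \<epsilon>"
  shows "\<exists>d\<in>V. \<phi> d < \<epsilon> \<and> (\<forall>\<^sub>F i in F. \<bbar>x i\<bbar> \<sqinter> u \<preceq> d)"
proof -
  let ?D = "ub_set E F (\<lambda>i. \<bbar>x i\<bbar> \<sqinter> u)"
  have null': "o_null E F (\<lambda>i. \<bbar>x i\<bbar> \<sqinter> u)" using null u unfolding uo_null_def by blast
  have V: "\<forall>\<^sub>F i in F. \<bbar>x i\<bbar> \<sqinter> u \<in> V" using x by eventually_elim (use u in auto)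
  have "\<exists>d\<in>?D. \<phi> d < \<epsilon>"
  proof (rule phi_continuous)
    show "?D \<subseteq> V" by (auto simp: ub_set_def)
    show "?D \<noteq> {}" by (rule o_null_ub_nonempty[OF null' V])
    show "is_glb E \<zero> ?D" using null' by (simp add: o_null_def)
    show "\<exists>c\<in>?D. c \<preceq> a \<and> c \<preceq> b" if ab: "a \<in> ?D" "b \<in> ?D" for a b
    proof (intro bexI conjI)
      have abV: "a \<in> V" "b \<in> V" and ev: "\<forall>\<^sub>F i in F. \<bbar>x i\<bbar> \<sqinter> u \<preceq> a" "\<forall>\<^sub>F i in F. \<bbar>x i\<bbar> \<sqinter> u \<preceq> b"
        using ab by (auto simp: ub_set_def)
      show "a \<sqinter> b \<preceq> a" "a \<sqinter> b \<preceq> b" using abV by auto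
      have "\<forall>\<^sub>F i in F. \<bbar>x i\<bbar> \<sqinter> u \<preceq> a \<sqinter> b" using ev V
      proof eventually_elim
        case (elim i)
        then show ?case using le_inf_iff[OF abV elim(3)] by simp
      qed
      then show "a \<sqinter> b \<in> ?D" using abV by (simp add: ub_set_def)
    qed
  qed (rule \<epsilon>)
  then show ?thesis by (auto simp: ub_set_def)
qed

lemma uo_lebesgue_udist: "uo_lebesgue E U.mtopology"
proof -
  have "locally_solid E U.mtopology" unfolding locally_solid_def
  proof (intro allI impI)
    fix W assume W: "openin U.mtopology W \<and> \<zero> \<in> W"
    then obtain r where r: "r > 0" "U.mball \<zero> r \<subseteq> W" unfolding U.openin_mtopology by blast
    have ball: "U.mball \<zero> r = {x \<in> V. trunc x < r}"
      by (auto simp: udist_def a_minus_def trunc_minus)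
    have "solid E (U.mball \<zero> r)" unfolding ball solid_def using trunc_mono by (auto intro: le_less_trans)
    then show "\<exists>S W'. solid E S \<and> openin U.mtopology W' \<and> \<zero> \<in> W' \<and> W' \<subseteq> S \<and> S \<subseteq> W"
      using r by (intro exI[of _ "U.mball \<zero> r"]) auto
  qed
  moreover have "limitin U.mtopology x \<zero> (net_filter A lq)"
    if d: "directed A lq" and x: "\<forall>a\<in>A. x a \<in> V" and conv: "uo_conv E A lq x \<zero>"
    for A :: "('a \<times> 'a set) set" and lq x
    unfolding limitin_udist_zero
  proof (intro allI impI)
    fix \<epsilon> :: real assume \<epsilon>: "0 < \<epsilon>"
    have xV: "\<forall>\<^sub>F a in net_filter A lq. x a \<in> V" using eventually_net_mem[OF d] by eventually_elim (use x in auto)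
    have null: "uo_null E (net_filter A lq) (\<lambda>a. x a \<ominus> \<zero>)"
      using conv by (subst (asm) uo_conv_iff[OF d]) (use x in auto)
    have zV: "\<forall>\<^sub>F a in net_filter A lq. x a \<ominus> \<zero> \<in> V" using xV by eventually_elim auto
    obtain v where v: "v \<in> V" "\<phi> v < \<epsilon>" "\<forall>\<^sub>F a in net_filter A lq. \<bbar>x a \<ominus> \<zero>\<bbar> \<sqinter> u \<preceq> v"
      using uo_null_ub_small[OF net_filter_ne_bot[OF d] zV null \<epsilon>] by blast
    show "\<forall>\<^sub>F a in net_filter A lq. x a \<in> V \<and> trunc (x a) < \<epsilon>"
      using xV v(3)
    proof eventually_elim
      case (elim a)
      then have "trunc (x a) \<le> \<phi> v" unfolding trunc_def using v(1) u by (intro phi_mono) (auto simp: a_minus_def)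
      then show ?case using elim v(2) by simp
    qed
  qed
  ultimately show ?thesis unfolding uo_lebesgue_def using linear_topology_udist by blast
qed

lemma admits_uoL_udist: "admits_uoL E"
  unfolding admits_uoL_def using uo_lebesgue_udist U.Hausdorff_space_mtopology by blast

end

section \<open>A lattice without atoms\<close>

text \<open>A bounded measurable function on \<open>[0, 1]\<close> is determined, up to null sets, by its indefinite
  integral. The indefinite integrals are the Lipschitz functions that vanish at 0, and the order of
  the integrands is the order for which the monotone functions are positive. So the following lattice
  is \<open>L\<^sup>\<infinity>[0, 1]\<close>, without equivalence classes. The functions are constant outside \<open>[0, 1]\<close>, since
  the increments are compared with those of \<open>unit_clamp\<close>, the integral of the constant function 1.\<close>

definition unit_clamp :: "real \<Rightarrow> real" where "unit_clamp t = max 0 (min 1 t)"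

lemma unit_clamp_mono: "s \<le> t \<Longrightarrow> unit_clamp s \<le> unit_clamp t"
  by (auto simp: unit_clamp_def)

definition lips :: "(real \<Rightarrow> real) set" where
  "lips = {F. F 0 = 0 \<and> (\<exists>C. \<forall>s t. s \<le> t \<longrightarrow> \<bar>F t - F s\<bar> \<le> C * (unit_clamp t - unit_clamp s))}"

definition lip_lattice :: "(real \<Rightarrow> real) vlat" where
  "lip_lattice = \<lparr>carrier = lips, mult = (\<lambda>f g. f), one = (\<lambda>x. 0), zero = (\<lambda>x. 0),
     add = (\<lambda>f g x. f x + g x), smult = (\<lambda>r f x. r * f x),
     vle = (\<lambda>f g. \<forall>s t. s \<le> t \<longrightarrow> f t - f s \<le> g t - g s)\<rparr>"

lemma lip_lattice_simps [simp]:
  "carrier lip_lattice = lips" "\<zero>\<^bsub>lip_lattice\<^esub> = (\<lambda>x. 0)"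
  "f \<oplus>\<^bsub>lip_lattice\<^esub> g = (\<lambda>x. f x + g x)" "r \<odot>\<^bsub>lip_lattice\<^esub> f = (\<lambda>x. r * f x)"
  "vle lip_lattice f g \<longleftrightarrow> (\<forall>s t. s \<le> t \<longrightarrow> f t - f s \<le> g t - g s)"
  by (simp_all add: lip_lattice_def)

lemma lipsI:
  "F 0 = 0 \<Longrightarrow> (\<And>s t. s \<le> t \<Longrightarrow> \<bar>F t - F s\<bar> \<le> C * (unit_clamp t - unit_clamp s)) \<Longrightarrow> F \<in> lips"
  unfolding lips_def by blast

lemma lipsE:
  assumes "F \<in> lips"
  obtains C where "0 \<le> C" "\<And>s t. s \<le> t \<Longrightarrow> \<bar>F t - F s\<bar> \<le> C * (unit_clamp t - unit_clamp s)"
proof -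
  obtain C where C: "\<And>s t. s \<le> t \<Longrightarrow> \<bar>F t - F s\<bar> \<le> C * (unit_clamp t - unit_clamp s)"
    using assms unfolding lips_def by blast
  have "\<bar>F t - F s\<bar> \<le> max C 0 * (unit_clamp t - unit_clamp s)" if "s \<le> t" for s t
    using C[OF that] unit_clamp_mono[OF that] by (smt (verit) mult_right_mono)
  then show ?thesis by (rule that[rotated]) auto
qed

lemma lips_0: "F \<in> lips \<Longrightarrow> F 0 = 0"
  by (simp add: lips_def)

lemma unit_clamp_lips: "unit_clamp \<in> lips"
  by (rule lipsI[of _ 1]) (auto simp: unit_clamp_mono, simp add: unit_clamp_def)

lemma lips_zero: "(\<lambda>x. 0) \<in> lips"
  by (rule lipsI[of _ 0]) auto

lemma lips_add: assumes "F \<in> lips" "G \<in> lips" shows "(\<lambda>x. F x + G x) \<in> lips"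
proof -
  obtain C where C: "\<And>s t. s \<le> t \<Longrightarrow> \<bar>F t - F s\<bar> \<le> C * (unit_clamp t - unit_clamp s)"
    using assms(1) by (rule lipsE) blast
  obtain D where D: "\<And>s t. s \<le> t \<Longrightarrow> \<bar>G t - G s\<bar> \<le> D * (unit_clamp t - unit_clamp s)"
    using assms(2) by (rule lipsE) blast
  show ?thesis
  proof (rule lipsI[of _ "C + D"])
    show "\<bar>F t + G t - (F s + G s)\<bar> \<le> (C + D) * (unit_clamp t - unit_clamp s)" if "s \<le> t" for s t
      using C[OF that] D[OF that] by (simp add: distrib_right)
  qed (use lips_0[OF assms(1)] lips_0[OF assms(2)] in simp)
qed

lemma lips_smult: assumes "F \<in> lips" shows "(\<lambda>x. r * F x) \<in> lips"
proof -
  obtain C where C: "\<And>s t. s \<le> t \<Longrightarrow> \<bar>F t - F s\<bar> \<le> C * (unit_clamp t - unit_clamp s)"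
    using assms(1) by (rule lipsE) blast
  show ?thesis
  proof (rule lipsI[of _ "\<bar>r\<bar> * C"])
    show "\<bar>r * F t - r * F s\<bar> \<le> \<bar>r\<bar> * C * (unit_clamp t - unit_clamp s)" if "s \<le> t" for s t
      using mult_left_mono[OF C[OF that], of "\<bar>r\<bar>"] by (simp add: right_diff_distrib[symmetric] abs_mult mult.assoc)
  qed (use assms lips_0 in auto)
qed

lemma lips_between:
  assumes "F \<in> lips" "G \<in> lips" "H 0 = 0"
    and "\<And>s t. s \<le> t \<Longrightarrow> F t - F s \<le> H t - H s" "\<And>s t. s \<le> t \<Longrightarrow> H t - H s \<le> G t - G s"
  shows "H \<in> lips"
proof -
  obtain C where C: "\<And>s t. s \<le> t \<Longrightarrow> \<bar>F t - F s\<bar> \<le> C * (unit_clamp t - unit_clamp s)" "0 \<le> C"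
    using assms(1) by (rule lipsE) blast
  obtain D where D: "\<And>s t. s \<le> t \<Longrightarrow> \<bar>G t - G s\<bar> \<le> D * (unit_clamp t - unit_clamp s)" "0 \<le> D"
    using assms(2) by (rule lipsE) blast
  show ?thesis
  proof (rule lipsI[of _ "C + D"])
    show "\<bar>H t - H s\<bar> \<le> (C + D) * (unit_clamp t - unit_clamp s)" if "s \<le> t" for s t
      using C(1)[OF that] D(1)[OF that] assms(4,5)[OF that] by (simp add: distrib_right)
  qed (rule assms)
qed

text \<open>The increments of a supremum are the suprema of sums of increments along chains of intervals.\<close>

inductive chain_sum :: "(real \<Rightarrow> real) set \<Rightarrow> real \<Rightarrow> real \<Rightarrow> real \<Rightarrow> bool" for A where
  single: "F \<in> A \<Longrightarrow> s \<le> t \<Longrightarrow> chain_sum A s t (F t - F s)"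
| append: "chain_sum A s t a \<Longrightarrow> chain_sum A t u b \<Longrightarrow> chain_sum A s u (a + b)"

lemma chain_sum_split:
  "chain_sum A s u v \<Longrightarrow> s \<le> t \<Longrightarrow> t \<le> u \<Longrightarrow> \<exists>a b. chain_sum A s t a \<and> chain_sum A t u b \<and> v = a + b"
proof (induction arbitrary: t rule: chain_sum.induct)
  case (single F s u)
  then show ?case
    by (intro exI[of _ "F t - F s"] exI[of _ "F u - F t"]) (auto intro: chain_sum.single)
next
  case (append s r a u b)
  show ?case
  proof (cases "t \<le> r")
    case True
    then obtain a1 a2 where "chain_sum A s t a1" "chain_sum A t r a2" "a = a1 + a2" using append by blast
    then show ?thesis using append.hyps(2)
      by (intro exI[of _ a1] exI[of _ "a2 + b"]) (auto intro: chain_sum.append)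
  next
    case False
    then obtain b1 b2 where "chain_sum A r t b1" "chain_sum A t u b2" "b = b1 + b2" using append by (metis linear)
    then show ?thesis using append.hyps(1)
      by (intro exI[of _ "a + b1"] exI[of _ b2]) (auto intro: chain_sum.append)
  qed
qed

lemma ex_lip_lub:
  assumes A: "A \<subseteq> lips" "A \<noteq> {}" and U: "U \<in> lips" "\<And>F s t. F \<in> A \<Longrightarrow> s \<le> t \<Longrightarrow> F t - F s \<le> U t - U s"
  shows "\<exists>H. is_lub lip_lattice H A"
proof -
  obtain F0 where F0: "F0 \<in> A" using A by blast
  define h where "h s t = Sup {a. chain_sum A s t a}" for s t
  have upper: "a \<le> W t - W s" if "chain_sum A s t a" "\<And>F s t. F \<in> A \<Longrightarrow> s \<le> t \<Longrightarrow> F t - F s \<le> W t - W s" for a s t W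
    using that(1) by (induction rule: chain_sum.induct) (use that(2) in force)+
  have bdd: "bdd_above {a. chain_sum A s t a}" for s t
    using upper[of _ _ _ U] U(2) by (intro bdd_aboveI[of _ "U t - U s"]) auto
  have ne: "{a. chain_sum A s t a} \<noteq> {}" if "s \<le> t" for s t using chain_sum.single[OF F0 that] by blast
  have h_ge: "a \<le> h s t" if "chain_sum A s t a" for s t a
    unfolding h_def using that by (intro cSup_upper bdd) auto
  have h_le: "h s t \<le> c" if "s \<le> t" "\<And>a. chain_sum A s t a \<Longrightarrow> a \<le> c" for s t c
    unfolding h_def using that ne by (intro cSup_least) auto
  have h_add: "h s u = h s t + h t u" if st: "s \<le> t" and tu: "t \<le> u" for s t u
  proof (rule antisym)
    show "h s u \<le> h s t + h t u"
    proof (rule h_le)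
      fix v assume v: "chain_sum A s u v"
      obtain a b where "chain_sum A s t a" "chain_sum A t u b" "v = a + b"
        using chain_sum_split[OF v st tu] by blast
      then show "v \<le> h s t + h t u" using h_ge by (simp add: add_mono)
    qed (use st tu in simp)
    have "h s t \<le> h s u - h t u"
    proof (rule h_le[OF st])
      fix a assume a: "chain_sum A s t a"
      have "h t u \<le> h s u - a"
        by (rule h_le[OF tu]) (use chain_sum.append[OF a] h_ge in \<open>force simp: le_diff_eq add.commute\<close>)
      then show "a \<le> h s u - h t u" by simp
    qed
    then show "h s t + h t u \<le> h s u" by simp
  qed
  define H where "H t = (if 0 \<le> t then h 0 t else - h t 0)" for t
  have H: "H t - H s = h s t" if "s \<le> t" for s t
    using h_add[of 0 s t] h_add[of s 0 t] h_add[of s t 0] that by (auto simp: H_def)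
  have H0: "H 0 = 0" using h_add[of 0 0 0] by (simp add: H_def)
  have ub: "F t - F s \<le> H t - H s" if "F \<in> A" "s \<le> t" for F s t
    using h_ge[OF chain_sum.single[OF that]] H[OF that(2)] by simp
  have least: "H t - H s \<le> W t - W s" if "\<And>F s t. F \<in> A \<Longrightarrow> s \<le> t \<Longrightarrow> F t - F s \<le> W t - W s" "s \<le> t" for W s t
    using h_le[OF that(2), of "W t - W s"] upper[of s t _ W] that H[OF that(2)] by simp
  have "H \<in> lips"
  proof (rule lips_between[where H=H, OF subsetD[OF A(1) F0] U(1) H0])
    show "F0 t - F0 s \<le> H t - H s" if "s \<le> t" for s t using ub[OF F0 that] .
    show "H t - H s \<le> U t - U s" if "s \<le> t" for s t by (rule least[OF U(2) that])
  qed
  then have "is_lub lip_lattice H A" unfolding is_lub_def using ub least by simp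
  then show ?thesis by (intro exI[of _ H])
qed

lemma module_lip_lattice: "Module.module real_ring lip_lattice"
proof (rule moduleI[OF cring_real_ring])
  show "abelian_group lip_lattice"
  proof (rule abelian_groupI)
    show "\<exists>g\<in>carrier lip_lattice. g \<oplus>\<^bsub>lip_lattice\<^esub> f = \<zero>\<^bsub>lip_lattice\<^esub>"
      if "f \<in> carrier lip_lattice" for f
      using lips_smult[of f "-1"] that by (intro bexI[of _ "\<lambda>x. -1 * f x"]) auto
  qed (auto simp: lips_add lips_zero algebra_simps)
qed (auto simp: lips_smult algebra_simps)

lemma dvlattice_lip_lattice: "dvlattice lip_lattice"
proof
  show "vector_lattice lip_lattice"
  proof (rule vector_latticeI[OF module_lip_lattice])
    show "\<exists>s. is_lub lip_lattice s {F, G}"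
      if FG: "F \<in> carrier lip_lattice" "G \<in> carrier lip_lattice" for F G
    proof -
      obtain C where C: "\<And>s t. s \<le> t \<Longrightarrow> \<bar>F t - F s\<bar> \<le> C * (unit_clamp t - unit_clamp s)" "0 \<le> C"
        using FG(1) unfolding lip_lattice_simps by (rule lipsE) blast
      obtain D where D: "\<And>s t. s \<le> t \<Longrightarrow> \<bar>G t - G s\<bar> \<le> D * (unit_clamp t - unit_clamp s)" "0 \<le> D"
        using FG(2) unfolding lip_lattice_simps by (rule lipsE) blast
      show ?thesis
      proof (rule ex_lip_lub)
        show "(\<lambda>x. (C + D) * unit_clamp x) \<in> lips" by (rule lips_smult[OF unit_clamp_lips])
        fix K s t assume K: "K \<in> {F, G}" and st: "s \<le> (t::real)"
        have "0 \<le> C * (unit_clamp t - unit_clamp s)" "0 \<le> D * (unit_clamp t - unit_clamp s)"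
          using C(2) D(2) unit_clamp_mono[OF st] by auto
        then have "K t - K s \<le> C * (unit_clamp t - unit_clamp s) + D * (unit_clamp t - unit_clamp s)"
          using C(1)[OF st] D(1)[OF st] K by auto
        then show "K t - K s \<le> (C + D) * unit_clamp t - (C + D) * unit_clamp s"
          by (simp add: algebra_simps)
      qed (use FG in auto)
    qed
    show "archimedean lip_lattice" unfolding archimedean_def
    proof (intro ballI impI)
      fix F G assume le: "\<forall>n. vle lip_lattice (real n \<odot>\<^bsub>lip_lattice\<^esub> F) G"
      have "F t - F s \<le> 0" if st: "s \<le> t" for s t
      proof (rule ccontr)
        assume "\<not> F t - F s \<le> 0"
        then obtain n where "G t - G s < real n * (F t - F s)" using reals_Archimedean3[of "F t - F s"] by auto
        then show False using le st by (auto simp: not_le[symmetric] right_diff_distrib)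
      qed
      then show "vle lip_lattice F \<zero>\<^bsub>lip_lattice\<^esub>" by simp
    qed
    show "vle lip_lattice F H" if "vle lip_lattice F G" "vle lip_lattice G H" for F G H
      using that by simp (meson order_trans)
    show "F = G" if V: "F \<in> carrier lip_lattice" "G \<in> carrier lip_lattice" and le: "vle lip_lattice F G" "vle lip_lattice G F" for F G
    proof
      fix t
      have *: "F t - F s = G t - G s" if "s \<le> t" for s t using le that by (auto intro: antisym)
      have "F 0 = 0" "G 0 = 0" using V lips_0 by auto
      then show "F t = G t" using *[of 0 t] *[of t 0] by (cases "0 \<le> t") auto
    qed
    show "vle lip_lattice (r \<odot>\<^bsub>lip_lattice\<^esub> F) (r \<odot>\<^bsub>lip_lattice\<^esub> G)" if "0 \<le> r" "vle lip_lattice F G" for r F G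
      using that mult_left_mono[of _ _ r] by (simp add: right_diff_distrib[symmetric])
    show "vle lip_lattice (F \<oplus>\<^bsub>lip_lattice\<^esub> H) (G \<oplus>\<^bsub>lip_lattice\<^esub> H)" if "vle lip_lattice F G" for F G H
      using that by (simp add: algebra_simps)
  qed auto
  show "dedekind_complete lip_lattice" unfolding dedekind_complete_def
  proof (intro allI impI)
    fix A assume A: "A \<subseteq> carrier lip_lattice \<and> A \<noteq> {} \<and> Upper (ord_of lip_lattice) A \<noteq> {}"
    then obtain U where U: "U \<in> Upper (ord_of lip_lattice) A" by blast
    have "\<exists>s. is_lub lip_lattice s A"
    proof (rule ex_lip_lub[of A U])
      have "vle lip_lattice F U" if "F \<in> A" for F using U A that by (auto simp: Upper_def)
      then show "F t - F s \<le> U t - U s" if "F \<in> A" "s \<le> t" for F s t using that by simp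
    qed (use A U in \<open>auto simp: Upper_def\<close>)
    then show "\<exists>s. least (ord_of lip_lattice) s (Upper (ord_of lip_lattice) A)"
      using least_Upper_iff[of A "lip_lattice"] A by blast
  qed
qed

interpretation Lip: dvlattice lip_lattice by (rule dvlattice_lip_lattice)

lemma lip_minus: "F \<in> lips \<Longrightarrow> \<ominus>\<^bsub>lip_lattice\<^esub> F = (\<lambda>x. - F x)"
  using lips_smult[of F "-1"] by (intro Lip.minus_equality) auto

lemma lip_abs_le:
  assumes F: "F \<in> lips" and G: "G \<in> lips" and le: "\<And>s t. s \<le> t \<Longrightarrow> \<bar>F t - F s\<bar> \<le> G t - G s"
  shows "vle lip_lattice (vabs lip_lattice F) G"
proof -
  have "F t - F s \<le> G t - G s" "- F t - - F s \<le> G t - G s" if "s \<le> t" for s t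
    using le[OF that] by (auto simp: abs_le_iff)
  then show ?thesis using Lip.abs_le_iff[of F G] F G by (simp add: lip_minus)
qed

text \<open>The pointwise infimum of a downward directed set is its infimum: since the set is directed, the
  increments of the pointwise infimum lie below those of all members.\<close>

lemma lip_order_continuous:
  assumes D: "D \<subseteq> lips" "D \<noteq> {}" and glb: "is_glb lip_lattice (\<lambda>x. 0) D"
    and dir: "\<And>F G. F \<in> D \<Longrightarrow> G \<in> D \<Longrightarrow> \<exists>H\<in>D. vle lip_lattice H F \<and> vle lip_lattice H G" and \<epsilon>: "0 < \<epsilon>"
  shows "\<exists>F\<in>D. F 1 < \<epsilon>"
proof -
  have mono: "F s \<le> F t" if "F \<in> D" "s \<le> t" for F s t using glb that by (auto simp: is_glb_def)
  have F0: "F 0 = 0" if "F \<in> D" for F using D(1) that lips_0 by blast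
  define L where "L t = (INF F\<in>D. F t)" for t
  have neg: "F t = 0" if F: "F \<in> D" and t: "t \<le> 0" for F t
  proof -
    obtain C where "\<And>s t. s \<le> t \<Longrightarrow> \<bar>F t - F s\<bar> \<le> C * (unit_clamp t - unit_clamp s)"
      using D(1) F lipsE by (metis subsetD)
    from this[OF t] show ?thesis using F0[OF F] t by (simp add: unit_clamp_def)
  qed
  have bdd: "bdd_below ((\<lambda>F. F t) ` D)" for t
  proof (cases "0 \<le> t")
    case True
    have "0 \<le> F t" if "F \<in> D" for F using mono[OF that True] F0[OF that] by simp
    then show ?thesis by (intro bdd_belowI[of _ 0]) auto
  next
    case False
    then have "F t = 0" if "F \<in> D" for F using neg[OF that] by simp
    then show ?thesis by (intro bdd_belowI[of _ 0]) (auto intro: eq_refl sym)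
  qed
  have lower: "L t \<le> F t" if "F \<in> D" for F t unfolding L_def using bdd that by (intro cINF_lower)
  have greatest: "c \<le> L t" if "\<And>F. F \<in> D \<Longrightarrow> c \<le> F t" for c t unfolding L_def using D(2) that by (intro cINF_greatest)
  have incr: "L t - L s \<le> F t - F s" if F: "F \<in> D" and st: "s \<le> t" for F s t
  proof -
    have "L t - (F t - F s) \<le> L s"
    proof (rule greatest)
      fix G assume G: "G \<in> D"
      obtain H where H: "H \<in> D" "vle lip_lattice H F" "vle lip_lattice H G" using dir[OF F G] by blast
      have "H t - H s \<le> F t - F s" using H(2) st by simp
      moreover have "H s \<le> G s"
      proof (cases "0 \<le> s")
        case True
        then have "H s - H 0 \<le> G s - G 0" using H(3) by simp
        then show ?thesis using F0[OF H(1)] F0[OF G] by simp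
      qed (use neg[OF H(1)] neg[OF G] in simp)
      ultimately show "L t - (F t - F s) \<le> G s" using lower[OF H(1), of t] by simp
    qed
    then show ?thesis by simp
  qed
  have L_mono: "L s \<le> L t" if "s \<le> t" for s t
    by (rule greatest) (rule order_trans[OF lower mono[OF _ that]])
  obtain F1 where F1: "F1 \<in> D" using D(2) by blast
  have "0 \<le> L 0" by (rule greatest) (simp add: F0)
  then have L0: "L 0 = 0" using lower[OF F1, of 0] F0[OF F1] by simp
  have "L \<in> lips"
  proof (rule lips_between[OF lips_zero subsetD[OF D(1) F1]])
    show "L 0 = 0" by (rule L0)
    show "L t - L s \<le> F1 t - F1 s" if "s \<le> t" for s t by (rule incr[OF F1 that])
  qed (use L_mono in auto)
  then have "vle lip_lattice L (\<lambda>x. 0)"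
    using glb incr unfolding is_glb_def by (auto simp del: lip_lattice_simps(5) simp: lip_lattice_simps(5)[of L])
  then have "L 1 - L 0 \<le> 0" by simp
  then have "(INF F\<in>D. F 1) < \<epsilon>" using \<epsilon> L0 unfolding L_def[symmetric] by simp
  then show ?thesis using bdd D(2) by (auto simp: cINF_less_iff)
qed

lemma lip_functional: "order_continuous_functional lip_lattice (\<lambda>F. F 1) unit_clamp"
proof unfold_locales
  show "unit_clamp \<in> carrier lip_lattice" by (simp add: unit_clamp_lips)
  show u0: "vle lip_lattice \<zero>\<^bsub>lip_lattice\<^esub> unit_clamp" by (simp add: unit_clamp_mono)
  show "\<exists>d\<in>D. d 1 < \<epsilon>" if "D \<subseteq> carrier lip_lattice" "D \<noteq> {}" "is_glb lip_lattice \<zero>\<^bsub>lip_lattice\<^esub> D"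
    "\<And>a b. a \<in> D \<Longrightarrow> b \<in> D \<Longrightarrow> \<exists>c\<in>D. vle lip_lattice c a \<and> vle lip_lattice c b" "0 < \<epsilon>" for D and \<epsilon> :: real
    using lip_order_continuous[of D \<epsilon>] that by (simp del: lip_lattice_simps(5))
  show "0 \<le> F 1" if "F \<in> carrier lip_lattice" "vle lip_lattice \<zero>\<^bsub>lip_lattice\<^esub> F" for F
  proof -
    have "0 \<le> F 1 - F 0" using that(2) by simp
    then show ?thesis using lips_0[of F] that(1) by simp
  qed
  show "F = \<zero>\<^bsub>lip_lattice\<^esub>" if F: "F \<in> carrier lip_lattice" "vle lip_lattice \<zero>\<^bsub>lip_lattice\<^esub> F" "F 1 = 0" for F
  proof
    fix t
    have mono: "F s \<le> F t" if "s \<le> t" for s t using F(2) that by simp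
    have F0: "F 0 = 0" using F(1) lips_0 by simp
    obtain C where C: "\<And>s t. s \<le> t \<Longrightarrow> \<bar>F t - F s\<bar> \<le> C * (unit_clamp t - unit_clamp s)"
      using F(1) unfolding lip_lattice_simps(1) by (rule lipsE) blast
    have "F t = 0"
    proof -
      consider "t \<le> 0" | "0 \<le> t" "t \<le> 1" | "1 \<le> t" by linarith
      then show ?thesis
      proof cases
        case 1
        then show ?thesis using C[OF 1] F0 by (simp add: unit_clamp_def)
      next
        case 2
        then show ?thesis using mono[of 0 t] mono[of t 1] F0 F(3) by simp
      next
        case 3
        then show ?thesis using C[OF 3] F(3) by (simp add: unit_clamp_def)
      qed
    qed
    then show "F t = \<zero>\<^bsub>lip_lattice\<^esub> t" by simp
  qed
  show "F = \<zero>\<^bsub>lip_lattice\<^esub>"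
    if F: "F \<in> carrier lip_lattice" "vle lip_lattice \<zero>\<^bsub>lip_lattice\<^esub> F" and inf: "F \<sqinter>\<^bsub>ord_of lip_lattice\<^esub> unit_clamp = \<zero>\<^bsub>lip_lattice\<^esub>" for F
  proof -
    obtain C where C: "\<And>s t. s \<le> t \<Longrightarrow> \<bar>F t - F s\<bar> \<le> C * (unit_clamp t - unit_clamp s)" "0 \<le> C"
      using F(1) unfolding lip_lattice_simps(1) by (rule lipsE) blast
    have mono: "F s \<le> F t" if "s \<le> t" for s t using F(2) that by simp
    define c where "c = 1 / (C + 1)"
    have c: "0 < c" "c \<le> 1" "c * C \<le> 1" using C(2) by (auto simp: c_def field_simps)
    let ?G = "\<lambda>x. c * F x"
    have G: "?G \<in> lips" using F(1) lips_smult by simp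
    have "c * (F t - F s) \<le> F t - F s" "c * (F t - F s) \<le> unit_clamp t - unit_clamp s" if st: "s \<le> t" for s t
    proof -
      show "c * (F t - F s) \<le> F t - F s" using c mono[OF st] by (intro mult_left_le_one_le) auto
      have "c * (F t - F s) \<le> c * (C * (unit_clamp t - unit_clamp s))" using C(1)[OF st] c by (intro mult_left_mono) auto
      also have "\<dots> \<le> 1 * (unit_clamp t - unit_clamp s)"
        unfolding mult.assoc[symmetric] using c unit_clamp_mono[OF st] by (intro mult_right_mono) auto
      finally show "c * (F t - F s) \<le> unit_clamp t - unit_clamp s" by simp
    qed
    then have "vle lip_lattice ?G F" "vle lip_lattice ?G unit_clamp" by (simp_all add: right_diff_distrib)
    then have "vle lip_lattice ?G (F \<sqinter>\<^bsub>ord_of lip_lattice\<^esub> unit_clamp)"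
      using Lip.inf_greatest[of F unit_clamp ?G] F G unit_clamp_lips by simp
    then have "c * F t - c * F s \<le> 0" if "s \<le> t" for s t using that unfolding inf by simp
    then have "c * (F t - F s) \<le> 0" if "s \<le> t" for s t using that by (simp add: right_diff_distrib)
    then have "F t - F s \<le> 0" if "s \<le> t" for s t using that c(1) by (simp add: mult_le_0_iff)
    then have "vle lip_lattice F \<zero>\<^bsub>lip_lattice\<^esub>" by simp
    then show ?thesis using Lip.le_antisym[of F "\<zero>\<^bsub>lip_lattice\<^esub>"] F lips_zero by simp
  qed
qed auto

interpretation Lip: order_continuous_functional lip_lattice "\<lambda>F. F 1" unit_clamp
  by (rule lip_functional)

definition cut_left :: "nat \<times> nat \<Rightarrow> real" where "cut_left a = real (snd a) / real (fst a + 1)"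
definition cut_right :: "nat \<times> nat \<Rightarrow> real" where "cut_right a = real (snd a + 1) / real (fst a + 1)"
definition clamp_to :: "nat \<times> nat \<Rightarrow> real \<Rightarrow> real" where "clamp_to a t = max (cut_left a) (min (cut_right a) t)"

text \<open>In terms of integrands, \<open>cut (k, j)\<close> is multiplication by the indicator function of the interval
  \<open>[j / (k + 1), (j + 1) / (k + 1)]\<close>. The second summand makes the integral vanish at 0.\<close>

definition cut :: "nat \<times> nat \<Rightarrow> (real \<Rightarrow> real) \<Rightarrow> real \<Rightarrow> real" where
  "cut a = (\<lambda>F\<in>lips. \<lambda>t. F (clamp_to a t) - F (cut_left a))"

lemma cut_left_right: "0 \<le> cut_left a" "cut_left a < cut_right a" "cut_right a - cut_left a = 1 / real (fst a + 1)"
  by (auto simp: cut_left_def cut_right_def field_simps)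

lemma clamp_to_between:
  assumes "s \<le> t"
  shows "clamp_to a s = clamp_to a t \<or> s \<le> clamp_to a s \<and> clamp_to a s \<le> clamp_to a t \<and> clamp_to a t \<le> t"
  using assms cut_left_right(2)[of a] by (auto simp: clamp_to_def max_def min_def)

lemma clamp_to_mono: "s \<le> t \<Longrightarrow> clamp_to a s \<le> clamp_to a t"
  by (auto simp: clamp_to_def max_def min_def)

lemma cut_lips: assumes "F \<in> lips" shows "cut a F \<in> lips"
proof -
  obtain C where C: "\<And>s t. s \<le> t \<Longrightarrow> \<bar>F t - F s\<bar> \<le> C * (unit_clamp t - unit_clamp s)" "0 \<le> C"
    using assms by (rule lipsE) blast
  show ?thesis
  proof (rule lipsI[of _ C])
    show "cut a F 0 = 0" using assms cut_left_right[of a] by (simp add: cut_def clamp_to_def)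
    fix s t :: real assume st: "s \<le> t"
    have "\<bar>cut a F t - cut a F s\<bar> \<le> C * (unit_clamp (clamp_to a t) - unit_clamp (clamp_to a s))"
      using assms C(1)[OF clamp_to_mono[OF st]] by (simp add: cut_def)
    also have "\<dots> \<le> C * (unit_clamp t - unit_clamp s)"
      using clamp_to_between[OF st, of a] unit_clamp_mono[of s "clamp_to a s"] unit_clamp_mono[of "clamp_to a t" t]
        unit_clamp_mono[OF st] C(2) by (intro mult_left_mono) auto
    finally show "\<bar>cut a F t - cut a F s\<bar> \<le> C * (unit_clamp t - unit_clamp s)" .
  qed
qed

lemma cut_nonneg:
  assumes F: "F \<in> lips" "vle lip_lattice (\<lambda>x. 0) F"
  shows "vle lip_lattice (\<lambda>x. 0) (cut a F)" "vle lip_lattice (cut a F) F"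
proof -
  have mono: "F s \<le> F t" if "s \<le> t" for s t using F(2) that by simp
  show "vle lip_lattice (\<lambda>x. 0) (cut a F)" using F(1) by (simp add: cut_def mono clamp_to_mono)
  have "cut a F t - cut a F s \<le> F t - F s" if st: "s \<le> t" for s t
    using clamp_to_between[OF st, of a] mono[of s "clamp_to a s"] mono[of "clamp_to a t" t] mono[OF st] F(1)
    by (auto simp: cut_def)
  then show "vle lip_lattice (cut a F) F" by simp
qed

lemma cut_Orth: "cut a \<in> carrier (Orth lip_lattice)"
proof -
  have "linear_operator lip_lattice (cut a)" unfolding linear_operator_def
    using cut_lips by (auto simp: lips_add lips_smult) (auto simp: cut_def lips_add lips_smult algebra_simps)
  then have "orthomorphism lip_lattice (cut a)"
    by (rule Lip.orthomorphism_of_le_smult[of _ 1]) (use cut_nonneg in \<open>auto simp del: lip_lattice_simps(5)\<close>)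
  then show ?thesis by (simp add: Orth_simps(1)) (simp add: cut_def)
qed

text \<open>The density of \<open>F\<close> is bounded, and the length of the intervals tends to zero.\<close>

lemma cut_Stau: "converges Mode_Stau lip_lattice UNIV fst_le cut \<zero>\<^bsub>Orth lip_lattice\<^esub>"
proof -
  have uoL: "uoL lip_lattice = Lip.U.mtopology"
    by (rule Lip.uoL_eq[OF Lip.uo_lebesgue_udist Lip.U.Hausdorff_space_mtopology])
  have "limitin Lip.U.mtopology (\<lambda>a. cut a F) \<zero>\<^bsub>lip_lattice\<^esub> fst_filter" if F: "F \<in> lips" for F
    unfolding Lip.limitin_udist_zero
  proof (intro allI impI)
    fix \<epsilon> :: real assume \<epsilon>: "0 < \<epsilon>"
    obtain C where C: "\<And>s t. s \<le> t \<Longrightarrow> \<bar>F t - F s\<bar> \<le> C * (unit_clamp t - unit_clamp s)" "0 \<le> C"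
      using F by (rule lipsE) blast
    have small: "Lip.trunc (cut a F) \<le> C / real (fst a + 1)" for a
    proof -
      let ?G = "\<lambda>x. C * cut a unit_clamp x"
      have G: "?G \<in> lips" by (rule lips_smult[OF cut_lips[OF unit_clamp_lips]])
      have "vle lip_lattice (vabs lip_lattice (cut a F)) ?G"
      proof (rule lip_abs_le[OF cut_lips[OF F] G])
        show "\<bar>cut a F t - cut a F s\<bar> \<le> ?G t - ?G s" if "s \<le> t" for s t
          using F C(1)[OF clamp_to_mono[OF that, of a]] by (simp add: cut_def unit_clamp_lips right_diff_distrib)
      qed
      then have "(vabs lip_lattice (cut a F)) 1 \<le> ?G 1"
        using Lip.phi_mono[of "vabs lip_lattice (cut a F)" ?G] G cut_lips[OF F] Lip.abs_closed by simp
      also have "?G 1 \<le> C * (1 / real (fst a + 1))"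
      proof (rule mult_left_mono[OF _ C(2)])
        have "unit_clamp (clamp_to a 1) - unit_clamp (cut_left a) \<le> cut_right a - cut_left a"
          using cut_left_right[of a] by (auto simp: unit_clamp_def clamp_to_def max_def min_def)
        then show "cut a unit_clamp 1 \<le> 1 / real (fst a + 1)"
          unfolding cut_left_right(3) by (simp add: cut_def unit_clamp_lips)
      qed
      finally show ?thesis using Lip.trunc_le[of "cut a F"] cut_lips[OF F] by simp
    qed
    obtain k where k: "C / \<epsilon> < real k" using reals_Archimedean2 by blast
    have "C / real (m + 1) < \<epsilon>" if "k \<le> m" for m
    proof -
      have "C / \<epsilon> < real (m + 1)" using k that by linarith
      then show ?thesis using \<epsilon> by (simp add: field_simps)
    qed
    then show "\<forall>\<^sub>F a in fst_filter. cut a F \<in> carrier lip_lattice \<and> Lip.trunc (cut a F) < \<epsilon>"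
      unfolding eventually_fst_filter using cut_lips[OF F] small[of "(_, _)"]
      by (intro exI[of _ k]) (fastforce intro: le_less_trans)
  qed
  then show ?thesis by (simp add: tau_conv_def uoL Orth_simps(2))
qed

text \<open>A function that dominates a tail of the cuts of \<open>unit_clamp\<close> dominates all cuts at one level,
  and these add up to \<open>unit_clamp\<close>.\<close>

lemma cut_not_SUO: "\<not> converges Mode_SUO lip_lattice UNIV fst_le cut \<zero>\<^bsub>Orth lip_lattice\<^esub>"
proof
  let ?u = unit_clamp
  note uV = unit_clamp_lips
  assume "converges Mode_SUO lip_lattice UNIV fst_le cut \<zero>\<^bsub>Orth lip_lattice\<^esub>"
  then have "uo_conv lip_lattice UNIV fst_le (\<lambda>a. cut a ?u) \<zero>\<^bsub>lip_lattice\<^esub>"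
    using uV by (simp add: Orth_simps(2))
  then have null: "uo_null lip_lattice fst_filter (\<lambda>a. cut a ?u \<ominus>\<^bsub>lip_lattice\<^esub> \<zero>\<^bsub>lip_lattice\<^esub>)"
    by (subst (asm) Lip.uo_conv_iff[OF directed_fst_le]) (use cut_lips uV lips_zero in auto)
  have e: "cut a ?u \<ominus>\<^bsub>lip_lattice\<^esub> \<zero>\<^bsub>lip_lattice\<^esub> = cut a ?u" for a
    by (simp add: a_minus_def lip_minus[OF lips_zero])
  have u0: "vle lip_lattice (\<lambda>x. 0) ?u" by (simp add: unit_clamp_mono)
  have abs: "vabs lip_lattice (cut a ?u) \<sqinter>\<^bsub>ord_of lip_lattice\<^esub> ?u = cut a ?u" for a
  proof -
    have "vabs lip_lattice (cut a ?u) = cut a ?u"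
      using Lip.abs_of_nonneg[of "cut a ?u"] cut_nonneg[OF uV u0, of a] cut_lips[OF uV] by (simp del: lip_lattice_simps(5))
    then show ?thesis
      using Lip.inf_absorb1[of "cut a ?u" ?u] cut_nonneg[OF uV u0, of a] cut_lips[OF uV] uV by (simp del: lip_lattice_simps(5))
  qed
  obtain v where v: "v \<in> lips" "v 1 < 1" "\<forall>\<^sub>F a in fst_filter. vle lip_lattice (cut a ?u) v"
    using Lip.uo_null_ub_small[OF net_filter_ne_bot[OF directed_fst_le] _ null, of 1] cut_lips[OF uV]
    unfolding e abs by (auto simp del: lip_lattice_simps(5))
  then obtain k where k: "\<And>j. vle lip_lattice (cut (k, j) ?u) v"
    unfolding eventually_fst_filter by blast
  have step: "v (real j / real (k + 1)) + 1 / real (k + 1) \<le> v (real (j + 1) / real (k + 1))" if j: "j \<le> k" for j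
  proof -
    let ?a = "(k, j)"
    have lu: "cut_left ?a = real j / real (k + 1)" "cut_right ?a = real (j + 1) / real (k + 1)" by (auto simp: cut_left_def cut_right_def)
    have "cut_right ?a \<le> 1" using j by (simp add: cut_right_def)
    then have "?u (cut_right ?a) - ?u (cut_left ?a) = 1 / real (k + 1)"
      using cut_left_right[of ?a] by (simp add: unit_clamp_def)
    moreover have "cut ?a ?u (cut_right ?a) - cut ?a ?u (cut_left ?a) \<le> v (cut_right ?a) - v (cut_left ?a)"
      using k[of j] cut_left_right(2)[of ?a] by simp
    moreover have "cut ?a ?u (cut_right ?a) - cut ?a ?u (cut_left ?a) = ?u (cut_right ?a) - ?u (cut_left ?a)"
      using cut_left_right(2)[of ?a] uV by (simp add: cut_def clamp_to_def)
    ultimately show ?thesis by (simp only: lu)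
  qed
  have "real j / real (k + 1) \<le> v (real j / real (k + 1))" if "j \<le> k + 1" for j
    using that
  proof (induction j)
    case 0
    then show ?case using lips_0[OF v(1)] by simp
  next
    case (Suc j)
    then show ?case using step[of j] by (simp add: add_divide_distrib)
  qed
  from this[of "k + 1"] show False using v(2) by simp
qed

section \<open>The table of implications\<close>

lemma not_mode_impliesI:
  fixes E :: "(real \<Rightarrow> real) vlat" and T :: "nat \<times> nat \<Rightarrow> (real \<Rightarrow> real) \<Rightarrow> real \<Rightarrow> real"
  assumes "dvlattice E" "c1 \<in> {Mode_tau, Mode_Stau} \<or> c2 \<in> {Mode_tau, Mode_Stau} \<Longrightarrow> admits_uoL E"
    "\<And>a. T a \<in> carrier (Orth E)" "converges c1 E UNIV fst_le T \<zero>\<^bsub>Orth E\<^esub>"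
    "\<not> converges c2 E UNIV fst_le T \<zero>\<^bsub>Orth E\<^esub>"
  shows "\<not> mode_implies TYPE(real \<Rightarrow> real) TYPE(nat \<times> nat) c1 c2"
proof -
  interpret dvlattice E by fact
  have "\<zero>\<^bsub>Orth E\<^esub> \<in> carrier (Orth E)" by (rule Orth_zero_closed)
  then show ?thesis unfolding mode_implies_def using assms directed_fst_le vector_lattice dedekind_complete by blast
qed

lemma not_mode_implies_o:
  assumes "c1 \<in> {Mode_SO}"
  shows "\<not> mode_implies TYPE(real \<Rightarrow> real) TYPE(nat \<times> nat) c1 Mode_o"
  using assms finite_support_SO finite_support_not_o
  by (intro not_mode_impliesI[OF finite_support.dvlattice_fun_lattice _ finite_support.spike_Orth])
     (auto simp del: converges.simps)

lemma not_mode_implies_uo: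
  assumes "c1 \<in> {Mode_uo, Mode_SUO}" "c2 \<in> {Mode_o, Mode_SO}"
  shows "\<not> mode_implies TYPE(real \<Rightarrow> real) TYPE(nat \<times> nat) c1 c2"
proof -
  interpret L: dvlattice "fun_lattice (UNIV :: (real \<Rightarrow> real) set)" by (rule all_functions.dvlattice_fun_lattice)
  note imps = L.converges_imp[where T=all_functions.spike, OF directed_fst_le all_functions.spike_Orth L.Orth_zero_closed]
  have "converges c1 (fun_lattice UNIV) UNIV fst_le all_functions.spike \<zero>\<^bsub>Orth (fun_lattice UNIV)\<^esub>"
    using all_functions.spike_uo imps(4) assms(1) by auto
  moreover have "\<not> converges c2 (fun_lattice UNIV) UNIV fst_le all_functions.spike \<zero>\<^bsub>Orth (fun_lattice UNIV)\<^esub>"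
    using all_functions_not_SO imps(1) assms(2) by auto
  ultimately show ?thesis using assms
    by (intro not_mode_impliesI[OF L.dvlattice_axioms _ all_functions.spike_Orth]) auto
qed

lemma not_mode_implies_tau:
  assumes "c1 \<in> {Mode_tau, Mode_Stau}" "c2 \<in> {Mode_o, Mode_uo, Mode_SO, Mode_SUO}"
  shows "\<not> mode_implies TYPE(real \<Rightarrow> real) TYPE(nat \<times> nat) c1 c2"
proof -
  note imps = Lip.converges_imp[where T=cut, OF directed_fst_le cut_Orth Lip.Orth_zero_closed]
  have "converges c1 lip_lattice UNIV fst_le cut \<zero>\<^bsub>Orth lip_lattice\<^esub>"
    using cut_Stau imps(6)[OF Lip.admits_uoL_udist] assms(1) by auto
  moreover have "\<not> converges c2 lip_lattice UNIV fst_le cut \<zero>\<^bsub>Orth lip_lattice\<^esub>"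
    using cut_not_SUO imps(2,3,4) assms(2) by auto
  ultimately show ?thesis using Lip.admits_uoL_udist
    by (intro not_mode_impliesI[OF dvlattice_lip_lattice _ cut_Orth]) auto
qed

theorem mainTheorem2:
  fixes c1 c2 :: conv_mode
  shows "((c1, c2) \<in> valid_implications \<longrightarrow> mode_implies TYPE('a) TYPE('i) c1 c2) \<and>
    ((c1, c2) \<notin> valid_implications \<longrightarrow> \<not> mode_implies TYPE(real \<Rightarrow> real) TYPE(nat \<times> nat) c1 c2)"
proof (intro conjI impI)
  show "mode_implies TYPE('a) TYPE('i) c1 c2" if "(c1, c2) \<in> valid_implications"
    using that by (rule mode_implies_of_valid)
  show "\<not> mode_implies TYPE(real \<Rightarrow> real) TYPE(nat \<times> nat) c1 c2" if "(c1, c2) \<notin> valid_implications"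
    using that not_mode_implies_o[of c1] not_mode_implies_uo[of c1 c2] not_mode_implies_tau[of c1 c2]
    by (cases c1; cases c2) (auto simp: valid_implications_def)
qed

end
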